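(* Let $M$ be a simple connected binary matroid, and let $e$ and $f$ be distinct elements of $M$. Suppose that every circuit of $M$ containing $\{e,f\}$ is spanning. Then the canonical tree decomposition of $M$ is a path $\mathcal{P}$ every vertex of which is labeled by a circuit of size at least three, by $U_{1,3}$, or by $Z_r\backslash y_r$ for some $r\geq 3$, where the ends of $\mathcal{P}$ are not labeled by $U_{1,3}$.
   Context: All matroids are finite. A circuit $C$ of a matroid $M$ is spanning if $r_M(C)=r(M)$. $U_{k,n}$ denotes the uniform matroid of rank $k$ on $n$ elements. A vertex of a tree decomposition is "labeled by" a matroid $N$ if its label is isomorphic to $N$; "labeled by a circuit" of size $k$ means the label is isomorphic to $U_{k-1,k}$, and "labeled by a cocircuit" means the label is isomorphic to $U_{1,k}$ for some $k$. A path may consist of a single vertex, in which case that vertex is its only end. Spikes. For $r\geq 3$, $Z_r$ is the rank-$r$ binary spike with tip $t$: the binary matroid on $\{x_1,y_1,x_2,y_2,\dots,x_r,y_r,t\}$ represented over $\mathrm{GF}(2)$ by letting $x_1,\dots,x_r$ be the standard basis vectors of $\mathrm{GF}(2)^r$, $t$ the all-ones vector, and $y_i=x_i+t$ (so each $\{x_i,y_i,t\}$ is a triangle). 2-sums. If $M_1$ and $M_2$ are connected matroids, each with at least three elements and with $E(M_1)\cap E(M_2)=\{p\}$, then $M_1\oplus_2 M_2$ is the 2-sum with basepoint $p$: the matroid on $(E(M_1)\cup E(M_2))-\{p\}$ whose circuits are the circuits of $M_1$ avoiding $p$, the circuits of $M_2$ avoiding $p$, and all sets $(C_1\cup C_2)-\{p\}$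 where $C_i$ is a circuit of $M_i$ containing $p$. Tree decompositions. A tree decomposition of a connected matroid $M$ is a tree $\mathcal{T}$ with vertex set $\{M_1,\dots,M_k\}$, where each $M_i$ is a connected matroid (the label of that vertex), and edge set $\{e_1,\dots,e_{k-1}\}$, such that (i) $E(M)=(E(M_1)\cup\dots\cup E(M_k))-\{e_1,\dots,e_{k-1}\}$; (ii) if $M_{j_1}$ and $M_{j_2}$ are joined by an edge $e_i$, then $E(M_{j_1})\cap E(M_{j_2})=\{e_i\}$, and otherwise $E(M_{j_1})\cap E(M_{j_2})=\emptyset$; (iii) $|E(M_i)|\geq 3$ for all $i$ unless $|E(M)|<3$, in which case $k=1$ and $M_1=M$; and (iv) $M$ can be obtained from $\mathcal{T}$ by repeatedly taking an edge $e_i$ with ends $M_{j_1}$ and $M_{j_2}$, contracting $e_i$ from the current tree, and labeling the resulting composite vertex by $M_{j_1}\oplus_2 M_{j_2}$. By a theorem of Cunningham and Edmonds, every connected matroid $M$ has a tree decomposition, unique up to its edge labels, in which every vertex is labeled by a circuit, a cocircuit, or a 3-connected matroid with at least four elements, and no two adjacent vertices are both labeled by circuits or both labeled by cocircuits. This is the canonical tree decomposition of $M$. *)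

theory Defs
  imports Complex_Main "HOL-Library.Z2" "HOL-Library.Function_Algebras"
begin

section \<open>Matroids\<close>

record 'a pre_matroid =
  ground :: "'a set"
  indeps :: "'a set set"

locale matroid =
  fixes M :: "'a pre_matroid"
  assumes finite_ground: "finite (ground M)"
    and indeps_subset_ground: "I \<in> indeps M \<Longrightarrow> I \<subseteq> ground M"
    and empty_indep: "{} \<in> indeps M"
    and indep_subset: "I \<in> indeps M \<Longrightarrow> J \<subseteq> I \<Longrightarrow> J \<in> indeps M"
    and augment: "I \<in> indeps M \<Longrightarrow> J \<in> indeps M \<Longrightarrow> card I < card J
      \<Longrightarrow> \<exists>x \<in> J - I. insert x I \<in> indeps M"

definition circuit :: "'a pre_matroid \<Rightarrow> 'a set \<Rightarrow> bool" where
  "circuit M C \<longleftrightarrow> C \<subseteq> ground M \<and> C \<notin> indeps M \<and> (\<forall>D. D \<subset> C \<longrightarrow> D \<in> indeps M)"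

definition rank_of :: "'a pre_matroid \<Rightarrow> 'a set \<Rightarrow> nat" where
  "rank_of M X = Max (card ` {I \<in> indeps M. I \<subseteq> X})"

definition spanning :: "'a pre_matroid \<Rightarrow> 'a set \<Rightarrow> bool" where
  "spanning M X \<longleftrightarrow> rank_of M X = rank_of M (ground M)"

text \<open>No loops and no parallel pairs.\<close>

definition simple_matroid :: "'a pre_matroid \<Rightarrow> bool" where
  "simple_matroid M \<longleftrightarrow>
     (\<forall>x. \<not> circuit M {x}) \<and> (\<forall>x y. x \<noteq> y \<longrightarrow> \<not> circuit M {x, y})"

definition connected_matroid :: "'a pre_matroid \<Rightarrow> bool" where
  "connected_matroid M \<longleftrightarrow>
     (\<forall>x \<in> ground M. \<forall>y \<in> ground M. x \<noteq> y \<longrightarrow> (\<exists>C. circuit M C \<and> x \<in> C \<and> y \<in> C))"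

text \<open>Tutte's \<open>k\<close>-separations; the last conjunct is \<open>r(X) + r(Y) - r(M) \<le> k - 1\<close>.\<close>

definition k_separation :: "'a pre_matroid \<Rightarrow> nat \<Rightarrow> 'a set \<Rightarrow> 'a set \<Rightarrow> bool" where
  "k_separation M k X Y \<longleftrightarrow>
     X \<union> Y = ground M \<and> X \<inter> Y = {} \<and> k \<le> card X \<and> k \<le> card Y \<and>
     rank_of M X + rank_of M Y < rank_of M (ground M) + k"

definition n_connected :: "nat \<Rightarrow> 'a pre_matroid \<Rightarrow> bool" where
  "n_connected n M \<longleftrightarrow> (\<forall>k X Y. 1 \<le> k \<and> k < n \<longrightarrow> \<not> k_separation M k X Y)"

definition isomorphic :: "'a pre_matroid \<Rightarrow> 'b pre_matroid \<Rightarrow> bool" where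
  "isomorphic M N \<longleftrightarrow>
     (\<exists>h. bij_betw h (ground M) (ground N) \<and>
          (\<forall>I. I \<subseteq> ground M \<longrightarrow> (I \<in> indeps M \<longleftrightarrow> h ` I \<in> indeps N)))"

definition delete :: "'a pre_matroid \<Rightarrow> 'a set \<Rightarrow> 'a pre_matroid" where
  "delete M D = \<lparr>ground = ground M - D, indeps = {I \<in> indeps M. I \<inter> D = {}}\<rparr>"

definition uniform_matroid :: "nat \<Rightarrow> nat \<Rightarrow> nat pre_matroid" where
  "uniform_matroid k n = \<lparr>ground = {..<n}, indeps = {I. I \<subseteq> {..<n} \<and> card I \<le> k}\<rparr>"


section \<open>Binary matroids and spikes\<close>

text \<open>\<open>GF(2)\<^sup>n\<close> is rendered as the space of vectors \<open>nat \<Rightarrow> bit\<close> supported on the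
  coordinates \<open>1, \<dots>, n\<close>.\<close>

definition gf2_scale :: "bit \<Rightarrow> (nat \<Rightarrow> bit) \<Rightarrow> nat \<Rightarrow> bit" where
  "gf2_scale c v = (\<lambda>j. c * v j)"

global_interpretation gf2: vector_space gf2_scale
  by standard (simp_all only: gf2_scale_def fun_eq_iff plus_fun_def distrib_left distrib_right
      mult.assoc mult_1_left simp_thms)

definition gf2_space :: "nat \<Rightarrow> (nat \<Rightarrow> bit) set" where
  "gf2_space n = {v. \<forall>j. j \<notin> {1..n} \<longrightarrow> v j = 0}"

text \<open>The vectors are indexed by \<open>E\<close>, so a repeated vector gives a parallel pair; this is
  why injectivity is part of independence.\<close>

definition vector_matroid :: "'a set \<Rightarrow> ('a \<Rightarrow> nat \<Rightarrow> bit) \<Rightarrow> 'a pre_matroid" where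
  "vector_matroid E \<phi> =
     \<lparr>ground = E, indeps = {I. I \<subseteq> E \<and> inj_on \<phi> I \<and> gf2.independent (\<phi> ` I)}\<rparr>"

definition binary_matroid :: "'a pre_matroid \<Rightarrow> bool" where
  "binary_matroid M \<longleftrightarrow>
     (\<exists>n \<phi>. \<phi> ` ground M \<subseteq> gf2_space n \<and> M = vector_matroid (ground M) \<phi>)"

datatype spike_element = SX nat | SY nat | Tip

definition unit_vector :: "nat \<Rightarrow> nat \<Rightarrow> bit" where
  "unit_vector i = (\<lambda>j. if j = i then 1 else 0)"

definition ones_vector :: "nat \<Rightarrow> nat \<Rightarrow> bit" where
  "ones_vector r = (\<lambda>j. if j \<in> {1..r} then 1 else 0)"

fun spike_vector :: "nat \<Rightarrow> spike_element \<Rightarrow> nat \<Rightarrow> bit" where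
  "spike_vector r (SX i) = unit_vector i"
| "spike_vector r (SY i) = unit_vector i + ones_vector r"
| "spike_vector r Tip = ones_vector r"

definition binary_spike :: "nat \<Rightarrow> spike_element pre_matroid" where
  "binary_spike r = vector_matroid (SX ` {1..r} \<union> SY ` {1..r} \<union> {Tip}) (spike_vector r)"


section \<open>2-sums\<close>

definition two_summable :: "'a \<Rightarrow> 'a pre_matroid \<Rightarrow> 'a pre_matroid \<Rightarrow> bool" where
  "two_summable p M1 M2 \<longleftrightarrow>
     matroid M1 \<and> matroid M2 \<and> connected_matroid M1 \<and> connected_matroid M2 \<and>
     3 \<le> card (ground M1) \<and> 3 \<le> card (ground M2) \<and> ground M1 \<inter> ground M2 = {p}"

definition two_sum_circuits :: "'a \<Rightarrow> 'a pre_matroid \<Rightarrow> 'a pre_matroid \<Rightarrow> 'a set set" where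
  "two_sum_circuits p M1 M2 =
     {C. circuit M1 C \<and> p \<notin> C} \<union> {C. circuit M2 C \<and> p \<notin> C} \<union>
     {(C1 \<union> C2) - {p} | C1 C2. circuit M1 C1 \<and> p \<in> C1 \<and> circuit M2 C2 \<and> p \<in> C2}"

text \<open>The matroid with the above circuits; meaningful when \<open>two_summable p M1 M2\<close>.\<close>

definition two_sum :: "'a \<Rightarrow> 'a pre_matroid \<Rightarrow> 'a pre_matroid \<Rightarrow> 'a pre_matroid" where
  "two_sum p M1 M2 =
     \<lparr>ground = (ground M1 \<union> ground M2) - {p},
      indeps = {I. I \<subseteq> (ground M1 \<union> ground M2) - {p} \<and>
                   (\<forall>C \<in> two_sum_circuits p M1 M2. \<not> C \<subseteq> I)}\<rparr>"


section \<open>Tree decompositions\<close>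

text \<open>The vertices are the labelling matroids themselves, and the edges are the basepoints.
  (Two vertices with the same label cannot occur in a tree decomposition, since distinct
  labels share at most one element.) The value \<open>ends T p\<close> is the set of the two end vertices
  of \<open>p\<close>, and is irrelevant for \<open>p \<notin> edges T\<close>.\<close>

record 'a matroid_graph =
  verts :: "'a pre_matroid set"
  edges :: "'a set"
  ends :: "'a \<Rightarrow> 'a pre_matroid set"

definition adjacent :: "'a matroid_graph \<Rightarrow> 'a pre_matroid \<Rightarrow> 'a pre_matroid \<Rightarrow> bool" where
  "adjacent T u v \<longleftrightarrow> (\<exists>p \<in> edges T. ends T p = {u, v})"

definition simple_graph :: "'a matroid_graph \<Rightarrow> bool" where
  "simple_graph T \<longleftrightarrow>
     finite (verts T) \<and> finite (edges T) \<and>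
     (\<forall>p \<in> edges T. ends T p \<subseteq> verts T \<and> card (ends T p) = 2) \<and>
     inj_on (ends T) (edges T)"

definition graph_cycle :: "'a matroid_graph \<Rightarrow> 'a pre_matroid list \<Rightarrow> bool" where
  "graph_cycle T vs \<longleftrightarrow>
     3 \<le> length vs \<and> distinct vs \<and> set vs \<subseteq> verts T \<and>
     successively (adjacent T) vs \<and> adjacent T (last vs) (hd vs)"

definition is_tree :: "'a matroid_graph \<Rightarrow> bool" where
  "is_tree T \<longleftrightarrow>
     simple_graph T \<and> verts T \<noteq> {} \<and>
     (\<forall>u \<in> verts T. \<forall>v \<in> verts T. (adjacent T)\<^sup>*\<^sup>* u v) \<and>
     (\<nexists>vs. graph_cycle T vs)"

text \<open>\<open>T\<close> is a path traversing its vertices in the order \<open>vs\<close>; its ends are \<open>hd vs\<close> and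
  \<open>last vs\<close>.\<close>

definition is_path :: "'a matroid_graph \<Rightarrow> 'a pre_matroid list \<Rightarrow> bool" where
  "is_path T vs \<longleftrightarrow>
     simple_graph T \<and> vs \<noteq> [] \<and> distinct vs \<and> set vs = verts T \<and>
     ends T ` edges T = {{vs ! i, vs ! Suc i} | i. Suc i < length vs}"

definition contract_edge ::
    "'a matroid_graph \<Rightarrow> 'a \<Rightarrow> 'a pre_matroid \<Rightarrow> 'a pre_matroid \<Rightarrow> 'a matroid_graph" where
  "contract_edge T p M1 M2 =
     \<lparr>verts = insert (two_sum p M1 M2) (verts T - {M1, M2}),
      edges = edges T - {p},
      ends = (\<lambda>q. (\<lambda>N. if N \<in> {M1, M2} then two_sum p M1 M2 else N) ` ends T q)\<rparr>"

definition contract_step :: "'a matroid_graph \<Rightarrow> 'a matroid_graph \<Rightarrow> bool" where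
  "contract_step T T' \<longleftrightarrow>
     (\<exists>p M1 M2. p \<in> edges T \<and> ends T p = {M1, M2} \<and> two_summable p M1 M2 \<and>
                T' = contract_edge T p M1 M2)"

definition tree_decomposition :: "'a pre_matroid \<Rightarrow> 'a matroid_graph \<Rightarrow> bool" where
  "tree_decomposition M T \<longleftrightarrow>
     is_tree T \<and>
     (\<forall>N \<in> verts T. matroid N \<and> connected_matroid N) \<and>
     ground M = (\<Union>N \<in> verts T. ground N) - edges T \<and>
     (\<forall>N1 \<in> verts T. \<forall>N2 \<in> verts T. N1 \<noteq> N2 \<longrightarrow>
        (\<forall>p \<in> edges T. ends T p = {N1, N2} \<longrightarrow> ground N1 \<inter> ground N2 = {p}) \<and>
        (\<not> adjacent T N1 N2 \<longrightarrow> ground N1 \<inter> ground N2 = {})) \<and>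
     (if card (ground M) < 3 then verts T = {M}
      else (\<forall>N \<in> verts T. 3 \<le> card (ground N))) \<and>
     (\<exists>T'. contract_step\<^sup>*\<^sup>* T T' \<and> verts T' = {M} \<and> edges T' = {})"

definition circuit_label :: "nat \<Rightarrow> 'a pre_matroid \<Rightarrow> bool" where
  "circuit_label k N \<longleftrightarrow> 1 \<le> k \<and> isomorphic N (uniform_matroid (k - 1) k)"

definition cocircuit_label :: "nat \<Rightarrow> 'a pre_matroid \<Rightarrow> bool" where
  "cocircuit_label k N \<longleftrightarrow> 1 \<le> k \<and> isomorphic N (uniform_matroid 1 k)"

definition canonical_tree_decomposition :: "'a pre_matroid \<Rightarrow> 'a matroid_graph \<Rightarrow> bool" where
  "canonical_tree_decomposition M T \<longleftrightarrow>
     tree_decomposition M T \<and>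
     (\<forall>N \<in> verts T. (\<exists>k. circuit_label k N) \<or> (\<exists>k. cocircuit_label k N) \<or>
                    (n_connected 3 N \<and> 4 \<le> card (ground N))) \<and>
     (\<forall>N1 N2. adjacent T N1 N2 \<longrightarrow>
        \<not> ((\<exists>k. circuit_label k N1) \<and> (\<exists>k. circuit_label k N2)) \<and>
        \<not> ((\<exists>k. cocircuit_label k N1) \<and> (\<exists>k. cocircuit_label k N2)))"

end

theory Submission
  imports Defs
begin

text \<open>The argument lives in the \<open>GF(2)\<close> cycle spaces. For any edge \<open>p\<close> of the tree, the cycle space of
  \<open>M\<close> is the 2-sum of those of the two sides. If both \<open>e\<close> and \<open>f\<close> lie on one side, then the other side
  is a circuit and no circuit through \<open>e\<close> and \<open>f\<close> on the first side avoids \<open>p\<close>. Hence a leaf off the path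
  joining \<open>e\<close> to \<open>f\<close> would be a circuit, so its neighbour would not be one and would stay connected after
  deleting \<open>p\<close>, a contradiction. So the tree is a path, and every label inherits the spanning property
  for the two elements by which it meets its neighbours (or \<open>e\<close> or \<open>f\<close> at the ends). In a 3-connected label
  with this property take a spanning circuit \<open>C\<close> through the two elements \<open>p\<close> and \<open>q\<close>. Each remaining
  element is a chord separating \<open>p\<close> from \<open>q\<close> on \<open>C\<close>; the absence of 2-separations forces the sides
  containing \<open>p\<close> to differ pairwise by one exchange and to distinguish all elements of \<open>C\<close>, so either all
  chords close a triangle with \<open>p\<close> or all close a triangle with \<open>q\<close>, which is the spike.\<close>

section \<open>Binary cycle spaces and their 2-sums\<close>

text \<open>The labels arise from 2-sums taken in an arbitrary order. Cycle spaces are used because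
  the cycle space of any subtree has a closed description, by families of label cycles that agree on
  the inner edges, so the tree can be cut at whichever edge is convenient. The label U_{1,3} has its
  own origin: elements of a cocircuit label are pairwise parallel, and two of them that are not
  edges of the tree would be parallel in the simple matroid \<open>M\<close>, so at most one element
  is not an edge. A label on the path has at most two edges and an end at most one, while labels
  have at least three elements; this leaves size three and excludes the ends. The two outcomes for a
  3-connected label come from a fact on sets pairwise related by one exchange: either all share a
  core of all but one element, or all lie in a common set with one element more. The missing
  \<open>y_r\<close> reflects that no chord closes a triangle with both distinguished elements, so
  the leg of the one that is not the tip has a single element.\<close>

definition cycle_space :: "'a set \<Rightarrow> 'a set set \<Rightarrow> bool" where
  "cycle_space E K \<longleftrightarrow>
     finite E \<and> K \<subseteq> Pow E \<and> {} \<in> K \<and> (\<forall>A \<in> K. \<forall>B \<in> K. sym_diff A B \<in> K)"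

definition min_cycle :: "'a set set \<Rightarrow> 'a set \<Rightarrow> bool" where
  "min_cycle K C \<longleftrightarrow> C \<in> K \<and> C \<noteq> {} \<and> (\<forall>D \<in> K. D \<subseteq> C \<longrightarrow> D = {} \<or> D = C)"

lemma min_cycleD:
  assumes "min_cycle K C"
  shows "C \<in> K" "C \<noteq> {}" "D \<in> K \<Longrightarrow> D \<subseteq> C \<Longrightarrow> D = {} \<or> D = C"
  using assms by (auto simp: min_cycle_def)

lemma cycle_spaceD:
  assumes "cycle_space E K"
  shows "finite E" "{} \<in> K" "A \<in> K \<Longrightarrow> A \<subseteq> E" "A \<in> K \<Longrightarrow> finite A"
    "A \<in> K \<Longrightarrow> B \<in> K \<Longrightarrow> sym_diff A B \<in> K"
  using assms by (auto simp: cycle_space_def intro: finite_subset)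

lemma cycle_space_diff:
  assumes "cycle_space E K" "A \<in> K" "B \<in> K" "B \<subseteq> A"
  shows "A - B \<in> K"
proof -
  have "sym_diff A B = A - B" using assms(4) by auto
  then show ?thesis using cycle_spaceD(5)[OF assms(1-3)] by simp
qed

lemma min_cycle_subset: "cycle_space E K \<Longrightarrow> min_cycle K C \<Longrightarrow> C \<subseteq> E"
  by (auto simp: min_cycle_def cycle_space_def)

text \<open>A member of \<open>K\<close> through \<open>x\<close> of least size works: a cycle
  inside it that avoids \<open>x\<close> can be subtracted, and the remainder is a smaller member
  through \<open>x\<close>.\<close>

lemma ex_min_cycle:
  assumes K: "cycle_space E K" and Z: "Z \<in> K" "x \<in> Z"
  shows "\<exists>C. min_cycle K C \<and> x \<in> C \<and> C \<subseteq> Z"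
proof -
  let ?P = "\<lambda>D. D \<in> K \<and> x \<in> D \<and> D \<subseteq> Z"
  obtain C where C: "?P C" and least: "\<And>D. ?P D \<Longrightarrow> card C \<le> card D"
    using Z ex_has_least_nat[of ?P Z card] by blast
  have fin: "finite C" using C K cycle_spaceD(4) by blast
  have "D = {} \<or> D = C" if D: "D \<in> K" "D \<subseteq> C" for D
  proof (cases "x \<in> D")
    case True
    then show ?thesis using least[of D] D C fin by (meson card_seteq order_trans)
  next
    case False
    have "C - D \<in> K" using cycle_space_diff[OF K] C D by blast
    then have "card C \<le> card (C - D)" using least[of "C - D"] False C by blast
    then have "C - D = C" using fin by (meson Diff_subset card_seteq)
    then show ?thesis using D by blast
  qed
  then have "min_cycle K C" using C by (auto simp: min_cycle_def)
  then show ?thesis using C by blast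
qed

text \<open>Among the pairs of intersecting circuits through the two elements, one with minimal union
  must have a component of its symmetric difference containing both.\<close>

lemma min_cycle_trans:
  assumes K: "cycle_space E K"
    and "min_cycle K C1" "x \<in> C1" "min_cycle K C2" "z \<in> C2" "C1 \<inter> C2 \<noteq> {}"
  shows "\<exists>C. min_cycle K C \<and> x \<in> C \<and> z \<in> C \<and> C \<subseteq> C1 \<union> C2"
  using assms(2-)
proof (induction "card (C1 \<union> C2)" arbitrary: C1 C2 rule: less_induct)
  case less
  have fin: "finite C1" "finite C2"
    using less.prems cycle_spaceD(4)[OF K] by (auto simp: min_cycle_def)
  show ?case
  proof (cases "x \<in> C2 \<or> z \<in> C1")
    case True
    then show ?thesis using less.prems by blast
  next
    case False
    let ?S = "sym_diff C1 C2"
    have S: "?S \<in> K" using less.prems cycle_spaceD(5)[OF K] by (auto simp: min_cycle_def)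
    have xS: "x \<in> ?S" using False less.prems(2) by simp
    obtain D1 where D1: "min_cycle K D1" "x \<in> D1" "D1 \<subseteq> ?S"
      using ex_min_cycle[OF K S xS] by auto
    show ?thesis
    proof (cases "z \<in> D1")
      case True
      then show ?thesis using D1 by (intro exI[of _ D1]) auto
    next
      case zD1: False
      \<comment> \<open>Otherwise \<open>D1\<close> would be all of \<open>C1\<close>, yet it misses
        \<open>C1 \<inter> C2\<close>. So \<open>D1\<close> meets \<open>C2\<close>, and the pair
        \<open>D1\<close>, \<open>C2\<close> is again admissible.\<close>
      have "\<not> D1 \<subseteq> C1"
      proof
        assume "D1 \<subseteq> C1"
        then have "D1 = C1"
          using min_cycleD(3)[OF less.prems(1)] min_cycleD(1,2)[OF D1(1)] by auto
        then show False using D1(3) less.prems(5) by auto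
      qed
      then have meet: "D1 \<inter> C2 \<noteq> {}" using D1 by blast
      show ?thesis
      proof (cases "C1 - C2 \<subseteq> D1")
        case False
        then have "D1 \<union> C2 \<subset> C1 \<union> C2" using D1(3) by blast
        then have "card (D1 \<union> C2) < card (C1 \<union> C2)" using fin by (meson finite_UnI psubset_card_mono)
        then obtain C where "min_cycle K C" "x \<in> C" "z \<in> C" "C \<subseteq> D1 \<union> C2"
          using less.hyps[of D1 C2] D1(1,2) less.prems(3,4) meet by auto
        then show ?thesis using D1(3) by (intro exI[of _ C]) auto
      next
        case True
        \<comment> \<open>\<open>D1\<close> covers \<open>C1 - C2\<close>, so the rest of the
          symmetric difference lies in \<open>C2 - C1\<close>; a circuit there would have to be all
          of \<open>C2\<close>, which meets \<open>C1\<close>.\<close>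
        have "?S - D1 \<in> K" using cycle_space_diff[OF K S] D1 by (auto simp: min_cycle_def)
        moreover have "z \<in> ?S - D1" using zD1 less.prems(4) \<open>\<not> (x \<in> C2 \<or> z \<in> C1)\<close> by simp
        ultimately obtain D2 where D2: "min_cycle K D2" "z \<in> D2" "D2 \<subseteq> ?S - D1"
          using ex_min_cycle[OF K] by metis
        then have "D2 \<subseteq> C2 - C1" using True by blast
        moreover from this have "D2 = C2"
          using min_cycleD(3)[OF less.prems(3)] min_cycleD(1,2)[OF D2(1)] by auto
        ultimately have False using less.prems(5) by auto
        then show ?thesis ..
      qed
    qed
  qed
qed

text \<open>For \<open>F = {p}\<close> this says that the deletion of \<open>p\<close> is connected.\<close>

definition connected_space :: "'a set \<Rightarrow> 'a set \<Rightarrow> 'a set set \<Rightarrow> bool" where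
  "connected_space F E K \<longleftrightarrow> (\<forall>x. {x} \<notin> K) \<and>
     (\<forall>x \<in> E - F. \<forall>y \<in> E - F. \<exists>C. min_cycle K C \<and> x \<in> C \<and> y \<in> C \<and> C \<inter> F = {})"

lemma connected_spaceD:
  assumes "connected_space F E K"
  shows "{x} \<notin> K"
    "x \<in> E \<Longrightarrow> x \<notin> F \<Longrightarrow> y \<in> E \<Longrightarrow> y \<notin> F \<Longrightarrow>
      \<exists>C. min_cycle K C \<and> x \<in> C \<and> y \<in> C \<and> C \<inter> F = {}"
  using assms unfolding connected_space_def by blast+

text \<open>Spanning in closure form: a fundamental cycle for each outside element replaces the rank
  condition, and cycles can be restricted to one side of a 2-sum. The case \<open>e = f\<close> is
  meaningful and is used with both equal to a basepoint.\<close>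

definition pair_spanning :: "'a set \<Rightarrow> 'a set set \<Rightarrow> 'a \<Rightarrow> 'a \<Rightarrow> bool" where
  "pair_spanning E K e f \<longleftrightarrow> (\<forall>C. min_cycle K C \<longrightarrow> e \<in> C \<longrightarrow> f \<in> C \<longrightarrow>
     (\<forall>x \<in> E - C. \<exists>Z \<in> K. x \<in> Z \<and> Z \<subseteq> insert x C))"

lemma pair_spanningD:
  "pair_spanning E K e f \<Longrightarrow> min_cycle K C \<Longrightarrow> e \<in> C \<Longrightarrow> f \<in> C \<Longrightarrow> x \<in> E \<Longrightarrow> x \<notin> C \<Longrightarrow>
    \<exists>Z \<in> K. x \<in> Z \<and> Z \<subseteq> insert x C"
  unfolding pair_spanning_def by blast

lemma pair_spanning_commute: "pair_spanning E K e f \<longleftrightarrow> pair_spanning E K f e"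
  by (auto simp: pair_spanning_def)

text \<open>\<open>Z\<close> and \<open>sym_diff Z C\<close> share just \<open>x\<close> and cut
  \<open>C\<close> in two. A cycle strictly inside \<open>Z\<close>, or else its complement in
  \<open>Z\<close>, avoids \<open>x\<close> and would be a proper nonempty cycle inside the circuit
  \<open>C\<close>.\<close>

lemma chord_split:
  assumes K: "cycle_space E K" and C: "min_cycle K C" and x: "x \<notin> C" "{x} \<notin> K"
    and Z: "Z \<in> K" "x \<in> Z" "Z \<subseteq> insert x C"
  shows "min_cycle K Z" "insert x (C - Z) \<in> K" "C - Z \<noteq> {}" "Z - {x} \<noteq> {}"
proof -
  have eq: "sym_diff Z C = insert x (C - Z)" using x Z by auto
  show co: "insert x (C - Z) \<in> K"
    using eq cycle_spaceD(5)[OF K Z(1)] C by (metis min_cycle_def)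
  then show ne: "C - Z \<noteq> {}" using x by metis
  show "Z - {x} \<noteq> {}" using x Z by (metis insert_Diff)
  have "D = {} \<or> D = Z" if D: "D \<in> K" "D \<subseteq> Z" for D
  proof (cases "x \<in> D")
    case False
    then have "D \<subseteq> C" "D \<noteq> C" using D Z ne by auto
    then show ?thesis using C D by (auto simp: min_cycle_def)
  next
    case True
    have "Z - D \<in> K" using cycle_space_diff[OF K] Z D by blast
    moreover have "Z - D \<subseteq> C" "Z - D \<noteq> C" using True Z D ne by auto
    ultimately have "Z - D = {}" using C by (auto simp: min_cycle_def)
    then show ?thesis using D by blast
  qed
  then show "min_cycle K Z" using Z by (auto simp: min_cycle_def)
qed

text \<open>\<open>Z\<close> is itself a circuit through \<open>e\<close> and \<open>f\<close>,
  hence spanning, so an element \<open>b\<close> of \<open>C - Z\<close> closes a cycle with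
  \<open>Z\<close>. Clearing \<open>x\<close> from it leaves a cycle inside \<open>C\<close>, which
  must be all of \<open>C\<close> and so cannot miss a second element of \<open>C - Z\<close>. In
  effect \<open>x\<close> is parallel to \<open>b\<close>.\<close>

lemma chord_separates:
  assumes K: "cycle_space E K" and ps: "pair_spanning E K e f"
    and C: "min_cycle K C" and x: "x \<notin> C" "{x} \<notin> K"
    and Z: "Z \<in> K" "x \<in> Z" "Z \<subseteq> insert x C" "e \<in> Z" "f \<in> Z"
  shows "\<exists>b. C - Z = {b}"
proof (rule ccontr)
  assume no: "\<nexists>b. C - Z = {b}"
  note sp = chord_split[OF K C x Z(1-3)]
  obtain b where b: "b \<in> C" "b \<notin> Z" using sp(3) by auto
  then have bb: "C - Z - {b} \<noteq> {}" using no by auto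
  have "b \<in> E" using b(1) min_cycle_subset[OF K C] by auto
  then obtain Y where Y: "Y \<in> K" "b \<in> Y" "Y \<subseteq> insert b Z"
    using pair_spanningD[OF ps sp(1) Z(4,5), of b] b(2) by auto
  \<comment> \<open>\<open>Z\<close> contains \<open>x\<close> but not \<open>b\<close>, so adding
    it removes \<open>x\<close> and keeps \<open>b\<close>.\<close>
  have "\<exists>Y' \<in> K. b \<in> Y' \<and> Y' \<subseteq> insert b (Z - {x})"
  proof (cases "x \<in> Y")
    case True
    have "sym_diff Y Z \<in> K" using cycle_spaceD(5)[OF K Y(1) Z(1)] .
    moreover have "b \<in> sym_diff Y Z" "sym_diff Y Z \<subseteq> insert b (Z - {x})"
      using Y(2,3) Z(2) b(2) True by auto
    ultimately show ?thesis by (intro bexI[of _ "sym_diff Y Z"] conjI)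
  next
    case False
    then have "Y \<subseteq> insert b (Z - {x})" using Y(3) by auto
    then show ?thesis using Y(1,2) by (intro bexI[of _ Y] conjI)
  qed
  then obtain Y' where Y': "Y' \<in> K" "b \<in> Y'" "Y' \<subseteq> insert b (Z - {x})" by auto
  then have "Y' \<subseteq> C" using Z(3) b(1) by auto
  moreover have "Y' \<noteq> C" using Y'(3) bb by auto
  ultimately show False using min_cycleD(3)[OF C Y'(1)] Y'(2) by auto
qed

text \<open>The linear form of the 2-sum: closure under symmetric difference can be checked
  componentwise, without sorting circuits into kinds. \<open>cycles_two_sum\<close> identifies it
  with the cycles of \<open>two_sum\<close>.\<close>

definition two_sum_space :: "'a \<Rightarrow> 'a set set \<Rightarrow> 'a set set \<Rightarrow> 'a set set" where
  "two_sum_space p K1 K2 = {(Z1 \<union> Z2) - {p} | Z1 Z2. Z1 \<in> K1 \<and> Z2 \<in> K2 \<and> (p \<in> Z1 \<longleftrightarrow> p \<in> Z2)}"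

lemma two_sum_space_commute: "two_sum_space p K1 K2 = two_sum_space p K2 K1"
  unfolding two_sum_space_def by blast

locale space_sum =
  fixes p :: 'a and E1 E2 :: "'a set" and K1 K2 :: "'a set set"
  assumes cs1: "cycle_space E1 K1" and cs2: "cycle_space E2 K2"
    and meet: "E1 \<inter> E2 = {p}" and loop1: "{p} \<notin> K1" and loop2: "{p} \<notin> K2"
begin

abbreviation "K \<equiv> two_sum_space p K1 K2"
abbreviation "E \<equiv> E1 \<union> E2 - {p}"

lemma swap: "space_sum p E2 E1 K2 K1"
  using cs1 cs2 meet loop1 loop2 by unfold_locales auto

lemma memI: "Z1 \<in> K1 \<Longrightarrow> Z2 \<in> K2 \<Longrightarrow> p \<in> Z1 \<longleftrightarrow> p \<in> Z2 \<Longrightarrow> (Z1 \<union> Z2) - {p} \<in> K"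
  unfolding two_sum_space_def by blast

text \<open>As \<open>E1\<close> and \<open>E2\<close> meet only in \<open>p\<close>, the components
  of \<open>Z\<close> can be read off from its traces up to \<open>p\<close>; later arguments rest
  on the last two equations.\<close>

lemma memE:
  assumes "Z \<in> K"
  obtains Z1 Z2 where "Z1 \<in> K1" "Z2 \<in> K2" "p \<in> Z1 \<longleftrightarrow> p \<in> Z2" "Z = (Z1 \<union> Z2) - {p}"
    "Z1 \<subseteq> E1" "Z2 \<subseteq> E2" "Z \<inter> E1 = Z1 - {p}" "Z \<inter> E2 = Z2 - {p}"
proof -
  obtain Z1 Z2 where Z: "Z1 \<in> K1" "Z2 \<in> K2" "p \<in> Z1 \<longleftrightarrow> p \<in> Z2" "Z = (Z1 \<union> Z2) - {p}"
    using assms unfolding two_sum_space_def by blast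
  moreover have "Z1 \<subseteq> E1" "Z2 \<subseteq> E2" using Z cs1 cs2 by (auto dest: cycle_spaceD)
  ultimately show ?thesis using that meet by blast
qed

lemma left_memI: "Z \<in> K1 \<Longrightarrow> p \<notin> Z \<Longrightarrow> Z \<in> K"
  using memI[of Z "{}"] cycle_spaceD(2)[OF cs2] by auto

lemma sum_space: "cycle_space E K"
  unfolding cycle_space_def
proof (intro conjI ballI)
  show "finite E" using cs1 cs2 by (auto dest: cycle_spaceD)
  show "{} \<in> K" using left_memI cycle_spaceD(2)[OF cs1] by blast
  show "K \<subseteq> Pow E" by (rule subsetI, erule memE) blast
  fix A B assume "A \<in> K" "B \<in> K"
  obtain A1 A2 where A: "A1 \<in> K1" "A2 \<in> K2" "p \<in> A1 \<longleftrightarrow> p \<in> A2" "A = (A1 \<union> A2) - {p}"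
    "A1 \<subseteq> E1" "A2 \<subseteq> E2" "A \<inter> E1 = A1 - {p}" "A \<inter> E2 = A2 - {p}"
    by (rule memE[OF \<open>A \<in> K\<close>])
  obtain B1 B2 where B: "B1 \<in> K1" "B2 \<in> K2" "p \<in> B1 \<longleftrightarrow> p \<in> B2" "B = (B1 \<union> B2) - {p}"
    "B1 \<subseteq> E1" "B2 \<subseteq> E2" "B \<inter> E1 = B1 - {p}" "B \<inter> E2 = B2 - {p}"
    by (rule memE[OF \<open>B \<in> K\<close>])
  have "sym_diff A B = (sym_diff A1 B1 \<union> sym_diff A2 B2) - {p}"
  proof (rule set_eqI)
    fix x
    show "x \<in> sym_diff A B \<longleftrightarrow> x \<in> (sym_diff A1 B1 \<union> sym_diff A2 B2) - {p}"
    proof (cases "x \<in> E1 \<and> x \<noteq> p")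
      case True
      then have "x \<notin> A2" "x \<notin> B2" using A(6) B(6) meet by auto
      then show ?thesis unfolding A(4) B(4) using True by simp
    next
      case False
      then have "x \<notin> A1 \<and> x \<notin> B1 \<or> x = p" using A(5) B(5) by auto
      then show ?thesis unfolding A(4) B(4) by auto
    qed
  qed
  moreover have "\<dots> \<in> K"
    by (rule memI) (use A B cycle_spaceD(5)[OF cs1] cycle_spaceD(5)[OF cs2] in auto)
  ultimately show "sym_diff A B \<in> K" by simp
qed

lemma left_min_cycle:
  assumes "min_cycle K1 C" "p \<notin> C"
  shows "min_cycle K C"
proof -
  have CE: "C \<subseteq> E1" using min_cycle_subset[OF cs1] assms(1) by auto
  have "D = {} \<or> D = C" if "D \<in> K" "D \<subseteq> C" for D
  proof -
    obtain Z1 Z2 where Z: "Z1 \<in> K1" "Z2 \<in> K2" "p \<in> Z1 \<longleftrightarrow> p \<in> Z2" "D = (Z1 \<union> Z2) - {p}"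
      "Z1 \<subseteq> E1" "Z2 \<subseteq> E2" "D \<inter> E1 = Z1 - {p}" "D \<inter> E2 = Z2 - {p}"
      by (rule memE[OF \<open>D \<in> K\<close>])
    have "Z2 - {p} \<subseteq> E1 \<inter> E2" using Z(8) that(2) CE by auto
    then have "Z2 \<subseteq> {p}" using meet by auto
    then have "Z2 = {}" using loop2 Z(2) by (metis subset_singletonD)
    then have "D = Z1" using Z(3,4) by auto
    then show ?thesis using assms that Z(1) by (auto simp: min_cycle_def)
  qed
  then show ?thesis using assms left_memI by (auto simp: min_cycle_def)
qed

text \<open>A cycle inside the glued set has components inside \<open>C1\<close> and
  \<open>C2\<close>, each empty or full, and agreement at \<open>p\<close> makes both empty or both
  full.\<close>

lemma joined_min_cycle:
  assumes "min_cycle K1 C1" "p \<in> C1" "min_cycle K2 C2" "p \<in> C2"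
  shows "min_cycle K ((C1 \<union> C2) - {p})"
proof -
  let ?C = "(C1 \<union> C2) - {p}"
  have CE: "C1 \<subseteq> E1" "C2 \<subseteq> E2" "C1 \<in> K1" "C2 \<in> K2"
    using assms cs1 cs2 by (auto simp: min_cycle_def dest: cycle_spaceD)
  have "C1 \<noteq> {p}" using CE(3) loop1 by auto
  then have ne: "?C \<noteq> {}" using assms(2) by auto
  have "D = {} \<or> D = ?C" if "D \<in> K" "D \<subseteq> ?C" for D
  proof -
    obtain Z1 Z2 where Z: "Z1 \<in> K1" "Z2 \<in> K2" "p \<in> Z1 \<longleftrightarrow> p \<in> Z2" "D = (Z1 \<union> Z2) - {p}"
      "Z1 \<subseteq> E1" "Z2 \<subseteq> E2" "D \<inter> E1 = Z1 - {p}" "D \<inter> E2 = Z2 - {p}"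
      by (rule memE[OF \<open>D \<in> K\<close>])
    have "D \<inter> E1 \<subseteq> C1 \<union> (E1 \<inter> E2)" "D \<inter> E2 \<subseteq> C2 \<union> (E1 \<inter> E2)"
      using that(2) CE(1,2) by auto
    then have "Z1 - {p} \<subseteq> C1 \<union> (E1 \<inter> E2)" "Z2 - {p} \<subseteq> C2 \<union> (E1 \<inter> E2)"
      using Z(7,8) by simp_all
    then have "Z1 \<subseteq> C1" "Z2 \<subseteq> C2" using meet assms(2,4) by auto
    then have "Z1 = {} \<or> Z1 = C1" "Z2 = {} \<or> Z2 = C2"
      using min_cycleD(3)[OF assms(1) Z(1)] min_cycleD(3)[OF assms(3) Z(2)] by auto
    then show ?thesis using Z(3,4) assms(2,4) by auto
  qed
  moreover have "?C \<in> K" using memI[OF CE(3,4)] assms(2,4) by simp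
  ultimately show ?thesis using ne unfolding min_cycle_def by blast
qed

text \<open>Gluing on a circuit of the right side through \<open>p\<close> extends a circuit without
  changing its trace on \<open>E1\<close>; connectedness of the right side lets the extension pass
  through a chosen \<open>y\<close>.\<close>

lemma left_lift:
  assumes C1: "min_cycle K1 C1" and con2: "connected_space {} E2 K2"
  shows "\<exists>C. min_cycle K C \<and> C1 - {p} \<subseteq> C \<and> C \<subseteq> C1 \<union> E2 \<and> C \<inter> E1 = C1 - {p} \<and>
    (y \<in> E2 \<and> p \<in> C1 \<and> y \<noteq> p \<longrightarrow> y \<in> C)"
proof (cases "p \<in> C1")
  case False
  have "C1 \<subseteq> E1" using min_cycle_subset[OF cs1] C1 by auto
  then show ?thesis using left_min_cycle[OF C1 False] False by (intro exI[of _ C1]) auto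
next
  case True
  have pE: "p \<in> E2" "p \<in> E1" using meet by auto
  \<comment> \<open>For \<open>y\<close> outside \<open>E2\<close> nothing is demanded, and
    \<open>p\<close> can serve as the substitute.\<close>
  obtain y' where y': "y' \<in> E2" "y \<in> E2 \<longrightarrow> y' = y" using pE by blast
  obtain C2 where C2: "min_cycle K2 C2" "p \<in> C2" "y' \<in> C2"
    using connected_spaceD(2)[OF con2, of p y'] pE y' by auto
  have "C1 \<subseteq> E1" "C2 \<subseteq> E2" using C1 C2 cs1 cs2 by (auto simp: min_cycle_def dest: cycle_spaceD)
  then have "((C1 \<union> C2) - {p}) \<inter> E1 = C1 - {p}" "(C1 \<union> C2) - {p} \<subseteq> C1 \<union> E2" using meet by auto
  then show ?thesis using joined_min_cycle[OF C1 True C2(1,2)] C2 y'(2)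
    by (intro exI[of _ "(C1 \<union> C2) - {p}"]) auto
qed

text \<open>Only the left half of a circuit can meet \<open>F\<close>, and there \<open>con1\<close>
  supplies circuits through \<open>p\<close> that avoid it. This carries connectivity after a
  deletion from one label to a whole subtree.\<close>

lemma sum_connected:
  assumes con1: "connected_space F E1 K1" and con2: "connected_space {} E2 K2"
    and F: "F \<subseteq> E1" "p \<notin> F"
  shows "connected_space F E K"
  unfolding connected_space_def
proof (intro conjI allI ballI)
  have pE: "p \<in> E2" "p \<in> E1" using meet by auto
  fix x show "{x} \<notin> K"
  proof
    assume "{x} \<in> K"
    obtain Z1 Z2 where Z: "Z1 \<in> K1" "Z2 \<in> K2" "p \<in> Z1 \<longleftrightarrow> p \<in> Z2" "{x} = (Z1 \<union> Z2) - {p}"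
      "Z1 \<subseteq> E1" "Z2 \<subseteq> E2" "{x} \<inter> E1 = Z1 - {p}" "{x} \<inter> E2 = Z2 - {p}"
      by (rule memE[OF \<open>{x} \<in> K\<close>])
    have nl: "{x} \<notin> K1" "{x} \<notin> K2" using con1 con2 by (auto simp: connected_space_def)
    have "x \<notin> E1 \<or> x \<notin> E2 \<or> x = p" using meet by auto
    then have "{x} \<inter> E1 \<subseteq> {p} \<or> {x} \<inter> E2 \<subseteq> {p}" by auto
    then have "Z1 - {p} \<subseteq> {p} \<or> Z2 - {p} \<subseteq> {p}" using Z(7,8) by simp
    then have "Z1 \<subseteq> {p} \<or> Z2 \<subseteq> {p}" by auto
    then have "Z1 = {} \<or> Z2 = {}" using loop1 loop2 Z(1,2) by (metis subset_singletonD)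
    then have "Z1 = {x} \<or> Z2 = {x}" using Z(3,4) by auto
    then show False using nl Z(1,2) by auto
  qed
next
  have pE: "p \<in> E2" "p \<in> E1" using meet by auto
  have FE: "F \<inter> E2 = {}" using F meet by auto
  fix x y assume x: "x \<in> E - F" and y: "y \<in> E - F"
  have mixed: "\<exists>C. min_cycle K C \<and> x \<in> C \<and> y \<in> C \<and> C \<inter> F = {}"
    if a: "x \<in> E1" "y \<in> E2" "x \<in> E" "y \<in> E" "x \<notin> F" for x y
  proof -
    obtain C1 where C1: "min_cycle K1 C1" "x \<in> C1" "p \<in> C1" "C1 \<inter> F = {}"
      using connected_spaceD(2)[OF con1, of x p] a(1,5) pE F by auto
    obtain C where "min_cycle K C" "C1 - {p} \<subseteq> C" "C \<subseteq> C1 \<union> E2" "y \<in> C"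
      using left_lift[OF C1(1) con2, of y] a(2,4) C1(3) by (metis DiffD2 singletonI)
    then show ?thesis using a FE C1 by (intro exI[of _ C]) auto
  qed
  consider "x \<in> E1" "y \<in> E1" | "x \<in> E1" "y \<in> E2" | "x \<in> E2" "y \<in> E1" | "x \<in> E2" "y \<in> E2"
    using x y by blast
  then show "\<exists>C. min_cycle K C \<and> x \<in> C \<and> y \<in> C \<and> C \<inter> F = {}"
  proof cases
    case 1
    obtain C1 where C1: "min_cycle K1 C1" "x \<in> C1" "y \<in> C1" "C1 \<inter> F = {}"
      using connected_spaceD(2)[OF con1, of x y] x y 1 by auto
    obtain C where "min_cycle K C" "C1 - {p} \<subseteq> C" "C \<subseteq> C1 \<union> E2"
      using left_lift[OF C1(1) con2, of y] by auto
    then show ?thesis using x y FE C1 by (intro exI[of _ C]) auto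
  next
    case 2 then show ?thesis using mixed x y by auto
  next
    case 3 then show ?thesis using mixed[of y x] x y by auto
  next
    case 4
    obtain C2 where C2: "min_cycle K2 C2" "x \<in> C2" "y \<in> C2"
      using connected_spaceD(2)[OF con2, of x y] 4 by auto
    have C2E: "C2 \<subseteq> E2" using min_cycle_subset[OF cs2] C2 by auto
    show ?thesis
    proof (cases "p \<in> C2")
      case False
      then have "min_cycle K C2"
        using space_sum.left_min_cycle[OF swap C2(1)] by (simp add: two_sum_space_commute)
      then show ?thesis using C2 C2E FE by (intro exI[of _ C2]) auto
    next
      case True
      obtain C1 where C1: "min_cycle K1 C1" "p \<in> C1" "C1 \<inter> F = {}"
        using connected_spaceD(2)[OF con1, of p p] pE F by auto
      show ?thesis using joined_min_cycle[OF C1(1,2) C2(1) True] C2 C1 C2E FE x y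
        by (intro exI[of _ "(C1 \<union> C2) - {p}"]) auto
    qed
  qed
qed

text \<open>The basepoint stands in for \<open>f\<close>: a circuit through \<open>e\<close> and
  \<open>p\<close> lifts to one through \<open>e\<close> and \<open>f\<close>, which spans, and the
  left components of the resulting cycles are the ones required.\<close>

lemma pair_spanning_left:
  assumes ps: "pair_spanning E K e f" and f: "f \<in> E2" "f \<noteq> p" and e: "e \<noteq> p"
    and con2: "connected_space {} E2 K2"
  shows "pair_spanning E1 K1 e p"
  unfolding pair_spanning_def
proof (intro allI impI ballI)
  have pE: "p \<in> E2" "p \<in> E1" using meet by auto
  fix C1 x assume C1: "min_cycle K1 C1" "e \<in> C1" "p \<in> C1" and x: "x \<in> E1 - C1"
  obtain C where C: "min_cycle K C" "C1 - {p} \<subseteq> C" "C \<inter> E1 = C1 - {p}" "f \<in> C"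
    using left_lift[OF C1(1) con2, of f] C1 f by auto
  have xE: "x \<in> E - C" using x C(3) C1(3) by auto
  obtain Z where Z: "Z \<in> K" "x \<in> Z" "Z \<subseteq> insert x C"
    using pair_spanningD[OF ps C(1), of x] C C1 xE e by auto
  obtain Z1 Z2 where Z1: "Z1 \<in> K1" "Z2 \<in> K2" "p \<in> Z1 \<longleftrightarrow> p \<in> Z2" "Z = (Z1 \<union> Z2) - {p}"
    "Z1 \<subseteq> E1" "Z2 \<subseteq> E2" "Z \<inter> E1 = Z1 - {p}" "Z \<inter> E2 = Z2 - {p}"
    by (rule memE[OF \<open>Z \<in> K\<close>])
  show "\<exists>Z\<in>K1. x \<in> Z \<and> Z \<subseteq> insert x C1"
  proof (intro bexI conjI)
    show "x \<in> Z1" using Z1(7) Z(2) x by auto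
    have "Z1 - {p} \<subseteq> insert x C \<inter> E1" using Z1(7) Z(3) by auto
    then have "Z1 - {p} \<subseteq> insert x (C1 - {p})" using C(3) by auto
    then show "Z1 \<subseteq> insert x C1" using C1(3) by auto
  qed (rule Z1(1))
qed

text \<open>A circuit through \<open>e\<close> and \<open>f\<close> that avoids \<open>p\<close>
  would span the 2-sum while living on the left, so every other right element would be parallel to
  \<open>p\<close>; two of them would form a parallel pair of the 2-sum.\<close>

lemma no_avoiding:
  assumes ps: "pair_spanning E K e f"
    and simple: "\<And>x y. x \<noteq> y \<Longrightarrow> {x, y} \<notin> K" and big: "3 \<le> card E2"
    and C1: "min_cycle K1 C1" "e \<in> C1" "f \<in> C1"
    and con2: "connected_space {} E2 K2"
  shows "p \<in> C1"
proof (rule ccontr)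
  assume p: "p \<notin> C1"
  have C1E: "C1 \<subseteq> E1" using min_cycle_subset[OF cs1] C1 by auto
  have par: "{x, p} \<in> K2" if x: "x \<in> E2 - {p}" for x
  proof -
    have "min_cycle K C1" using left_min_cycle[OF C1(1) p] .
    moreover have "x \<in> E - C1" using x C1E meet by auto
    ultimately obtain Z where Z: "Z \<in> K" "x \<in> Z" "Z \<subseteq> insert x C1"
      using pair_spanningD[OF ps, of C1 x] C1 by auto
    obtain Z1 Z2 where Z2: "Z1 \<in> K1" "Z2 \<in> K2" "p \<in> Z1 \<longleftrightarrow> p \<in> Z2" "Z = (Z1 \<union> Z2) - {p}"
      "Z1 \<subseteq> E1" "Z2 \<subseteq> E2" "Z \<inter> E1 = Z1 - {p}" "Z \<inter> E2 = Z2 - {p}"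
      by (rule memE[OF \<open>Z \<in> K\<close>])
    have "C1 \<inter> E2 \<subseteq> {p}" using C1E meet by auto
    then have "Z2 \<subseteq> {x, p}" "x \<in> Z2" using Z(2,3) Z2(8) x by auto
    moreover have "Z2 \<noteq> {x}" using connected_spaceD(1)[OF con2] Z2(2) by auto
    ultimately have "Z2 = {x, p}" by auto
    then show ?thesis using Z2(2) by simp
  qed
  have "finite E2" "p \<in> E2" using cs2 meet by (auto dest: cycle_spaceD)
  then have "2 \<le> card (E2 - {p})" using big by (simp add: card_Diff_singleton_if)
  then obtain x y where xy: "x \<in> E2 - {p}" "y \<in> E2 - {p}" "x \<noteq> y"
    by (meson card_2_iff' obtain_subset_with_card_n subsetD)
  have "sym_diff {x, p} {y, p} \<in> K2"
    by (rule cycle_spaceD(5)[OF cs2 par[OF xy(1)] par[OF xy(2)]])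
  moreover have "sym_diff {x, p} {y, p} = {x, y}" using xy by auto
  ultimately have "{x, y} \<in> K"
    using space_sum.left_memI[OF swap, of "{x, y}"] xy by (auto simp: two_sum_space_commute)
  then show False using simple xy by blast
qed

text \<open>Any circuit \<open>C2\<close> through \<open>p\<close> on the right completes one
  through \<open>e\<close>, \<open>f\<close> and \<open>p\<close> on the left, so it spans the right
  side. An element outside \<open>C2\<close> would then be parallel to a member of
  \<open>C2 - {p}\<close>, against simplicity.\<close>

lemma right_is_circuit:
  assumes ps: "pair_spanning E K e f"
    and simple: "\<And>x y. x \<noteq> y \<Longrightarrow> {x, y} \<notin> K" and big: "3 \<le> card E2"
    and e: "e \<in> E1" "e \<noteq> p" and f: "f \<in> E1" "f \<noteq> p"
    and con1: "connected_space {} E1 K1" and con2: "connected_space {} E2 K2"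
  shows "min_cycle K2 E2"
proof -
  have pE: "p \<in> E2" "p \<in> E1" using meet by auto
  obtain C1 where C1: "min_cycle K1 C1" "e \<in> C1" "f \<in> C1"
    using connected_spaceD(2)[OF con1, of e f] e f by auto
  have pC1: "p \<in> C1" using no_avoiding[OF ps simple big C1 con2] by blast
  have C1E: "C1 \<subseteq> E1" using min_cycle_subset[OF cs1] C1 by auto
  have spans: "pair_spanning E2 K2 p p"
    unfolding pair_spanning_def
  proof (intro allI impI ballI)
    fix C2 x assume C2: "min_cycle K2 C2" "p \<in> C2" and x: "x \<in> E2 - C2"
    let ?C = "(C1 \<union> C2) - {p}"
    have C1m: "C1 \<inter> E2 \<subseteq> {p}" using C1E meet by auto
    have "min_cycle K ?C" using joined_min_cycle[OF C1(1) pC1 C2] .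
    moreover have "x \<in> E - ?C" using x C1m C2(2) by auto
    ultimately obtain Z where Z: "Z \<in> K" "x \<in> Z" "Z \<subseteq> insert x ?C"
      using pair_spanningD[OF ps, of ?C x] C1 e f by auto
    obtain Z1 Z2 where Z2: "Z1 \<in> K1" "Z2 \<in> K2" "p \<in> Z1 \<longleftrightarrow> p \<in> Z2" "Z = (Z1 \<union> Z2) - {p}"
      "Z1 \<subseteq> E1" "Z2 \<subseteq> E2" "Z \<inter> E1 = Z1 - {p}" "Z \<inter> E2 = Z2 - {p}"
      by (rule memE[OF \<open>Z \<in> K\<close>])
    have "Z2 - {p} \<subseteq> insert x ?C \<inter> E2" using Z(3) Z2(8) by auto
    then have "Z2 \<subseteq> insert x C2" using C1m C2(2) by auto
    moreover have "x \<in> Z2" using Z(2) x Z2(8) C2(2) by auto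
    ultimately show "\<exists>Z \<in> K2. x \<in> Z \<and> Z \<subseteq> insert x C2" using Z2(2) by auto
  qed
  obtain C2 where C2: "min_cycle K2 C2" "p \<in> C2"
    using connected_spaceD(2)[OF con2, of p p] pE by auto
  have C2E: "C2 \<subseteq> E2" using min_cycle_subset[OF cs2] C2 by auto
  have "E2 - C2 = {}"
  proof (rule ccontr)
    assume "E2 - C2 \<noteq> {}"
    then obtain x where x: "x \<in> E2" "x \<notin> C2" by auto
    have nl: "{x} \<notin> K2" using connected_spaceD(1)[OF con2] .
    obtain Z0 where Z0: "Z0 \<in> K2" "x \<in> Z0" "Z0 \<subseteq> insert x C2"
      using pair_spanningD[OF spans C2(1,2,2) x] by auto
    \<comment> \<open>Of the two cycles that the chord \<open>x\<close> forms with
      \<open>C2\<close>, one contains \<open>p\<close>; \<open>chord_separates\<close> is applied to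
      it with both distinguished elements equal to \<open>p\<close>.\<close>
    have "\<exists>Z \<in> K2. x \<in> Z \<and> Z \<subseteq> insert x C2 \<and> p \<in> Z"
    proof (cases "p \<in> Z0")
      case False
      have "insert x (C2 - Z0) \<in> K2" using chord_split(2)[OF cs2 C2(1) x(2) nl Z0] .
      then show ?thesis using C2(2) False by (intro bexI[of _ "insert x (C2 - Z0)"]) auto
    qed (use Z0 in auto)
    then obtain Z where Z: "Z \<in> K2" "x \<in> Z" "Z \<subseteq> insert x C2" "p \<in> Z" by auto
    obtain b where b: "C2 - Z = {b}"
      using chord_separates[OF cs2 spans C2(1) x(2) nl Z Z(4)] by auto
    have "{x, b} \<in> K2" using chord_split(2)[OF cs2 C2(1) x(2) nl Z(1-3)] b by simp
    moreover have "p \<notin> {x, b}" "x \<noteq> b" using x(2) C2(2) Z(4) b by auto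
    ultimately show False
      using space_sum.left_memI[OF swap, of "{x, b}"] simple[of x b]
      by (simp add: two_sum_space_commute)
  qed
  then show ?thesis using C2 C2E by (metis Diff_eq_empty_iff subset_antisym)
qed

end

section \<open>Cycles of binary matroids\<close>

context matroid
begin

lemma rank_of_attained:
  shows "\<exists>I \<in> indeps M. I \<subseteq> X \<and> card I = rank_of M X"
    and "I \<in> indeps M \<Longrightarrow> I \<subseteq> X \<Longrightarrow> card I \<le> rank_of M X"
proof -
  have "{I \<in> indeps M. I \<subseteq> X} \<subseteq> Pow (ground M)"
    using indeps_subset_ground by auto
  then have fin: "finite {I \<in> indeps M. I \<subseteq> X}"
    using finite_ground by (meson finite_Pow_iff finite_subset)
  have "{} \<in> {I \<in> indeps M. I \<subseteq> X}" using empty_indep by auto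
  then have "rank_of M X \<in> card ` {I \<in> indeps M. I \<subseteq> X}"
    unfolding rank_of_def by (intro Max_in) (use fin in auto)
  then obtain J where "J \<in> indeps M" "J \<subseteq> X" "rank_of M X = card J" by auto
  then show "\<exists>I \<in> indeps M. I \<subseteq> X \<and> card I = rank_of M X" by metis
  show "I \<in> indeps M \<Longrightarrow> I \<subseteq> X \<Longrightarrow> card I \<le> rank_of M X"
    unfolding rank_of_def by (rule Max_ge) (use fin in auto)
qed

lemma dependent_contains_circuit:
  assumes X: "X \<subseteq> ground M" "X \<notin> indeps M"
  shows "\<exists>C. circuit M C \<and> C \<subseteq> X"
proof -
  have fin: "finite X" using X finite_ground finite_subset by blast
  obtain C where C: "C \<subseteq> X" "C \<notin> indeps M"
    and least: "\<And>D. D \<subseteq> X \<Longrightarrow> D \<notin> indeps M \<Longrightarrow> card C \<le> card D"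
    using ex_has_least_nat[of "\<lambda>D. D \<subseteq> X \<and> D \<notin> indeps M" X card] X by auto
  have "D \<in> indeps M" if "D \<subset> C" for D
  proof (rule ccontr)
    assume "D \<notin> indeps M"
    then have "card C \<le> card D" using least that C by auto
    then show False using psubset_card_mono[OF _ that] C fin finite_subset by fastforce
  qed
  then have "circuit M C" using C X by (auto simp: circuit_def)
  then show ?thesis using C by blast
qed

end

text \<open>A matroid is binary iff no nonempty member of the span of its circuits is independent; unlike a
  representation, this criterion passes to the summands of a 2-sum.\<close>

inductive_set cycles :: "'a pre_matroid \<Rightarrow> 'a set set" for M where
  empty: "{} \<in> cycles M"
| step: "Z \<in> cycles M \<Longrightarrow> circuit M C \<Longrightarrow> sym_diff Z C \<in> cycles M"

definition cycles_dependent :: "'a pre_matroid \<Rightarrow> bool" where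
  "cycles_dependent M \<longleftrightarrow> (\<forall>Z \<in> cycles M. Z \<noteq> {} \<longrightarrow> Z \<notin> indeps M)"

lemma circuit_in_cycles: "circuit M C \<Longrightarrow> C \<in> cycles M"
  using cycles.step[OF cycles.empty, of M C] by simp

lemma cycles_subset_ground: "Z \<in> cycles M \<Longrightarrow> Z \<subseteq> ground M"
  by (induction rule: cycles.induct) (auto simp: circuit_def)

lemma sym_diff_assoc: "sym_diff A (sym_diff B C) = sym_diff (sym_diff A B) C"
  by auto

lemma cycles_sym_diff: "B \<in> cycles M \<Longrightarrow> A \<in> cycles M \<Longrightarrow> sym_diff A B \<in> cycles M"
proof (induction arbitrary: A rule: cycles.induct)
  case (step Z C)
  then show ?case using cycles.step[of "sym_diff A Z" M C] by (simp only: sym_diff_assoc)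
qed simp

lemma cycle_space_cycles: "matroid M \<Longrightarrow> cycle_space (ground M) (cycles M)"
  unfolding cycle_space_def
proof (intro conjI ballI)
  show "cycles M \<subseteq> Pow (ground M)" using cycles_subset_ground by auto
qed (use matroid.finite_ground cycles.empty cycles_sym_diff in auto)

section \<open>Matroids whose nonempty cycles are dependent\<close>

locale gf2_matroid = matroid M for M :: "'a pre_matroid" +
  assumes cyc_dep: "cycles_dependent M"
begin

lemma space: "cycle_space (ground M) (cycles M)"
  by (rule cycle_space_cycles) unfold_locales

lemma contains_circuit: "Z \<in> cycles M \<Longrightarrow> Z \<noteq> {} \<Longrightarrow> \<exists>C. circuit M C \<and> C \<subseteq> Z"
  by (rule dependent_contains_circuit[OF cycles_subset_ground])
    (use cyc_dep in \<open>auto simp: cycles_dependent_def\<close>)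

lemma circuit_nonempty: "circuit M C \<Longrightarrow> C \<noteq> {}"
  using empty_indep by (auto simp: circuit_def)

text \<open>A nonempty cycle is dependent and so contains a circuit; this gives both
  directions.\<close>

lemma min_cycle_iff: "min_cycle (cycles M) C \<longleftrightarrow> circuit M C"
proof
  assume C: "min_cycle (cycles M) C"
  then obtain D where D: "circuit M D" "D \<subseteq> C"
    using contains_circuit min_cycleD by metis
  then have "D = C" using min_cycleD(3)[OF C] circuit_in_cycles circuit_nonempty by metis
  then show "circuit M C" using D by simp
next
  assume C: "circuit M C"
  have "D = {} \<or> D = C" if D: "D \<in> cycles M" "D \<subseteq> C" for D
    using contains_circuit[OF D(1)] D(2) C unfolding circuit_def
    by (metis psubsetI psubset_subset_trans subset_antisym)
  then show "min_cycle (cycles M) C"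
    using C circuit_in_cycles circuit_nonempty unfolding min_cycle_def by blast
qed

lemma indep_iff: "I \<in> indeps M \<longleftrightarrow> I \<subseteq> ground M \<and> (\<forall>Z \<in> cycles M. Z \<subseteq> I \<longrightarrow> Z = {})"
proof
  assume "I \<in> indeps M"
  then show "I \<subseteq> ground M \<and> (\<forall>Z \<in> cycles M. Z \<subseteq> I \<longrightarrow> Z = {})"
    using indeps_subset_ground indep_subset cyc_dep unfolding cycles_dependent_def by blast
next
  assume R: "I \<subseteq> ground M \<and> (\<forall>Z \<in> cycles M. Z \<subseteq> I \<longrightarrow> Z = {})"
  show "I \<in> indeps M"
  proof (rule ccontr)
    assume "I \<notin> indeps M"
    then obtain C where C: "circuit M C" "C \<subseteq> I"
      using dependent_contains_circuit[OF conjunct1[OF R]] by auto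
    then have "C = {}" using bspec[OF conjunct2[OF R] circuit_in_cycles[OF C(1)]] by simp
    then show False using circuit_nonempty[OF C(1)] by simp
  qed
qed

text \<open>\<open>connected_matroid\<close> speaks of distinct elements only, so a second element
  is needed to exclude loops and to provide a circuit through a single element.\<close>

lemma connected_space_cycles:
  assumes con: "connected_matroid M" and big: "2 \<le> card (ground M)"
  shows "connected_space {} (ground M) (cycles M)"
proof -
  have other: "\<exists>y \<in> ground M. y \<noteq> x" for x
  proof (rule ccontr)
    assume "\<not> (\<exists>y \<in> ground M. y \<noteq> x)"
    then have "ground M \<subseteq> {x}" by auto
    then show False using big card_mono[of "{x}" "ground M"] by simp
  qed
  have both: "\<exists>C. min_cycle (cycles M) C \<and> x \<in> C \<and> y \<in> C"
    if "x \<in> ground M" "y \<in> ground M" for x y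
    using con that other[of x] unfolding connected_matroid_def min_cycle_iff by metis
  have "{x} \<notin> cycles M" for x
  proof
    assume x: "{x} \<in> cycles M"
    obtain y where y: "y \<in> ground M" "y \<noteq> x" using other by blast
    then obtain C where C: "min_cycle (cycles M) C" "x \<in> C" "y \<in> C"
      using both[of x y] cycles_subset_ground[OF x] by auto
    then show False using min_cycleD(3)[OF C(1) x] y by auto
  qed
  then show ?thesis using both unfolding connected_space_def by simp
qed

text \<open>A basis of \<open>M\<close> can be found inside \<open>C\<close>; adding
  \<open>x\<close> to it creates a circuit, which must pass through \<open>x\<close>.\<close>

lemma spanning_spans:
  assumes C: "C \<subseteq> ground M" "spanning M C" and x: "x \<in> ground M" "x \<notin> C"
  shows "\<exists>Z \<in> cycles M. x \<in> Z \<and> Z \<subseteq> insert x C"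
proof -
  obtain I where I: "I \<in> indeps M" "I \<subseteq> C" "card I = rank_of M (ground M)"
    using rank_of_attained(1)[of C] C(2) unfolding spanning_def by metis
  have finI: "finite I" using I(1) indeps_subset_ground finite_ground finite_subset by blast
  have "insert x I \<notin> indeps M"
  proof
    assume "insert x I \<in> indeps M"
    then have "card (insert x I) \<le> card I"
      using rank_of_attained(2) indeps_subset_ground I(3) by metis
    moreover have "x \<notin> I" using x(2) I(2) by auto
    ultimately show False using finI by simp
  qed
  moreover have "insert x I \<subseteq> ground M" using I(2) C(1) x(1) by auto
  ultimately obtain Z where Z: "circuit M Z" "Z \<subseteq> insert x I"
    using dependent_contains_circuit by blast
  have "x \<in> Z"
  proof (rule ccontr)
    assume "x \<notin> Z"
    then have "Z \<in> indeps M" using Z(2) indep_subset[OF I(1)] by auto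
    then show False using Z(1) by (simp add: circuit_def)
  qed
  then show ?thesis using Z I(2) circuit_in_cycles by (intro bexI[of _ Z]) auto
qed

lemma pair_spanning_cycles:
  assumes "\<And>C. circuit M C \<Longrightarrow> {e, f} \<subseteq> C \<Longrightarrow> spanning M C"
  shows "pair_spanning (ground M) (cycles M) e f"
  unfolding pair_spanning_def min_cycle_iff
proof (intro allI impI ballI)
  fix C x assume C: "circuit M C" "e \<in> C" "f \<in> C" and x: "x \<in> ground M - C"
  have "C \<subseteq> ground M" using C(1) by (simp add: circuit_def)
  then show "\<exists>Z \<in> cycles M. x \<in> Z \<and> Z \<subseteq> insert x C"
    using spanning_spans assms[OF C(1)] C(2,3) x by simp
qed

end

section \<open>Subset sums over GF(2) and represented matroids\<close>

lemma bit_vector_double: "v + v = (0 :: nat \<Rightarrow> bit)"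
  by (rule ext) (simp add: plus_fun_def)

lemma sum_sym_diff:
  fixes \<phi> :: "'a \<Rightarrow> nat \<Rightarrow> bit"
  assumes "finite A" "finite B"
  shows "sum \<phi> (sym_diff A B) = sum \<phi> A + sum \<phi> B"
proof -
  have 1: "sum \<phi> (sym_diff A B) = sum \<phi> (A - B) + sum \<phi> (B - A)"
    by (rule sum.union_disjoint) (use assms in auto)
  have 2: "sum \<phi> A = sum \<phi> (A \<inter> B) + sum \<phi> (A - B)"
    using sum.Int_Diff[OF assms(1)] .
  have 3: "sum \<phi> B = sum \<phi> (A \<inter> B) + sum \<phi> (B - A)"
    using sum.Int_Diff[OF assms(2), of \<phi> A] by (simp add: Int_commute)
  have "sum \<phi> A + sum \<phi> B = (sum \<phi> (A \<inter> B) + sum \<phi> (A \<inter> B)) + (sum \<phi> (A - B) + sum \<phi> (B - A))"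
    unfolding 2 3 by (simp only: add_ac)
  then show ?thesis unfolding 1 bit_vector_double by simp
qed

text \<open>Coefficients are 0 or 1, so a linear dependence is a nonempty subset with zero sum; a
  repeated vector shows up as a two-element subset with zero sum, which accounts for
  injectivity.\<close>

lemma vector_matroid_indep:
  assumes "finite I"
  shows "I \<in> indeps (vector_matroid E \<phi>) \<longleftrightarrow>
    I \<subseteq> E \<and> (\<forall>Z. Z \<subseteq> I \<longrightarrow> sum \<phi> Z = 0 \<longrightarrow> Z = {})"
proof -
  have "inj_on \<phi> I \<and> gf2.independent (\<phi> ` I) \<longleftrightarrow> (\<forall>Z. Z \<subseteq> I \<longrightarrow> sum \<phi> Z = 0 \<longrightarrow> Z = {})"
  proof
    assume L: "inj_on \<phi> I \<and> gf2.independent (\<phi> ` I)"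
    show "\<forall>Z. Z \<subseteq> I \<longrightarrow> sum \<phi> Z = 0 \<longrightarrow> Z = {}"
    proof (intro allI impI, rule ccontr)
      fix Z assume Z: "Z \<subseteq> I" "sum \<phi> Z = 0" "Z \<noteq> {}"
      have "(\<Sum>v\<in>\<phi> ` Z. gf2_scale 1 v) = sum \<phi> Z"
        unfolding sum.reindex[OF inj_on_subset[OF conjunct1[OF L] Z(1)]]
        by (rule sum.cong) (simp_all only: comp_def gf2_scale_def mult_1_left)
      moreover have "finite (\<phi> ` Z)" "\<phi> ` Z \<subseteq> \<phi> ` I" "\<exists>v \<in> \<phi> ` Z. (1 :: bit) \<noteq> 0"
        using Z assms finite_subset by auto
      ultimately have "gf2.dependent (\<phi> ` I)"
        unfolding gf2.dependent_explicit using Z(2)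
        by (intro exI[of _ "\<phi> ` Z"] exI[of _ "\<lambda>_. 1"]) auto
      then show False using L by simp
    qed
  next
    assume R: "\<forall>Z. Z \<subseteq> I \<longrightarrow> sum \<phi> Z = 0 \<longrightarrow> Z = {}"
    have inj: "inj_on \<phi> I"
    proof (rule inj_onI, rule ccontr)
      fix x y assume xy: "x \<in> I" "y \<in> I" "\<phi> x = \<phi> y" "x \<noteq> y"
      have "sum \<phi> {x, y} = 0" using xy by (simp add: bit_vector_double)
      then have "{x, y} = {}" using R xy(1,2) by (metis empty_subsetI insert_subset)
      then show False by simp
    qed
    have "\<not> gf2.dependent (\<phi> ` I)"
    proof
      assume "gf2.dependent (\<phi> ` I)"
      then obtain t u where t: "finite t" "t \<subseteq> \<phi> ` I" "(\<Sum>v\<in>t. gf2_scale (u v) v) = 0"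
        and nz: "\<exists>v \<in> t. u v \<noteq> 0"
        unfolding gf2.dependent_explicit by blast
      \<comment> \<open>The elements whose vectors carry coefficient 1 in the dependence.\<close>
      define Z where "Z = {x \<in> I. \<phi> x \<in> t \<and> u (\<phi> x) \<noteq> 0}"
      have img: "\<phi> ` Z = {v \<in> t. u v \<noteq> 0}" using t(2) unfolding Z_def by auto
      have "sum \<phi> Z = (\<Sum>v\<in>\<phi> ` Z. v)"
        using sum.reindex[of \<phi> Z "\<lambda>v. v"] inj_on_subset[OF inj, of Z]
        by (simp add: comp_def Z_def)
      also have "\<dots> = (\<Sum>v\<in>t. gf2_scale (u v) v)"
        unfolding img
      proof (rule sum.mono_neutral_cong_left)
        show "\<forall>v \<in> t - {v \<in> t. u v \<noteq> 0}. gf2_scale (u v) v = 0"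
          by (auto simp: gf2_scale_def fun_eq_iff)
        show "v = gf2_scale (u v) v" if "v \<in> {v \<in> t. u v \<noteq> 0}" for v
          using that by (auto simp: gf2_scale_def fun_eq_iff)
      qed (use t in auto)
      finally have "sum \<phi> Z = 0" using t by simp
      moreover have "Z \<subseteq> I" "Z \<noteq> {}" using nz img by (auto simp: Z_def)
      ultimately show False using R by blast
    qed
    then show "inj_on \<phi> I \<and> gf2.independent (\<phi> ` I)" using inj by simp
  qed
  then show ?thesis by (simp add: vector_matroid_def)
qed

text \<open>Each circuit has zero vector sum, since a nonempty zero-sum subset of it is dependent
  and hence the whole circuit. Vector sums are additive under symmetric difference, so all cycles
  sum to zero.\<close>

lemma binary_cycles_dependent:
  assumes M: "matroid M" and bin: "binary_matroid M"
  shows "cycles_dependent M"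
proof -
  obtain \<phi> where "M = vector_matroid (ground M) \<phi>"
    using bin unfolding binary_matroid_def by blast
  then have ind: "I \<in> indeps M \<longleftrightarrow>
      I \<subseteq> ground M \<and> (\<forall>Z. Z \<subseteq> I \<longrightarrow> sum \<phi> Z = 0 \<longrightarrow> Z = {})" if "finite I" for I
    using vector_matroid_indep[OF that, of "ground M" \<phi>] by simp
  have fin: "finite X" if "X \<subseteq> ground M" for X
    using that matroid.finite_ground[OF M] finite_subset by blast
  have circ: "sum \<phi> C = 0" if C: "circuit M C" for C
  proof -
    have CE: "C \<subseteq> ground M" using C by (simp add: circuit_def)
    then obtain Z where Z: "Z \<subseteq> C" "sum \<phi> Z = 0" "Z \<noteq> {}"
      using C ind[OF fin[OF CE]] by (auto simp: circuit_def)
    have "Z \<subseteq> ground M" using Z(1) CE by auto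
    then have "Z \<notin> indeps M" using ind[OF fin] Z by auto
    then have "Z = C" using Z(1) C by (auto simp: circuit_def)
    then show ?thesis using Z by simp
  qed
  have zero: "sum \<phi> Z = 0" if "Z \<in> cycles M" for Z
    using that
  proof (induction rule: cycles.induct)
    case (step Z C)
    have "finite Z" "finite C"
      using fin cycles_subset_ground[OF step(1)] step(2) by (auto simp: circuit_def)
    then show ?case using sum_sym_diff[of Z C \<phi>] step circ by simp
  qed simp
  then show ?thesis
    unfolding cycles_dependent_def using ind[OF fin] cycles_subset_ground by blast
qed

section \<open>2-sums of binary matroids\<close>

lemma circuit_subset_ground: "circuit M C \<Longrightarrow> C \<subseteq> ground M"
  by (simp add: circuit_def)

lemma circuit_incomparable:
  assumes "circuit M C" "circuit M D" "C \<subseteq> D"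
  shows "C = D"
proof (rule ccontr)
  assume "C \<noteq> D"
  then have "C \<subset> D" using assms(3) by auto
  then show False using assms(1,2) by (simp add: circuit_def)
qed

lemma connected_no_loop:
  assumes "connected_matroid M" "3 \<le> card (ground M)"
  shows "\<not> circuit M {x}"
proof
  assume x: "circuit M {x}"
  then have xE: "x \<in> ground M" using circuit_subset_ground by auto
  have "\<not> ground M \<subseteq> {x}" using card_mono[of "{x}" "ground M"] assms(2) by auto
  then obtain y where "y \<in> ground M" "y \<noteq> x" by auto
  then obtain C where "circuit M C" "x \<in> C" "y \<in> C"
    using assms(1) xE unfolding connected_matroid_def by metis
  then show False using circuit_incomparable[OF x] \<open>y \<noteq> x\<close> by auto
qed

lemma connected_ex_circuit:
  assumes "connected_matroid M" "3 \<le> card (ground M)" "x \<in> ground M"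
  shows "\<exists>C. circuit M C \<and> x \<in> C"
proof -
  have "\<not> ground M \<subseteq> {x}" using card_mono[of "{x}" "ground M"] assms(2) by auto
  then obtain y where "y \<in> ground M" "y \<noteq> x" by auto
  then show ?thesis using assms(1,3) unfolding connected_matroid_def by metis
qed

lemma two_sum_circuits_commute: "two_sum_circuits p M1 M2 = two_sum_circuits p M2 M1"
proof -
  have "two_sum_circuits p A B \<subseteq> two_sum_circuits p B A" for A B :: "'a pre_matroid"
    unfolding two_sum_circuits_def by (auto simp: Un_commute)
  then show ?thesis by blast
qed

lemma two_sum_commute: "two_sum p M1 M2 = two_sum p M2 M1"
  unfolding two_sum_def two_sum_circuits_commute[of p M1 M2] by (simp add: Un_commute)

lemma two_summable_commute: "two_summable p M1 M2 \<Longrightarrow> two_summable p M2 M1"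
  unfolding two_summable_def by auto

lemma ground_two_sum: "ground (two_sum p M1 M2) = (ground M1 \<union> ground M2) - {p}"
  by (simp add: two_sum_def)

section \<open>Circuits and cycles of a 2-sum of matroids\<close>

locale summable_pair =
  fixes p :: 'a and M1 M2 :: "'a pre_matroid"
  assumes summable: "two_summable p M1 M2"
begin

abbreviation "N \<equiv> two_sum p M1 M2"

lemma parts:
  "matroid M1" "matroid M2" "connected_matroid M1" "connected_matroid M2"
  "3 \<le> card (ground M1)" "3 \<le> card (ground M2)" "ground M1 \<inter> ground M2 = {p}"
  using summable unfolding two_summable_def by auto

lemma swap: "summable_pair p M2 M1"
  using two_summable_commute[OF summable] by unfold_locales

lemma two_sum_circuitsE:
  assumes "D \<in> two_sum_circuits p M1 M2"
  obtains "circuit M1 D" "p \<notin> D" | "circuit M2 D" "p \<notin> D"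
    | C1 C2 where "circuit M1 C1" "p \<in> C1" "circuit M2 C2" "p \<in> C2" "D = (C1 \<union> C2) - {p}"
  using assms unfolding two_sum_circuits_def by blast

lemma two_sum_circuitsI:
  "circuit M1 D \<Longrightarrow> p \<notin> D \<Longrightarrow> D \<in> two_sum_circuits p M1 M2"
  "circuit M1 C1 \<Longrightarrow> p \<in> C1 \<Longrightarrow> circuit M2 C2 \<Longrightarrow> p \<in> C2 \<Longrightarrow>
    (C1 \<union> C2) - {p} \<in> two_sum_circuits p M1 M2"
  unfolding two_sum_circuits_def by blast+

text \<open>Traces 2-sum circuits back to the left side: \<open>Y\<close> is a proper part of a
  circuit, so \<open>D\<close> cannot lie on the right, and a glued \<open>D\<close> has a right
  half other than \<open>{p}\<close>, which forces \<open>Y\<close> to be nonempty.\<close>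

lemma ex_left_circuit:
  assumes D: "D \<in> two_sum_circuits p M1 M2" and sub: "D \<subseteq> X \<union> Y" "X \<subseteq> ground M1"
    "Y \<subset> C2" "p \<notin> Y" and C2: "circuit M2 C2"
  shows "\<exists>C. circuit M1 C \<and> C \<subseteq> insert p X \<and> (p \<in> C \<longrightarrow> Y \<noteq> {})"
  using D
proof (cases rule: two_sum_circuitsE)
  case 1
  have "D \<subseteq> ground M1" using circuit_subset_ground[OF 1(1)] .
  moreover have "Y \<subseteq> ground M2" using circuit_subset_ground[OF C2] sub(3) by auto
  ultimately have "D \<inter> Y \<subseteq> ground M1 \<inter> ground M2" by auto
  then have "D \<inter> Y \<subseteq> {p}" using parts(7) by simp
  then have "D \<subseteq> X" using sub(1) 1(2) by auto
  then show ?thesis using 1 by (intro exI[of _ D]) auto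
next
  case 2
  have "D \<subseteq> ground M2" using circuit_subset_ground[OF 2(1)] .
  then have "D \<inter> X \<subseteq> ground M1 \<inter> ground M2" using sub(2) by auto
  then have "D \<inter> X \<subseteq> {p}" using parts(7) by simp
  then have "D \<subseteq> Y" using sub(1) 2(2) by auto
  then show ?thesis using circuit_incomparable[OF 2(1) C2] sub(3) by auto
next
  case (3 C1 D2)
  have g: "C1 \<subseteq> ground M1" "D2 \<subseteq> ground M2" using circuit_subset_ground 3 by auto
  have "Y \<subseteq> ground M2" using circuit_subset_ground[OF C2] sub(3) by auto
  then have "C1 \<inter> Y \<subseteq> {p}" "D2 \<inter> X \<subseteq> {p}" using g sub(2) parts(7) by auto
  then have s: "C1 \<subseteq> insert p X" "D2 \<subseteq> insert p Y" using 3(5) sub(1) by auto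
  have "D2 \<noteq> {p}" using connected_no_loop[OF parts(4,6)] 3(3) by auto
  then have "Y \<noteq> {}" using s(2) 3(4) by auto
  then show ?thesis using s(1) 3(1) by (intro exI[of _ C1]) auto
qed

lemma circuits_meet: "circuit M1 X \<Longrightarrow> circuit M2 Y \<Longrightarrow> X \<inter> Y \<subseteq> {p}"
  using circuit_subset_ground[of M1 X] circuit_subset_ground[of M2 Y] parts(7) by auto

lemma two_sum_circuit_in_left:
  assumes D: "D \<in> two_sum_circuits p M1 M2" "D \<subseteq> C" and C: "circuit M1 C" "p \<notin> C"
  shows "D = C"
  using D(1)
proof (cases rule: two_sum_circuitsE)
  case 1
  then show ?thesis using circuit_incomparable[OF 1(1) C(1) D(2)] by simp
next
  case 2
  then have "D = {}" using circuits_meet[OF C(1) 2(1)] D(2) by auto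
  then show ?thesis using 2(1) matroid.empty_indep[OF parts(2)] by (simp add: circuit_def)
next
  case (3 C1 C2)
  then have "C2 = {p}" using circuits_meet[OF C(1) 3(3)] D(2) by auto
  then show ?thesis using 3(3) connected_no_loop[OF parts(4,6)] by simp
qed

lemma two_sum_circuits_incomparable:
  assumes D: "D \<in> two_sum_circuits p M1 M2" and D': "D' \<in> two_sum_circuits p M1 M2"
    and sub: "D \<subseteq> D'"
  shows "D = D'"
  using D'
proof (cases rule: two_sum_circuitsE)
  case 1
  then show ?thesis using two_sum_circuit_in_left[OF D sub] by simp
next
  case 2
  then show ?thesis
    using summable_pair.two_sum_circuit_in_left[OF swap _ sub] D by (simp add: two_sum_circuits_commute)
next
  case C: (3 C1 C2)
  show ?thesis
    using D
  proof (cases rule: two_sum_circuitsE)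
    case 1
    have "D \<subseteq> C1" using circuits_meet[OF 1(1) C(3)] sub 1(2) C(5) by auto
    then show ?thesis using circuit_incomparable[OF 1(1) C(1)] 1(2) C(2) by auto
  next
    case 2
    have "D \<subseteq> C2" using circuits_meet[OF C(1) 2(1)] sub 2(2) C(5) by auto
    then show ?thesis using circuit_incomparable[OF 2(1) C(3)] 2(2) C(4) by auto
  next
    case (3 D1 D2)
    have "D1 \<subseteq> C1" using circuits_meet[OF 3(1) C(3)] sub C(2,5) 3(5) by auto
    moreover have "D2 \<subseteq> C2" using circuits_meet[OF C(1) 3(3)] sub C(4,5) 3(5) by auto
    ultimately show ?thesis
      using circuit_incomparable[OF 3(1) C(1)] circuit_incomparable[OF 3(3) C(3)] C(5) 3(5) by simp
  qed
qed

lemma two_sum_circuits_subset: "D \<in> two_sum_circuits p M1 M2 \<Longrightarrow> D \<subseteq> ground N"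
  using circuit_subset_ground[of M1] circuit_subset_ground[of M2]
  unfolding two_sum_circuits_def ground_two_sum by fastforce

lemma indeps_two_sum:
  "I \<in> indeps N \<longleftrightarrow> I \<subseteq> ground N \<and> (\<forall>C \<in> two_sum_circuits p M1 M2. \<not> C \<subseteq> I)"
  by (simp add: two_sum_def)

text \<open>Independence in \<open>two_sum\<close> means containing none of the listed sets, and
  these form an antichain, so they are exactly the minimal dependent sets.\<close>

lemma circuit_two_sum_iff: "circuit N D \<longleftrightarrow> D \<in> two_sum_circuits p M1 M2"
proof
  assume D: "circuit N D"
  then obtain C where C: "C \<in> two_sum_circuits p M1 M2" "C \<subseteq> D"
    using indeps_two_sum[of D] by (auto simp: circuit_def)
  then have "C \<notin> indeps N" using indeps_two_sum[of C] by auto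
  then have "C = D" using C(2) D by (auto simp: circuit_def)
  then show "D \<in> two_sum_circuits p M1 M2" using C by simp
next
  assume D: "D \<in> two_sum_circuits p M1 M2"
  have "X \<in> indeps N" if "X \<subset> D" for X
    unfolding indeps_two_sum
    using that two_sum_circuits_subset[OF D] two_sum_circuits_incomparable[OF _ D] by blast
  then show "circuit N D"
    using D two_sum_circuits_subset[OF D] indeps_two_sum[of D] by (auto simp: circuit_def)
qed

text \<open>Replacing \<open>p\<close> by the rest of \<open>C2\<close> is additive, because two
  copies of \<open>C2\<close> cancel; so it suffices to check circuits.\<close>

lemma cycle_lift:
  assumes C2: "circuit M2 C2" "p \<in> C2" and Z: "Z \<in> cycles M1"
  shows "(if p \<in> Z then sym_diff Z C2 else Z) \<in> cycles N"
  using Z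
proof (induction rule: cycles.induct)
  case empty
  then show ?case by (simp add: cycles.empty)
next
  case (step Z C)
  define g where "g = (\<lambda>Z. if p \<in> Z then sym_diff Z C2 else Z)"
  have "g C \<in> cycles N"
  proof (cases "p \<in> C")
    case True
    have "C \<inter> C2 \<subseteq> {p}"
      using circuit_subset_ground[OF step(2)] circuit_subset_ground[OF C2(1)] parts(7) by auto
    then have "g C = (C \<union> C2) - {p}" using True C2(2) by (auto simp: g_def)
    then show ?thesis
      using two_sum_circuitsI(2)[OF step(2) True C2] circuit_two_sum_iff circuit_in_cycles by metis
  next
    case False
    then show ?thesis
      using two_sum_circuitsI(1)[OF step(2)] circuit_two_sum_iff circuit_in_cycles
      unfolding g_def by metis
  qed
  moreover have "g Z \<in> cycles N" using step(3) by (simp add: g_def)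
  ultimately have "sym_diff (g Z) (g C) \<in> cycles N" by (rule cycles_sym_diff)
  moreover have "g (sym_diff Z C) = sym_diff (g Z) (g C)"
    unfolding g_def by (cases "p \<in> Z"; cases "p \<in> C") auto
  ultimately show ?case unfolding g_def by simp
qed

text \<open>Lift \<open>Z\<close> to a cycle of the 2-sum, find a circuit in it by hypothesis, and
  read off a circuit of \<open>M1\<close> inside \<open>Z\<close>. If \<open>Z\<close> avoids
  \<open>p\<close>, the last clause of \<open>ex_left_circuit\<close> with \<open>Y\<close> empty
  keeps \<open>p\<close> out of that circuit.\<close>

lemma left_cycles_dependent:
  assumes bin: "cycles_dependent N"
  shows "cycles_dependent M1"
  unfolding cycles_dependent_def
proof (intro ballI impI)
  fix Z assume Z: "Z \<in> cycles M1" "Z \<noteq> {}"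
  obtain C2 where C2: "circuit M2 C2" "p \<in> C2"
    using connected_ex_circuit[OF parts(4,6)] parts(7) by auto
  define g where "g = (if p \<in> Z then sym_diff Z C2 else Z)"
  have g: "g \<in> cycles N" using cycle_lift[OF C2 Z(1)] by (simp add: g_def)
  have ZE: "Z \<subseteq> ground M1" using cycles_subset_ground[OF Z(1)] .
  have C2E: "C2 \<subseteq> ground M2" using circuit_subset_ground[OF C2(1)] .
  have ZC: "Z \<inter> C2 \<subseteq> {p}" using ZE C2E parts(7) by auto
  have C2ne: "C2 \<noteq> {p}" using connected_no_loop[OF parts(4,6)] C2 by auto
  have "g \<noteq> {}" using Z(2) C2ne ZC C2(2) by (auto simp: g_def)
  then have "g \<notin> indeps N" using bin g by (auto simp: cycles_dependent_def)
  then obtain D where D: "D \<in> two_sum_circuits p M1 M2" "D \<subseteq> g"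
    using indeps_two_sum cycles_subset_ground[OF g] by auto
  have "\<exists>C. circuit M1 C \<and> C \<subseteq> Z"
  proof (cases "p \<in> Z")
    case True
    then have "D \<subseteq> (Z - {p}) \<union> (C2 - {p})" using D(2) C2(2) by (auto simp: g_def)
    then obtain C where "circuit M1 C" "C \<subseteq> insert p (Z - {p})"
      using ex_left_circuit[OF D(1) _ _ _ _ C2(1), of "Z - {p}" "C2 - {p}"] ZE C2(2) by auto
    then show ?thesis using True by (intro exI[of _ C]) auto
  next
    case False
    then have "D \<subseteq> Z \<union> {}" using D(2) by (auto simp: g_def)
    then obtain C where "circuit M1 C" "C \<subseteq> insert p Z" "p \<notin> C"
      using ex_left_circuit[OF D(1) _ ZE _ _ C2(1), of "{}"] C2(2) by auto
    then show ?thesis by (intro exI[of _ C]) auto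
  qed
  then obtain C where "circuit M1 C" "C \<subseteq> Z" by auto
  then show "Z \<notin> indeps M1"
    using matroid.indep_subset[OF parts(1)] by (auto simp: circuit_def)
qed

lemma both_cycles_dependent:
  assumes "cycles_dependent N"
  shows "cycles_dependent M1" "cycles_dependent M2"
  using left_cycles_dependent[OF assms] summable_pair.left_cycles_dependent[OF swap] assms
  by (simp_all add: two_sum_commute)

lemma space_sum:
  assumes "cycles_dependent M1" "cycles_dependent M2"
  shows "space_sum p (ground M1) (ground M2) (cycles M1) (cycles M2)"
proof -
  interpret L: gf2_matroid M1
    using parts(1) assms(1) by (simp add: gf2_matroid_def gf2_matroid_axioms_def)
  interpret R: gf2_matroid M2
    using parts(2) assms(2) by (simp add: gf2_matroid_def gf2_matroid_axioms_def)
  show ?thesis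
    using L.space R.space parts(7) connected_spaceD(1)[OF L.connected_space_cycles[OF parts(3)]]
      connected_spaceD(1)[OF R.connected_space_cycles[OF parts(4)]] parts(5,6)
    by unfold_locales auto
qed

lemma cycles_two_sum:
  assumes bin: "cycles_dependent M1" "cycles_dependent M2"
  shows "cycles N = two_sum_space p (cycles M1) (cycles M2)"
proof
  interpret S: space_sum p "ground M1" "ground M2" "cycles M1" "cycles M2"
    using space_sum[OF bin] .
  show "cycles N \<subseteq> S.K"
  proof
    fix Z assume "Z \<in> cycles N"
    then show "Z \<in> S.K"
    proof (induction rule: cycles.induct)
      case empty
      then show ?case using cycle_spaceD(2)[OF S.sum_space] .
    next
      case (step Z D)
      have "D \<in> two_sum_circuits p M1 M2" using step(2) circuit_two_sum_iff by simp
      then have "D \<in> S.K"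
      proof (cases rule: two_sum_circuitsE)
        case 1 then show ?thesis using S.left_memI circuit_in_cycles by metis
      next
        case 2
        then show ?thesis
          using space_sum.left_memI[OF S.swap] circuit_in_cycles two_sum_space_commute by metis
      next
        case (3 C1 C2)
        then show ?thesis
          using S.memI[OF circuit_in_cycles circuit_in_cycles, OF 3(1,3)] by simp
      qed
      then show ?case using cycle_spaceD(5)[OF S.sum_space step(3)] by simp
    qed
  qed
  show "S.K \<subseteq> cycles N"
  proof
    fix Z assume "Z \<in> S.K"
    obtain Z1 Z2 where Z: "Z1 \<in> cycles M1" "Z2 \<in> cycles M2" "p \<in> Z1 \<longleftrightarrow> p \<in> Z2"
      "Z = (Z1 \<union> Z2) - {p}" "Z1 \<subseteq> ground M1" "Z2 \<subseteq> ground M2"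
      "Z \<inter> ground M1 = Z1 - {p}" "Z \<inter> ground M2 = Z2 - {p}"
      by (rule S.memE[OF \<open>Z \<in> S.K\<close>])
    obtain C1 where C1: "circuit M1 C1" "p \<in> C1"
      using connected_ex_circuit[OF parts(3,5)] parts(7) by auto
    obtain C2 where C2: "circuit M2 C2" "p \<in> C2"
      using connected_ex_circuit[OF parts(4,6)] parts(7) by auto
    have ZZ: "Z1 \<inter> Z2 \<subseteq> {p}" using Z(5,6) parts(7) by auto
    show "Z \<in> cycles N"
    proof (cases "p \<in> Z1")
      case False
      have "Z = sym_diff Z1 Z2" using ZZ False Z(3,4) by auto
      moreover have "Z1 \<in> cycles N" using cycle_lift[OF C2 Z(1)] False by simp
      moreover have "Z2 \<in> cycles N"
        using summable_pair.cycle_lift[OF swap C1 Z(2)] False Z(3) by (simp add: two_sum_commute)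
      ultimately show ?thesis using cycles_sym_diff by metis
    next
      case True
      \<comment> \<open>Both halves are combined with the same \<open>C2\<close>: on the right this
        removes \<open>p\<close>, so the result lifts to itself, and \<open>C2\<close> cancels in
        the final sum.\<close>
      have 1: "sym_diff Z1 C2 \<in> cycles N" using cycle_lift[OF C2 Z(1)] True by simp
      have "sym_diff Z2 C2 \<in> cycles M2" using cycles.step[OF Z(2) C2(1)] .
      then have 2: "sym_diff Z2 C2 \<in> cycles N"
        using summable_pair.cycle_lift[OF swap C1, of "sym_diff Z2 C2"] True Z(3) C2(2)
        by (simp add: two_sum_commute)
      have "sym_diff (sym_diff Z1 C2) (sym_diff Z2 C2) = sym_diff Z1 Z2" by auto
      also have "\<dots> = Z" using ZZ True Z(3,4) by auto
      finally show ?thesis using cycles_sym_diff[OF 2 1] by simp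
    qed
  qed
qed

end

section \<open>Contracting the edges of a decomposition tree\<close>

definition inner_edges :: "'a matroid_graph \<Rightarrow> 'a pre_matroid set \<Rightarrow> 'a set" where
  "inner_edges T W = {p \<in> edges T. ends T p \<subseteq> W}"

text \<open>Quantifying over ordered pairs of ends turns the implication into an equivalence: the
  two labels at an inner edge agree about it.\<close>

definition compatible ::
    "'a matroid_graph \<Rightarrow> 'a pre_matroid set \<Rightarrow> ('a pre_matroid \<Rightarrow> 'a set) \<Rightarrow> bool" where
  "compatible T W z \<longleftrightarrow> (\<forall>N \<in> W. z N \<in> cycles N) \<and>
     (\<forall>p \<in> inner_edges T W. \<forall>A \<in> ends T p. \<forall>B \<in> ends T p. p \<in> z A \<longrightarrow> p \<in> z B)"

text \<open>Ground set and cycle space of the 2-sum of the labels in \<open>W\<close>, described without reference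
  to the order in which the edges are contracted.\<close>

definition part_ground :: "'a matroid_graph \<Rightarrow> 'a pre_matroid set \<Rightarrow> 'a set" where
  "part_ground T W = (\<Union>N \<in> W. ground N) - inner_edges T W"

definition part_cycles :: "'a matroid_graph \<Rightarrow> 'a pre_matroid set \<Rightarrow> 'a set set" where
  "part_cycles T W = {(\<Union>N \<in> W. z N) - inner_edges T W | z. compatible T W z}"

text \<open>The intersection conditions of a tree decomposition in elementwise form, which is easier
  to carry through a contraction.\<close>

definition incidence :: "'a matroid_graph \<Rightarrow> bool" where
  "incidence T \<longleftrightarrow> finite (verts T) \<and> finite (edges T) \<and>
     (\<forall>p \<in> edges T. ends T p \<subseteq> verts T \<and> card (ends T p) = 2 \<and>
        (\<forall>N \<in> verts T. p \<in> ground N \<longleftrightarrow> N \<in> ends T p)) \<and>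
     (\<forall>N1 \<in> verts T. \<forall>N2 \<in> verts T. \<forall>x. x \<in> ground N1 \<longrightarrow> x \<in> ground N2 \<longrightarrow>
        x \<notin> edges T \<longrightarrow> N1 = N2)"

text \<open>A form of acyclicity that is stable under contracting an edge.\<close>

definition sparse :: "'a matroid_graph \<Rightarrow> bool" where
  "sparse T \<longleftrightarrow> (\<forall>U. U \<subseteq> verts T \<longrightarrow> U \<noteq> {} \<longrightarrow> card (inner_edges T U) < card U)"

lemma incidenceD:
  assumes "incidence T"
  shows "finite (verts T)" "finite (edges T)"
    "p \<in> edges T \<Longrightarrow> ends T p \<subseteq> verts T" "p \<in> edges T \<Longrightarrow> card (ends T p) = 2"
    "p \<in> edges T \<Longrightarrow> N \<in> verts T \<Longrightarrow> p \<in> ground N \<longleftrightarrow> N \<in> ends T p"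
    "N1 \<in> verts T \<Longrightarrow> N2 \<in> verts T \<Longrightarrow> x \<in> ground N1 \<Longrightarrow> x \<in> ground N2 \<Longrightarrow> x \<notin> edges T \<Longrightarrow> N1 = N2"
  using assms unfolding incidence_def by blast+

lemma inner_edges_verts:
  assumes "incidence T"
  shows "inner_edges T (verts T) = edges T"
  using incidenceD(3)[OF assms] unfolding inner_edges_def by auto

section \<open>Invariants of a single contraction\<close>

locale contraction =
  fixes T :: "'a matroid_graph" and p :: 'a and M1 M2 :: "'a pre_matroid"
  assumes inc: "incidence T" and sparse: "sparse T"
    and p: "p \<in> edges T" "ends T p = {M1, M2}" and summable: "two_summable p M1 M2"
begin

sublocale summable_pair p M1 M2 by unfold_locales (rule summable)

abbreviation "T' \<equiv> contract_edge T p M1 M2"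

definition proj :: "'a pre_matroid \<Rightarrow> 'a pre_matroid" where
  "proj A = (if A \<in> {M1, M2} then N else A)"

lemma contracted:
  "verts T' = insert N (verts T - {M1, M2})" "edges T' = edges T - {p}"
  "ends T' q = proj ` ends T q"
  unfolding contract_edge_def proj_def by simp_all

lemma in_verts: "M1 \<in> verts T" "M2 \<in> verts T" "M1 \<noteq> M2"
proof -
  show "M1 \<in> verts T" "M2 \<in> verts T" using incidenceD(3)[OF inc p(1)] p(2) by auto
  show "M1 \<noteq> M2" using parts(5,7) by auto
qed

text \<open>Vertices are the labels themselves, so a composite label equal to an existing one would
  make two vertices collapse. In that case every element of \<open>M1\<close> would be an edge among
  three vertices, at least three edges in all, which \<open>sparse\<close> forbids.\<close>

lemma fresh: "N \<notin> verts T"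
proof
  assume N: "N \<in> verts T"
  have pM: "p \<in> ground M1" "p \<in> ground M2" "p \<notin> ground N"
    using parts(7) by (auto simp: ground_two_sum)
  then have ne: "N \<noteq> M1" "N \<noteq> M2" by auto
  let ?U = "{M1, M2, N}"
  have "x \<in> inner_edges T ?U" if x: "x \<in> ground M1" for x
  proof (cases "x = p")
    case True
    then show ?thesis using p unfolding inner_edges_def by auto
  next
    case False
    then have xN: "x \<in> ground N" using x by (simp add: ground_two_sum)
    then have e: "x \<in> edges T" using incidenceD(6)[OF inc in_verts(1) N x] ne by auto
    then have "M1 \<in> ends T x" "N \<in> ends T x" using incidenceD(5)[OF inc e] in_verts N x xN by auto
    then have "{M1, N} = ends T x"
      using card_subset_eq[of "ends T x" "{M1, N}"] incidenceD(4)[OF inc e] ne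
      by (metis card_2_iff card_eq_0_iff empty_subsetI insert_subset zero_neq_numeral)
    then show ?thesis using e unfolding inner_edges_def by auto
  qed
  then have "ground M1 \<subseteq> inner_edges T ?U" by auto
  then have "3 \<le> card (inner_edges T ?U)"
    using card_mono[of "inner_edges T ?U" "ground M1"] parts(5) incidenceD(2)[OF inc]
    unfolding inner_edges_def by auto
  moreover have "card ?U \<le> 3" by (simp add: card_insert_if)
  moreover have "card (inner_edges T ?U) < card ?U"
    using sparse in_verts N unfolding sparse_def by auto
  ultimately show False by simp
qed

lemma ends_not_both:
  assumes "q \<in> edges T" "q \<noteq> p" "A \<in> ends T q" "B \<in> ends T q" "A \<noteq> B"
  shows "\<not> (A \<in> {M1, M2} \<and> B \<in> {M1, M2})"
proof
  assume AB: "A \<in> {M1, M2} \<and> B \<in> {M1, M2}"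
  then have "M1 \<in> ends T q" "M2 \<in> ends T q" using assms(3-5) by auto
  then have "q \<in> ground M1 \<inter> ground M2" using incidenceD(5)[OF inc assms(1)] in_verts by auto
  then show False using parts(7) assms(2) by auto
qed

lemma proj_inj:
  assumes "q \<in> edges T" "q \<noteq> p"
  shows "inj_on proj (ends T q)"
proof (rule inj_onI, rule ccontr)
  fix A B assume AB: "A \<in> ends T q" "B \<in> ends T q" "proj A = proj B" "A \<noteq> B"
  have "A \<noteq> N" "B \<noteq> N" using AB(1,2) incidenceD(3)[OF inc assms(1)] fresh by auto
  then show False using AB(3,4) ends_not_both[OF assms AB(1,2,4)]
    unfolding proj_def by (auto split: if_splits)
qed

lemma proj_mem:
  assumes "q \<in> edges T" "q \<noteq> p" "A \<in> ends T q"
  shows "q \<in> ground (proj A)" "proj A \<in> verts T'"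
proof -
  have A: "A \<in> verts T" using assms incidenceD(3)[OF inc] by auto
  then show "proj A \<in> verts T'" unfolding contracted proj_def by auto
  have "q \<in> ground A" using incidenceD(5)[OF inc assms(1) A] assms(3) by simp
  then show "q \<in> ground (proj A)" using assms(2) by (auto simp: proj_def ground_two_sum)
qed

lemma incidence': "incidence T'"
  unfolding incidence_def
proof (intro conjI ballI allI impI)
  show "finite (verts T')" "finite (edges T')" using incidenceD[OF inc] by (auto simp: contracted)
next
  fix q assume "q \<in> edges T'"
  then have q: "q \<in> edges T" "q \<noteq> p" by (auto simp: contracted)
  show "ends T' q \<subseteq> verts T'" using proj_mem(2)[OF q] by (auto simp: contracted(3))
  show "card (ends T' q) = 2"
    using card_image[OF proj_inj[OF q]] incidenceD(4)[OF inc q(1)] by (simp add: contracted(3))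
  fix B assume B: "B \<in> verts T'"
  show "q \<in> ground B \<longleftrightarrow> B \<in> ends T' q"
  proof
    assume "B \<in> ends T' q"
    then show "q \<in> ground B" using proj_mem(1)[OF q] by (auto simp: contracted(3))
  next
    assume qB: "q \<in> ground B"
    have "\<exists>A \<in> verts T. q \<in> ground A \<and> proj A = B"
    proof (cases "B = N")
      case True
      then have "q \<in> ground M1 \<or> q \<in> ground M2" using qB by (auto simp: ground_two_sum)
      then show ?thesis using in_verts True by (auto simp: proj_def)
    next
      case False
      then show ?thesis using B qB by (intro bexI[of _ B]) (auto simp: contracted proj_def)
    qed
    then show "B \<in> ends T' q" using incidenceD(5)[OF inc q(1)] by (auto simp: contracted(3))
  qed
next
  fix A B x
  assume A: "A \<in> verts T'" "x \<in> ground A" and B: "B \<in> verts T'" "x \<in> ground B"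
    and x: "x \<notin> edges T'"
  have lift: "x \<noteq> p \<and> (\<exists>A' \<in> verts T. x \<in> ground A' \<and> proj A' = A)"
    if A: "A \<in> verts T'" "x \<in> ground A" for A
  proof (cases "A = N")
    case True
    then have "x \<noteq> p" "x \<in> ground M1 \<or> x \<in> ground M2" using A by (auto simp: ground_two_sum)
    then show ?thesis using in_verts True by (auto simp: proj_def)
  next
    case False
    then have AT: "A \<in> verts T" "A \<notin> {M1, M2}" using A by (auto simp: contracted)
    have "x \<noteq> p" using incidenceD(5)[OF inc p(1) AT(1)] A(2) AT(2) p(2) by auto
    then show ?thesis using AT A(2) by (auto simp: proj_def)
  qed
  obtain A' where A': "A' \<in> verts T" "x \<in> ground A'" "proj A' = A" using lift[OF A] by auto
  obtain B' where B': "B' \<in> verts T" "x \<in> ground B'" "proj B' = B" using lift[OF B] by auto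
  have "x \<notin> edges T" using lift[OF A] x by (simp add: contracted)
  then show "A = B" using incidenceD(6)[OF inc A'(1) B'(1) A'(2) B'(2)] A'(3) B'(3) by simp
qed

text \<open>Splitting \<open>N\<close> back into \<open>M1\<close> and \<open>M2\<close> gains one
  vertex and at least the edge \<open>p\<close>, so the strict inequality is inherited.\<close>

lemma sparse': "sparse T'"
  unfolding sparse_def
proof (intro allI impI)
  fix U assume U: "U \<subseteq> verts T'" "U \<noteq> {}"
  have endsT: "A \<in> verts T \<and> A \<noteq> N" if "q \<in> edges T" "A \<in> ends T q" for q A
    using that incidenceD(3)[OF inc] fresh by auto
  have fin: "finite (inner_edges T W)" for W
    using incidenceD(2)[OF inc] by (simp add: inner_edges_def)
  have finU: "finite U" using U incidence' incidenceD(1) finite_subset by blast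
  have proj_ends: "proj A \<in> U" if "q \<in> inner_edges T' U" "A \<in> ends T q" for q A
    using that by (auto simp: inner_edges_def contracted(3))
  show "card (inner_edges T' U) < card U"
  proof (cases "N \<in> U")
    case False
    have "A \<in> U" if "q \<in> inner_edges T' U" "A \<in> ends T q" for q A
      using proj_ends[OF that] False by (auto simp: proj_def split: if_splits)
    then have "inner_edges T' U \<subseteq> inner_edges T U" by (auto simp: inner_edges_def contracted(2))
    moreover have "U \<subseteq> verts T" using U False by (auto simp: contracted)
    ultimately show ?thesis
      using sparse U(2) card_mono[OF fin] unfolding sparse_def by (meson le_less_trans)
  next
    case True
    let ?W = "(U - {N}) \<union> {M1, M2}"
    have "A \<in> ?W" if "q \<in> inner_edges T' U" "A \<in> ends T q" for q A
    proof -
      have "q \<in> edges T" using that(1) by (auto simp: inner_edges_def contracted(2))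
      then show ?thesis using endsT[of q A] that(2) proj_ends[OF that]
        by (auto simp: proj_def split: if_splits)
    qed
    then have "insert p (inner_edges T' U) \<subseteq> inner_edges T ?W"
      using p by (auto simp: inner_edges_def contracted(2))
    moreover have "p \<notin> inner_edges T' U" by (simp add: inner_edges_def contracted(2))
    moreover have "finite (inner_edges T' U)"
      using incidenceD(2)[OF incidence'] by (simp add: inner_edges_def)
    ultimately have 1: "Suc (card (inner_edges T' U)) \<le> card (inner_edges T ?W)"
      using card_mono[OF fin] by (metis card_insert_disjoint)
    have "?W \<subseteq> verts T" using U(1) in_verts by (auto simp: contracted)
    then have 2: "card (inner_edges T ?W) < card ?W" using sparse unfolding sparse_def by auto
    have "{M1, M2} \<inter> (U - {N}) = {}" using U(1) by (auto simp: contracted)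
    then have "card ?W = card (U - {N}) + 2"
      using card_Un_disjoint[of "U - {N}" "{M1, M2}"] finU in_verts(3) by (simp add: Int_commute)
    also have "\<dots> = card U + 1" using True finU card_Suc_Diff1[OF finU True] by simp
    finally show ?thesis using 1 2 by simp
  qed
qed

text \<open>By \<open>cycles_two_sum\<close>, choosing a cycle at the composite vertex amounts to
  choosing a pair at \<open>M1\<close> and \<open>M2\<close> that agrees at \<open>p\<close>; the
  choices elsewhere are untouched and never contain \<open>p\<close>.\<close>

lemma part_cycles':
  assumes bin: "cycles_dependent M1" "cycles_dependent M2"
  shows "part_cycles T' (verts T') = part_cycles T (verts T)"
proof -
  interpret S: space_sum p "ground M1" "ground M2" "cycles M1" "cycles M2"
    using space_sum[OF bin] .
  note cyc = cycles_two_sum[OF bin]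
  note inner = inner_edges_verts[OF inc] inner_edges_verts[OF incidence']
  have pA: "p \<notin> ground A" if "A \<in> verts T" "A \<noteq> M1" "A \<noteq> M2" for A
    using incidenceD(5)[OF inc p(1) that(1)] that p(2) by auto
  show ?thesis
  proof
    show "part_cycles T' (verts T') \<subseteq> part_cycles T (verts T)"
    proof
      fix Z assume "Z \<in> part_cycles T' (verts T')"
      then obtain z where Z: "Z = (\<Union>A \<in> verts T'. z A) - edges T'"
        and z: "compatible T' (verts T') z"
        unfolding part_cycles_def inner by auto
      have zN: "z N \<in> S.K" using z cyc by (auto simp: compatible_def contracted)
      obtain Z1 Z2 where Z12: "Z1 \<in> cycles M1" "Z2 \<in> cycles M2" "p \<in> Z1 \<longleftrightarrow> p \<in> Z2"
        "z N = (Z1 \<union> Z2) - {p}" "Z1 \<subseteq> ground M1" "Z2 \<subseteq> ground M2"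
        "z N \<inter> ground M1 = Z1 - {p}" "z N \<inter> ground M2 = Z2 - {p}"
        by (rule S.memE[OF zN])
      define y where "y A = (if A = M1 then Z1 else if A = M2 then Z2 else z A)" for A
      have y12: "y M1 = Z1" "y M2 = Z2" using in_verts(3) by (auto simp: y_def)
      have y_mem: "q \<in> y A \<longleftrightarrow> q \<in> z (proj A)"
        if q: "q \<in> edges T" "q \<noteq> p" "A \<in> ends T q" for q A
      proof -
        have "A \<in> verts T" using q incidenceD(3)[OF inc] by auto
        then have "q \<in> ground A" using incidenceD(5)[OF inc q(1)] q(3) by simp
        then show ?thesis using Z12(7,8) q(2) y12 by (auto simp: proj_def y_def)
      qed
      have "compatible T (verts T) y"
        unfolding compatible_def inner
      proof (intro conjI ballI impI)
        fix A assume A: "A \<in> verts T"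
        show "y A \<in> cycles A"
          using z A Z12(1,2) by (auto simp: y_def compatible_def contracted(1))
      next
        fix q A B assume q: "q \<in> edges T" "A \<in> ends T q" "B \<in> ends T q" "q \<in> y A"
        show "q \<in> y B"
        proof (cases "q = p")
          case True
          then show ?thesis using q p(2) Z12(3) y12 by auto
        next
          case False
          have "q \<in> edges T'" "proj A \<in> ends T' q" "proj B \<in> ends T' q"
            using q False by (auto simp: contracted)
          then have "q \<in> z (proj A) \<longrightarrow> q \<in> z (proj B)"
            using z unfolding compatible_def inner by blast
          then show ?thesis using y_mem[OF q(1) False] q by simp
        qed
      qed
      moreover have "Z = (\<Union>A \<in> verts T. y A) - edges T"
      proof -
        have yA: "y A = z A" if "A \<in> verts T - {M1, M2}" for A using that by (simp add: y_def)
        have pz: "p \<notin> z A" if A: "A \<in> verts T - {M1, M2}" for A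
        proof -
          have "z A \<subseteq> ground A"
            using A z cycles_subset_ground by (auto simp: compatible_def contracted(1))
          then show ?thesis using pA[of A] A by auto
        qed
        have "(\<Union>A \<in> verts T. y A) = Z1 \<union> Z2 \<union> (\<Union>A \<in> verts T - {M1, M2}. y A)"
          using in_verts(1,2) y12 by auto
        also have "\<dots> = Z1 \<union> Z2 \<union> (\<Union>A \<in> verts T - {M1, M2}. z A)" using yA by simp
        finally have a: "(\<Union>A \<in> verts T. y A) = Z1 \<union> Z2 \<union> (\<Union>A \<in> verts T - {M1, M2}. z A)" .
        have b: "(\<Union>A \<in> verts T'. z A) = (Z1 \<union> Z2 - {p}) \<union> (\<Union>A \<in> verts T - {M1, M2}. z A)"
          unfolding contracted(1) using Z12(4) by simp
        have "p \<notin> (\<Union>A \<in> verts T - {M1, M2}. z A)" using pz by auto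
        then show ?thesis unfolding Z a b contracted(2) using p(1) by auto
      qed
      ultimately show "Z \<in> part_cycles T (verts T)"
        unfolding part_cycles_def inner by auto
    qed
    show "part_cycles T (verts T) \<subseteq> part_cycles T' (verts T')"
    proof
      fix Z assume "Z \<in> part_cycles T (verts T)"
      then obtain z where Z: "Z = (\<Union>A \<in> verts T. z A) - edges T"
        and z: "compatible T (verts T) z"
        unfolding part_cycles_def inner by auto
      have zsub: "z A \<subseteq> ground A" and zcyc: "z A \<in> cycles A" if "A \<in> verts T" for A
        using that z cycles_subset_ground by (auto simp: compatible_def)
      have pp: "p \<in> z M1 \<longleftrightarrow> p \<in> z M2"
        using z p unfolding compatible_def inner by blast
      define y where "y A = (if A = N then (z M1 \<union> z M2) - {p} else z A)" for A
      have y_mem: "q \<in> y (proj A) \<longleftrightarrow> q \<in> z A"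
        if q: "q \<in> edges T" "q \<noteq> p" "A \<in> ends T q" for q A
      proof (cases "A \<in> {M1, M2}")
        case True
        have "q \<in> ground A" using incidenceD(3,5)[OF inc q(1)] q(3) by auto
        moreover have "ground M1 \<inter> ground M2 = {p}" by (rule parts(7))
        ultimately have "q \<in> z M1 \<union> z M2 \<longleftrightarrow> q \<in> z A"
          using True zsub[OF in_verts(1)] zsub[OF in_verts(2)] q(2) by auto
        then show ?thesis using True q(2) by (auto simp: y_def proj_def)
      next
        case False
        have "A \<noteq> N" using q incidenceD(3)[OF inc] fresh by auto
        then show ?thesis using False by (simp add: y_def proj_def)
      qed
      have "compatible T' (verts T') y"
        unfolding compatible_def inner
      proof (intro conjI ballI impI)
        fix A assume A: "A \<in> verts T'"
        show "y A \<in> cycles A"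
        proof (cases "A = N")
          case True
          then show ?thesis
            using S.memI[OF zcyc[OF in_verts(1)] zcyc[OF in_verts(2)] pp] cyc by (simp add: y_def)
        next
          case False
          then show ?thesis using A zcyc by (simp add: y_def contracted(1))
        qed
      next
        fix q A B assume "q \<in> edges T'" "A \<in> ends T' q" "B \<in> ends T' q" and qA: "q \<in> y A"
        then obtain A' B' where q: "q \<in> edges T" "q \<noteq> p"
          and AB: "A' \<in> ends T q" "A = proj A'" "B' \<in> ends T q" "B = proj B'"
          by (auto simp: contracted)
        have "q \<in> z A' \<longrightarrow> q \<in> z B'"
          using z q(1) AB unfolding compatible_def inner by blast
        then show "q \<in> y B" using y_mem[OF q] AB qA by simp
      qed
      moreover have "Z = (\<Union>A \<in> verts T'. y A) - edges T'"
      proof -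
        have yA: "y A = z A" if "A \<in> verts T - {M1, M2}" for A using that fresh by (auto simp: y_def)
        have pz: "p \<notin> z A" if A: "A \<in> verts T - {M1, M2}" for A
          using pA[of A] zsub[of A] A by auto
        have a: "(\<Union>A \<in> verts T. z A) = z M1 \<union> z M2 \<union> (\<Union>A \<in> verts T - {M1, M2}. z A)"
          using in_verts(1,2) by auto
        have b: "(\<Union>A \<in> verts T'. y A) = (z M1 \<union> z M2 - {p}) \<union> (\<Union>A \<in> verts T - {M1, M2}. z A)"
        proof -
          have "(\<Union>A \<in> verts T - {M1, M2}. y A) = (\<Union>A \<in> verts T - {M1, M2}. z A)"
            by (rule SUP_cong[OF refl yA])
          moreover have "y N = z M1 \<union> z M2 - {p}" by (simp add: y_def)
          ultimately show ?thesis unfolding contracted(1) by simp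
        qed
        have "p \<notin> (\<Union>A \<in> verts T - {M1, M2}. z A)" using pz by auto
        then show ?thesis unfolding Z a b contracted(2) using p(1) by auto
      qed
      ultimately show "Z \<in> part_cycles T' (verts T')"
        unfolding part_cycles_def inner by auto
    qed
  qed
qed

end

text \<open>The induction runs back from the single vertex \<open>M\<close>: the criterion is known
  there and passes from a composite label to its two summands, which in turn permits
  \<open>part_cycles'\<close>.\<close>

lemma contract_steps_cycles:
  assumes steps: "contract_step\<^sup>*\<^sup>* T T'" and T': "verts T' = {M}" "edges T' = {}"
    and bin: "cycles_dependent M" and "incidence T" "sparse T"
  shows "(\<forall>N \<in> verts T. cycles_dependent N) \<and> part_cycles T (verts T) = cycles M"
  using steps assms(5,6)
proof (induction rule: converse_rtranclp_induct)
  case base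
  have "inner_edges T' {M} = {}" using T' by (simp add: inner_edges_def)
  then have "part_cycles T' {M} = {z M | z. z M \<in> cycles M}"
    by (auto simp: part_cycles_def compatible_def)
  also have "\<dots> = cycles M" by (auto intro!: exI[of _ "\<lambda>_. _"])
  finally show ?case using T' bin by simp
next
  case (step S S')
  then obtain p M1 M2 where S: "p \<in> edges S" "ends S p = {M1, M2}" "two_summable p M1 M2"
    "S' = contract_edge S p M1 M2" unfolding contract_step_def by auto
  interpret contraction S p M1 M2 using step(4,5) S by unfold_locales
  have IH: "\<forall>N \<in> verts S'. cycles_dependent N" "part_cycles S' (verts S') = cycles M"
    using step(3) incidence' sparse' S(4) by auto
  have "cycles_dependent N" using IH(1) S(4) contracted(1) by simp
  then have b: "cycles_dependent M1" "cycles_dependent M2" using both_cycles_dependent by auto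
  have "cycles_dependent A" if "A \<in> verts S" for A
    using b IH(1) S(4) contracted(1) that by (cases "A \<in> {M1, M2}") auto
  moreover have "part_cycles S (verts S) = cycles M"
    using part_cycles'[OF b] IH(2) S(4) by simp
  ultimately show ?case by blast
qed

section \<open>Growing subtrees\<close>

lemma adjacent_sym: "adjacent T u v \<Longrightarrow> adjacent T v u"
  unfolding adjacent_def by (metis insert_commute)

definition attaches ::
    "'a matroid_graph \<Rightarrow> 'a pre_matroid set \<Rightarrow> 'a pre_matroid \<Rightarrow> 'a \<Rightarrow> 'a pre_matroid \<Rightarrow> bool" where
  "attaches T W B p N \<longleftrightarrow> B \<in> verts T \<and> B \<notin> W \<and> p \<in> edges T \<and> ends T p = {N, B} \<and> N \<in> W \<and>
     (\<forall>q \<in> edges T. B \<in> ends T q \<longrightarrow> ends T q \<inter> W \<noteq> {} \<longrightarrow> q = p)"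

text \<open>Subtrees as a leaf-by-leaf construction, which makes induction along 2-sums possible:
  each attachment is one 2-sum with a single label.\<close>

inductive grown :: "'a matroid_graph \<Rightarrow> 'a pre_matroid \<Rightarrow> 'a pre_matroid set \<Rightarrow> bool" for T A where
  single: "A \<in> verts T \<Longrightarrow> grown T A {A}"
| attach: "grown T A W \<Longrightarrow> attaches T W B p N \<Longrightarrow> grown T A (insert B W)"

lemma grown_verts: "grown T A W \<Longrightarrow> A \<in> W \<and> W \<subseteq> verts T"
  by (induction rule: grown.induct) (auto simp: attaches_def)

lemma grown_path:
  assumes "grown T A W" "x \<in> W" "y \<in> W"
  shows "\<exists>ps. ps \<noteq> [] \<and> hd ps = x \<and> last ps = y \<and> distinct ps \<and> set ps \<subseteq> W \<and>
    successively (adjacent T) ps"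
  using assms
proof (induction arbitrary: x y rule: grown.induct)
  case single
  then show ?case by (intro exI[of _ "[A]"]) auto
next
  case (attach W B p N)
  have adj: "adjacent T N B" and NW: "N \<in> W" and BW: "B \<notin> W"
    using attach(2) unfolding attaches_def adjacent_def by auto
  consider "x \<in> W" "y \<in> W" | "x = B" "y = B" | "x = B" "y \<in> W" | "x \<in> W" "y = B"
    using attach(4,5) by auto
  then show ?case
  proof cases
    case 1
    then obtain ps where "ps \<noteq> []" "hd ps = x" "last ps = y" "distinct ps" "set ps \<subseteq> W"
      "successively (adjacent T) ps" using attach(3) by metis
    then show ?thesis by (intro exI[of _ ps]) auto
  next
    case 2
    then show ?thesis by (intro exI[of _ "[B]"]) auto
  next
    case 3
    obtain ps where ps: "ps \<noteq> []" "hd ps = N" "last ps = y" "distinct ps" "set ps \<subseteq> W"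
      "successively (adjacent T) ps" using attach(3)[OF NW 3(2)] by metis
    then show ?thesis using 3 BW adjacent_sym[OF adj]
      by (intro exI[of _ "B # ps"]) (auto simp: successively_Cons)
  next
    case 4
    obtain ps where ps: "ps \<noteq> []" "hd ps = x" "last ps = N" "distinct ps" "set ps \<subseteq> W"
      "successively (adjacent T) ps" using attach(3)[OF 4(1) NW] by metis
    then show ?thesis using 4 BW adj
      by (intro exI[of _ "ps @ [B]"]) (auto simp: successively_append_iff)
  qed
qed

abbreviation step_in ::
    "'a matroid_graph \<Rightarrow> 'a pre_matroid set \<Rightarrow> 'a pre_matroid \<Rightarrow> 'a pre_matroid \<Rightarrow> bool" where
  "step_in T U u v \<equiv> adjacent T u v \<and> u \<in> U \<and> v \<in> U"

lemma is_treeD: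
  assumes "is_tree T"
  shows "finite (verts T)" "finite (edges T)" "verts T \<noteq> {}" "inj_on (ends T) (edges T)"
    "p \<in> edges T \<Longrightarrow> ends T p \<subseteq> verts T" "p \<in> edges T \<Longrightarrow> card (ends T p) = 2"
    "u \<in> verts T \<Longrightarrow> v \<in> verts T \<Longrightarrow> (adjacent T)\<^sup>*\<^sup>* u v" "\<not> graph_cycle T vs"
  using assms unfolding is_tree_def simple_graph_def by blast+

lemma ends_not_single: "is_tree T \<Longrightarrow> q \<in> edges T \<Longrightarrow> \<not> ends T q \<subseteq> {B}"
  using card_mono[of "{B}" "ends T q"] is_treeD(6)[of T q] by auto

lemma inner_edges_single: "is_tree T \<Longrightarrow> inner_edges T {B} = {}"
  using ends_not_single[of T _ B] by (auto simp: inner_edges_def)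

text \<open>A vertex of \<open>U\<close> reached from \<open>W\<close> in one step is attached by a
  single edge: a second edge into \<open>W\<close> together with a path inside \<open>W\<close>
  would close a cycle.\<close>

lemma tree_attaches:
  assumes T: "is_tree T" and W: "grown T A W" and U: "U \<subseteq> verts T" "W \<subseteq> U" "W \<noteq> U"
    and reach: "\<And>v. v \<in> U \<Longrightarrow> (step_in T U)\<^sup>*\<^sup>* A v"
  shows "\<exists>B \<in> U - W. \<exists>p N. attaches T W B p N"
proof -
  obtain v where v: "v \<in> U" "v \<notin> W" using U by auto
  have "\<exists>N B. N \<in> W \<and> B \<in> U - W \<and> adjacent T N B" if "(step_in T U)\<^sup>*\<^sup>* A v" "v \<notin> W" for v
    using that
  proof (induction rule: rtranclp_induct)
    case base
    then show ?case using grown_verts[OF W] by auto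
  next
    case (step y z)
    then show ?case by (cases "y \<in> W") auto
  qed
  then obtain N B where NB: "N \<in> W" "B \<in> U - W" "adjacent T N B" using reach[OF v(1)] v(2) by blast
  then obtain p where p: "p \<in> edges T" "ends T p = {N, B}" unfolding adjacent_def by auto
  have "q = p" if q: "q \<in> edges T" "B \<in> ends T q" "ends T q \<inter> W \<noteq> {}" for q
  proof -
    obtain N' where N': "N' \<in> ends T q" "N' \<in> W" using q(3) by auto
    have "N' \<noteq> B" using N' NB by auto
    then have e: "ends T q = {N', B}"
      using is_treeD(6)[OF T q(1)] q(2) N'(1) by (auto simp: card_2_iff)
    have "N' = N"
    proof (rule ccontr)
      assume ne: "N' \<noteq> N"
      obtain ps where ps: "ps \<noteq> []" "hd ps = N" "last ps = N'" "distinct ps" "set ps \<subseteq> W"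
        "successively (adjacent T) ps" using grown_path[OF W NB(1) N'(2)] by metis
      have "2 \<le> length ps" using ps(1-3) ne by (cases ps; cases "tl ps") auto
      moreover have "adjacent T N' B" using e q(1) unfolding adjacent_def by auto
      moreover have "set ps \<subseteq> verts T" using ps(5) U by auto
      ultimately have "graph_cycle T (B # ps)"
        unfolding graph_cycle_def using ps NB U(1) adjacent_sym[OF NB(3)]
        by (auto simp: successively_Cons)
      then show False using is_treeD(8)[OF T] by blast
    qed
    then show ?thesis using e p q(1) is_treeD(4)[OF T] by (metis inj_onD)
  qed
  note uniq = this
  have "attaches T W B p N"
    unfolding attaches_def
  proof (intro conjI ballI impI)
    show "B \<in> verts T" "B \<notin> W" using NB(2) U(1) by auto
    show "q = p" if "q \<in> edges T" "B \<in> ends T q" "ends T q \<inter> W \<noteq> {}" for q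
      using uniq[OF that] .
  qed (rule p NB(1))+
  then show ?thesis using NB by auto
qed

lemma reach_grown:
  assumes T: "is_tree T" and U: "U \<subseteq> verts T" and reach: "\<And>v. v \<in> U \<Longrightarrow> (step_in T U)\<^sup>*\<^sup>* A v"
    and W: "grown T A W" "W \<subseteq> U"
  shows "grown T A U"
  using W
proof (induction "card (U - W)" arbitrary: W rule: less_induct)
  case less
  show ?case
  proof (cases "W = U")
    case True
    then show ?thesis using less by simp
  next
    case False
    then obtain B p N where B: "B \<in> U - W" "attaches T W B p N"
      using tree_attaches[OF T less(2) U less(3) _ reach] by auto
    have "finite (U - W)" using U is_treeD(1)[OF T] finite_subset by blast
    then have "card (U - insert B W) < card (U - W)"
      using B(1) by (intro psubset_card_mono) auto
    then show ?thesis using less(1)[OF _ grown.attach[OF less(2) B(2)]] less(3) B(1) by auto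
  qed
qed

text \<open>Growing \<open>W\<close> to \<open>U\<close> has a final step, and the vertex added
  there is a leaf of \<open>U\<close> outside \<open>W\<close>. Applied to a path \<open>W\<close>,
  it yields a leaf off that path.\<close>

lemma last_attached:
  assumes T: "is_tree T" and U: "U \<subseteq> verts T" and reach: "\<And>v. v \<in> U \<Longrightarrow> (step_in T U)\<^sup>*\<^sup>* A v"
    and W: "grown T A W" "W \<subseteq> U" "W \<noteq> U"
  shows "\<exists>B \<in> U - W. \<exists>p N. grown T A (U - {B}) \<and> attaches T (U - {B}) B p N"
  using W
proof (induction "card (U - W)" arbitrary: W rule: less_induct)
  case less
  obtain B p N where B: "B \<in> U - W" "attaches T W B p N"
    using tree_attaches[OF T less(2) U less(3,4) reach] by auto
  note g = grown.attach[OF less(2) B(2)]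
  show ?case
  proof (cases "insert B W = U")
    case True
    then have "U - {B} = W" using B(1) by auto
    then show ?thesis using B less(2) by auto
  next
    case False
    have "finite (U - W)" using U is_treeD(1)[OF T] finite_subset by blast
    then have "card (U - insert B W) < card (U - W)"
      using B(1) by (intro psubset_card_mono) auto
    then show ?thesis using less(1)[OF _ g _ False] less(3) B(1) by auto
  qed
qed

lemma successively_reach:
  assumes "successively (adjacent T) ps" "set ps \<subseteq> U" "ps \<noteq> []" "v \<in> set ps"
  shows "(step_in T U)\<^sup>*\<^sup>* (hd ps) v"
  using assms
proof (induction ps)
  case (Cons a ps)
  show ?case
  proof (cases "v = a")
    case False
    then have "ps \<noteq> []" "v \<in> set ps" using Cons(5) by auto
    moreover have "successively (adjacent T) ps" "adjacent T a (hd ps)"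
      using Cons(2) \<open>ps \<noteq> []\<close> by (auto simp: successively_Cons)
    moreover have "hd ps \<in> U" "a \<in> U" using Cons(3) \<open>ps \<noteq> []\<close> by (auto simp: hd_in_set subsetD)
    ultimately show ?thesis using Cons(1,3) converse_rtranclp_into_rtranclp[of "step_in T U" a "hd ps" v]
      by auto
  qed simp
qed simp

lemma grown_reach:
  assumes "grown T A W" "x \<in> W" "y \<in> W"
  shows "(step_in T W)\<^sup>*\<^sup>* x y"
proof -
  obtain ps where ps: "ps \<noteq> []" "hd ps = x" "last ps = y" "set ps \<subseteq> W" "successively (adjacent T) ps"
    using grown_path[OF assms] by metis
  then have "y \<in> set ps" using last_in_set by blast
  then show ?thesis using successively_reach[OF ps(5,4,1)] ps(2) by simp
qed

lemma list_grown:
  assumes T: "is_tree T" and ps: "ps \<noteq> []" "set ps \<subseteq> verts T" "successively (adjacent T) ps"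
  shows "grown T (hd ps) (set ps)"
proof (rule reach_grown[OF T ps(2)])
  show "(step_in T (set ps))\<^sup>*\<^sup>* (hd ps) v" if "v \<in> set ps" for v
    using successively_reach[OF ps(3) _ ps(1) that] by simp
  show "grown T (hd ps) {hd ps}" by (rule grown.single) (use ps in auto)
qed (use ps in auto)

text \<open>The root must be movable because \<open>grown_space\<close> handles deletions inside the
  root label only.\<close>

lemma regrow:
  assumes T: "is_tree T" and W: "grown T A W" and B: "B \<in> W"
  shows "grown T B W"
proof (rule reach_grown[OF T])
  show "W \<subseteq> verts T" using grown_verts[OF W] by simp
  then show "grown T B {B}" using B by (intro grown.single) auto
qed (use B grown_reach[OF W B] in auto)

lemma step_in_verts:
  assumes "is_tree T"
  shows "step_in T (verts T) = adjacent T"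
  using is_treeD(5)[OF assms] unfolding adjacent_def fun_eq_iff by fastforce

lemma tree_grown:
  assumes T: "is_tree T" and A: "A \<in> verts T"
  shows "grown T A (verts T)"
proof (rule reach_grown[OF T subset_refl])
  show "grown T A {A}" using A by (rule grown.single)
qed (use A is_treeD(7)[OF T] step_in_verts[OF T] in auto)

text \<open>The vertex attached last carries at most one edge to the others, so removing it from
  \<open>U\<close> costs one vertex and at most one edge.\<close>

lemma grown_sparse:
  assumes T: "is_tree T" and "grown T A W"
  shows "\<forall>U. U \<subseteq> W \<longrightarrow> U \<noteq> {} \<longrightarrow> card (inner_edges T U) < card U"
  using assms(2)
proof (induction rule: grown.induct)
  case single
  show ?case
  proof (intro allI impI)
    fix U assume "U \<subseteq> {A}" "U \<noteq> {}"
    then have "U = {A}" by auto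
    then show "card (inner_edges T U) < card U" using inner_edges_single[OF T] by simp
  qed
next
  case (attach W B p N)
  show ?case
  proof (intro allI impI)
    fix U assume U: "U \<subseteq> insert B W" "U \<noteq> {}"
    show "card (inner_edges T U) < card U"
    proof (cases "B \<in> U \<and> U \<noteq> {B}")
      case False
      then show ?thesis using U attach(3) inner_edges_single[OF T, of B] by (cases "B \<in> U") auto
    next
      case True
      let ?V = "U - {B}"
      have V: "?V \<subseteq> W" "?V \<noteq> {}" using U True by auto
      have "inner_edges T U \<subseteq> insert p (inner_edges T ?V)"
      proof
        fix q assume q: "q \<in> inner_edges T U"
        show "q \<in> insert p (inner_edges T ?V)"
        proof (cases "B \<in> ends T q")
          case False
          then show ?thesis using q by (auto simp: inner_edges_def)
        next
          case True
          have e: "q \<in> edges T" "ends T q \<subseteq> U" using q by (auto simp: inner_edges_def)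
          have "ends T q \<inter> W \<noteq> {}" using ends_not_single[OF T e(1), of B] e(2) U(1) by auto
          then show ?thesis using attach(2) e(1) True unfolding attaches_def by auto
        qed
      qed
      moreover have fin: "finite (inner_edges T ?V)" using is_treeD(2)[OF T] by (simp add: inner_edges_def)
      ultimately have "card (inner_edges T U) \<le> Suc (card (inner_edges T ?V))"
        using card_mono[of "insert p (inner_edges T ?V)" "inner_edges T U"]
          card_insert_le[of "inner_edges T ?V" p] by (simp add: card_insert_if split: if_splits)
      also have "\<dots> < Suc (card ?V)" using attach(3) V by auto
      also have "\<dots> = card U"
      proof -
        have "finite W" using grown_verts[OF attach(1)] is_treeD(1)[OF T] finite_subset by blast
        then have "finite U" using U(1) finite_subset by blast
        then show ?thesis using True card_Suc_Diff1[of U B] by simp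
      qed
      finally show ?thesis .
    qed
  qed
qed

lemma tree_sparse:
  assumes T: "is_tree T"
  shows "sparse T"
proof -
  obtain A where "A \<in> verts T" using is_treeD(3)[OF T] by auto
  then show ?thesis using grown_sparse[OF T tree_grown[OF T]] unfolding sparse_def by blast
qed

lemma tree_no_chord:
  assumes T: "is_tree T" and ps: "distinct ps" "set ps \<subseteq> verts T" "successively (adjacent T) ps"
    and q: "q \<in> edges T" "ends T q = {ps ! i, ps ! j}" and ij: "i < j" "j < length ps"
  shows "j = Suc i"
proof (rule ccontr)
  assume "j \<noteq> Suc i"
  then have far: "i + 2 \<le> j" using ij(1) by simp
  \<comment> \<open>The segment of \<open>ps\<close> between the two ends; having at least three
    vertices, it is closed to a cycle by \<open>q\<close>.\<close>
  define vs where "vs = take (Suc j - i) (drop i ps)"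
  have len: "length vs = Suc j - i" using ij by (simp add: vs_def)
  have nth: "vs ! k = ps ! (i + k)" if "k < Suc j - i" for k
    using that ij by (simp add: vs_def)
  have ne: "vs \<noteq> []" using len ij by auto
  have "hd vs = ps ! i" using hd_conv_nth[OF ne] nth[of 0] ij by simp
  moreover have "last vs = ps ! j" using last_conv_nth[OF ne] len nth[of "j - i"] ij by simp
  moreover have "successively (adjacent T) vs"
    unfolding successively_conv_nth
  proof (intro allI impI)
    fix k assume "Suc k < length vs"
    then have k: "Suc k < Suc j - i" using len by simp
    then have "adjacent T (ps ! (i + k)) (ps ! Suc (i + k))"
      using ps(3) ij unfolding successively_conv_nth by auto
    then show "adjacent T (vs ! k) (vs ! Suc k)" using nth[of k] nth[of "Suc k"] k by simp
  qed
  moreover have "distinct vs" "set vs \<subseteq> verts T" "3 \<le> length vs"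
    using ps(1,2) len far set_take_subset[of "Suc j - i" "drop i ps"] set_drop_subset[of i ps]
    by (auto simp: vs_def)
  moreover have "adjacent T (ps ! j) (ps ! i)"
    using q unfolding adjacent_def by (metis insert_commute)
  ultimately have "graph_cycle T vs" unfolding graph_cycle_def by simp
  then show False using is_treeD(8)[OF T] by blast
qed

lemma spanning_list_is_path:
  assumes T: "is_tree T" and ps: "ps \<noteq> []" "distinct ps" "set ps = verts T" "successively (adjacent T) ps"
  shows "is_path T ps"
proof -
  have "ends T ` edges T = {{ps ! i, ps ! Suc i} | i. Suc i < length ps}"
  proof
    show "ends T ` edges T \<subseteq> {{ps ! i, ps ! Suc i} | i. Suc i < length ps}"
    proof
      fix X assume "X \<in> ends T ` edges T"
      then obtain q where q: "q \<in> edges T" "X = ends T q" by auto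
      obtain u v where uv: "u \<noteq> v" "X = {u, v}" using is_treeD(6)[OF T q(1)] q(2) by (auto simp: card_2_iff)
      then have "u \<in> set ps" "v \<in> set ps" using is_treeD(5)[OF T q(1)] q(2) ps(3) by auto
      then obtain i j where ij: "i < length ps" "u = ps ! i" "j < length ps" "v = ps ! j"
        by (metis in_set_conv_nth)
      have "\<exists>i. Suc i < length ps \<and> X = {ps ! i, ps ! Suc i}"
      proof (cases "i < j")
        case True
        then have "j = Suc i" using tree_no_chord[OF T ps(2) _ ps(4) q(1), of i j] ps(3) q(2) uv ij by auto
        then show ?thesis using ij uv by auto
      next
        case False
        then have "j < i" using uv(1) ij by (metis linorder_neqE_nat)
        then have "i = Suc j"
          using tree_no_chord[OF T ps(2) _ ps(4) q(1), of j i] ps(3) q(2) uv ij by auto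
        then show ?thesis using ij uv by auto
      qed
      then show "X \<in> {{ps ! i, ps ! Suc i} | i. Suc i < length ps}" by blast
    qed
    show "{{ps ! i, ps ! Suc i} | i. Suc i < length ps} \<subseteq> ends T ` edges T"
      using ps(4) unfolding successively_conv_nth adjacent_def by blast
  qed
  then show ?thesis using T ps unfolding is_path_def is_tree_def by simp
qed

section \<open>Cycle spaces of subtrees\<close>

locale label_tree =
  fixes T :: "'a matroid_graph"
  assumes tree: "is_tree T" and inc: "incidence T"
    and labels: "A \<in> verts T \<Longrightarrow> matroid A" "A \<in> verts T \<Longrightarrow> connected_matroid A"
      "A \<in> verts T \<Longrightarrow> 3 \<le> card (ground A)" "A \<in> verts T \<Longrightarrow> cycles_dependent A"
begin

abbreviation "V \<equiv> verts T"
abbreviation "G \<equiv> part_ground T"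
abbreviation "K \<equiv> part_cycles T"

lemma label_binary: "A \<in> V \<Longrightarrow> gf2_matroid A"
  using labels(1,4) by (simp add: gf2_matroid_def gf2_matroid_axioms_def)

lemma label_space:
  assumes "A \<in> V"
  shows "cycle_space (ground A) (cycles A)" "connected_space {} (ground A) (cycles A)"
  using gf2_matroid.space[OF label_binary[OF assms]]
    gf2_matroid.connected_space_cycles[OF label_binary[OF assms] labels(2)[OF assms]]
    labels(3)[OF assms] by auto

lemma part_single: "G {A} = ground A" "K {A} = cycles A"
proof -
  show "G {A} = ground A" by (simp add: part_ground_def inner_edges_single[OF tree])
  have "K {A} = {z A | z. z A \<in> cycles A}"
    by (simp add: part_cycles_def compatible_def inner_edges_single[OF tree])
  also have "\<dots> = cycles A" by (auto intro!: exI[of _ "\<lambda>_. _"])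
  finally show "K {A} = cycles A" .
qed

lemma edge_in_label: "q \<in> edges T \<Longrightarrow> A \<in> ends T q \<Longrightarrow> A \<in> V \<and> q \<in> ground A"
  using incidenceD(3,5)[OF inc] by blast

text \<open>The two parts need not exhaust the tree, so that subtrees can be split as well.\<close>

definition split :: "'a pre_matroid set \<Rightarrow> 'a pre_matroid set \<Rightarrow> 'a \<Rightarrow> bool" where
  "split W1 W2 p \<longleftrightarrow> W1 \<subseteq> V \<and> W2 \<subseteq> V \<and> W1 \<inter> W2 = {} \<and> p \<in> edges T \<and>
     (\<exists>A \<in> W1. \<exists>B \<in> W2. ends T p = {A, B}) \<and>
     (\<forall>q \<in> edges T. ends T q \<inter> W1 \<noteq> {} \<longrightarrow> ends T q \<inter> W2 \<noteq> {} \<longrightarrow> q = p)"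

lemma split_unique:
  "split W1 W2 p \<Longrightarrow> q \<in> edges T \<Longrightarrow> ends T q \<inter> W1 \<noteq> {} \<Longrightarrow> ends T q \<inter> W2 \<noteq> {} \<Longrightarrow> q = p"
  unfolding split_def by metis

lemma splitI:
  assumes "W1 \<subseteq> V" "W2 \<subseteq> V" "W1 \<inter> W2 = {}" "p \<in> edges T" "A \<in> W1" "B \<in> W2" "ends T p = {A, B}"
    and "\<And>q. q \<in> edges T \<Longrightarrow> ends T q \<inter> W1 \<noteq> {} \<Longrightarrow> ends T q \<inter> W2 \<noteq> {} \<Longrightarrow> q = p"
  shows "split W1 W2 p"
  unfolding split_def
  by (intro conjI bexI[of _ A] bexI[of _ B] ballI impI) (fact assms)+

lemma inner_split:
  assumes "split W1 W2 p"
  shows "inner_edges T (W1 \<union> W2) = insert p (inner_edges T W1 \<union> inner_edges T W2)"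
    "p \<notin> inner_edges T W1" "p \<notin> inner_edges T W2"
proof -
  obtain A B where AB: "A \<in> W1" "B \<in> W2" "ends T p = {A, B}" using assms by (auto simp: split_def)
  have dis: "W1 \<inter> W2 = {}" and pe: "p \<in> edges T" using assms by (auto simp: split_def)
  show "p \<notin> inner_edges T W1" "p \<notin> inner_edges T W2"
    using AB dis by (auto simp: inner_edges_def)
  have "q \<in> insert p (inner_edges T W1 \<union> inner_edges T W2)" if q: "q \<in> inner_edges T (W1 \<union> W2)" for q
  proof (cases "ends T q \<inter> W1 = {} \<or> ends T q \<inter> W2 = {}")
    case True
    then show ?thesis using q by (auto simp: inner_edges_def)
  next
    case False
    then have "q = p" using assms q by (auto simp: split_def inner_edges_def)
    then show ?thesis by simp
  qed
  moreover have "p \<in> inner_edges T (W1 \<union> W2)" using AB pe by (auto simp: inner_edges_def)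
  ultimately show "inner_edges T (W1 \<union> W2) = insert p (inner_edges T W1 \<union> inner_edges T W2)"
    by (auto simp: inner_edges_def)
qed

lemma split_commute: "split W1 W2 p \<Longrightarrow> split W2 W1 p"
proof -
  assume s: "split W1 W2 p"
  then obtain A B where AB: "A \<in> W1" "B \<in> W2" "ends T p = {A, B}" by (auto simp: split_def)
  show "split W2 W1 p"
    by (rule splitI[OF _ _ _ _ AB(2,1)]) (use s AB(3) in \<open>auto simp: split_def\<close>)
qed

lemma inner_not_in_other:
  assumes "split W1 W2 p" "A \<in> W1" "x \<in> ground A"
  shows "x \<notin> inner_edges T W2"
proof
  assume x: "x \<in> inner_edges T W2"
  have A: "A \<in> V" using assms(1,2) by (auto simp: split_def)
  have "A \<in> ends T x" using incidenceD(5)[OF inc _ A] x assms(3) by (auto simp: inner_edges_def)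
  then show False using x assms(1,2) by (auto simp: inner_edges_def split_def)
qed

lemma part_ground_split:
  assumes s: "split W1 W2 p"
  shows "G (W1 \<union> W2) = G W1 \<union> G W2 - {p}" "G W1 \<inter> G W2 = {p}"
proof -
  show "G (W1 \<union> W2) = G W1 \<union> G W2 - {p}"
    unfolding part_ground_def inner_split(1)[OF s]
    using inner_not_in_other[OF s] inner_not_in_other[OF split_commute[OF s]] by auto
  obtain A B where AB: "A \<in> W1" "B \<in> W2" "ends T p = {A, B}" and pe: "p \<in> edges T"
    using s by (auto simp: split_def)
  have pG: "p \<in> G W1 \<inter> G W2"
    using edge_in_label[OF pe] AB inner_split(2,3)[OF s] by (auto simp: part_ground_def)
  have "G W1 \<inter> G W2 \<subseteq> {p}"
  proof
    fix x assume x: "x \<in> G W1 \<inter> G W2"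
    obtain A B where A: "A \<in> W1" "x \<in> ground A" and B: "B \<in> W2" "x \<in> ground B"
      using x by (auto simp: part_ground_def)
    have AV: "A \<in> V" "B \<in> V" "A \<noteq> B" using A B s by (auto simp: split_def)
    then have xe: "x \<in> edges T" using incidenceD(6)[OF inc AV(1,2) A(2) B(2)] by auto
    then have "A \<in> ends T x" "B \<in> ends T x" using incidenceD(5)[OF inc xe] A B AV by auto
    then have "ends T x \<inter> W1 \<noteq> {}" "ends T x \<inter> W2 \<noteq> {}" using A(1) B(1) by auto
    then show "x \<in> {p}" using split_unique[OF s xe] by simp
  qed
  then show "G W1 \<inter> G W2 = {p}" using pG by (metis empty_iff subset_singletonD)
qed

lemma compatible_subset:
  assumes "compatible T W z" "X \<subseteq> W"
  shows "compatible T X z"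
proof -
  have "inner_edges T X \<subseteq> inner_edges T W" using assms(2) by (auto simp: inner_edges_def)
  then show ?thesis using assms unfolding compatible_def by blast
qed

lemma compatible_cong:
  assumes "compatible T W z" "\<And>A. A \<in> W \<Longrightarrow> y A = z A"
  shows "compatible T W y"
proof -
  have "y A = z A" if "p \<in> inner_edges T W" "A \<in> ends T p" for p A
    using that assms(2) by (auto simp: inner_edges_def)
  then show ?thesis using assms unfolding compatible_def by metis
qed

text \<open>Compatibility on the union is compatibility on each part plus agreement at the one
  connecting edge, which is the condition for gluing at \<open>p\<close>.\<close>

lemma part_cycles_split:
  assumes s: "split W1 W2 p"
  shows "K (W1 \<union> W2) = two_sum_space p (K W1) (K W2)"
proof -
  obtain A B where AB: "A \<in> W1" "B \<in> W2" "ends T p = {A, B}" and pe: "p \<in> edges T"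
    using s by (auto simp: split_def)
  have W: "W1 \<subseteq> V" "W2 \<subseteq> V" "W1 \<inter> W2 = {}" using s by (auto simp: split_def)
  define part where "part W z = (\<Union>N \<in> W. z N) - inner_edges T W"
    for W and z :: "'a pre_matroid \<Rightarrow> 'a set"
  have sub: "z N \<subseteq> ground N" if "compatible T W z" "N \<in> W" for W z N
    using that cycles_subset_ground by (auto simp: compatible_def)
  \<comment> \<open>A part contains only one end of \<open>p\<close>, and \<open>p\<close> is no
    inner edge of it, so membership of \<open>p\<close> is decided by that one label.\<close>
  have at: "p \<in> part W z \<longleftrightarrow> p \<in> z X"
    if z: "compatible T W z" and X: "W \<subseteq> V" "X \<in> W" "{A, B} \<inter> W = {X}" "p \<notin> inner_edges T W"
    for W X z
  proof -
    have "N = X" if N: "N \<in> W" "p \<in> z N" for N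
    proof -
      have "p \<in> ground N" "N \<in> V" using sub[OF z N(1)] N X(1) by auto
      then have "N \<in> {A, B}" using incidenceD(5)[OF inc pe] AB(3) by auto
      then show ?thesis using N(1) X(3) by auto
    qed
    then show ?thesis using X(2,4) by (auto simp: part_def)
  qed
  have "{A, B} \<inter> W1 = {A}" "{A, B} \<inter> W2 = {B}" using AB(1,2) W(3) by auto
  note at_p = at[OF _ W(1) AB(1) this(1) inner_split(2)[OF s]]
    and at_p2 = at[OF _ W(2) AB(2) this(2) inner_split(3)[OF s]]
  have union: "part (W1 \<union> W2) z = (part W1 z \<union> part W2 z) - {p}"
    if z: "compatible T W1 z" "compatible T W2 z" for z
  proof -
    have "x \<notin> inner_edges T W2" if "N \<in> W1" "x \<in> z N" for N x
      using inner_not_in_other[OF s that(1)] sub[OF z(1) that(1)] that(2) by auto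
    moreover have "x \<notin> inner_edges T W1" if "N \<in> W2" "x \<in> z N" for N x
      using inner_not_in_other[OF split_commute[OF s] that(1)] sub[OF z(2) that(1)] that(2) by auto
    ultimately show ?thesis unfolding part_def inner_split(1)[OF s] by blast
  qed
  have mem: "Z \<in> K W \<longleftrightarrow> (\<exists>z. Z = part W z \<and> compatible T W z)" for Z W
    by (auto simp: part_cycles_def part_def)
  show ?thesis
  proof
    show "K (W1 \<union> W2) \<subseteq> two_sum_space p (K W1) (K W2)"
    proof
      fix Z assume "Z \<in> K (W1 \<union> W2)"
      then obtain z where z: "Z = part (W1 \<union> W2) z" "compatible T (W1 \<union> W2) z" using mem by auto
      have z12: "compatible T W1 z" "compatible T W2 z" using compatible_subset[OF z(2)] by auto
      have "p \<in> inner_edges T (W1 \<union> W2)" using inner_split(1)[OF s] by simp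
      then have "p \<in> z A \<longleftrightarrow> p \<in> z B" using z(2) AB(3) unfolding compatible_def by blast
      then have "p \<in> part W1 z \<longleftrightarrow> p \<in> part W2 z" using at_p[OF z12(1)] at_p2[OF z12(2)] by simp
      moreover have "part W1 z \<in> K W1" "part W2 z \<in> K W2" using mem z12 by auto
      ultimately show "Z \<in> two_sum_space p (K W1) (K W2)"
        unfolding two_sum_space_def z(1) union[OF z12] by blast
    qed
    show "two_sum_space p (K W1) (K W2) \<subseteq> K (W1 \<union> W2)"
    proof
      fix Z assume "Z \<in> two_sum_space p (K W1) (K W2)"
      then obtain Z1 Z2 where Z: "Z1 \<in> K W1" "Z2 \<in> K W2" "p \<in> Z1 \<longleftrightarrow> p \<in> Z2" "Z = (Z1 \<union> Z2) - {p}"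
        unfolding two_sum_space_def by auto
      obtain z1 where z1: "Z1 = part W1 z1" "compatible T W1 z1" using mem Z(1) by auto
      obtain z2 where z2: "Z2 = part W2 z2" "compatible T W2 z2" using mem Z(2) by auto
      define z where "z N = (if N \<in> W1 then z1 N else z2 N)" for N
      have eq: "z N = z1 N" if "N \<in> W1" for N using that by (simp add: z_def)
      have eq2: "z N = z2 N" if "N \<in> W2" for N using that W(3) by (auto simp: z_def)
      have c: "compatible T W1 z" "compatible T W2 z"
        using compatible_cong[OF z1(2) eq] compatible_cong[OF z2(2) eq2] by auto
      have parts: "part W1 z = Z1" "part W2 z = Z2"
        unfolding part_def z1(1) z2(1) using eq eq2 by auto
      have pz: "p \<in> z A \<longleftrightarrow> p \<in> z B" using at_p[OF c(1)] at_p2[OF c(2)] parts Z(3) by simp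
      have "compatible T (W1 \<union> W2) z"
        unfolding compatible_def
      proof (intro conjI ballI impI)
        show "z N \<in> cycles N" if "N \<in> W1 \<union> W2" for N using that c by (auto simp: compatible_def)
        fix q C D assume q: "q \<in> inner_edges T (W1 \<union> W2)" "C \<in> ends T q" "D \<in> ends T q" "q \<in> z C"
        consider "q = p" | "q \<in> inner_edges T W1" | "q \<in> inner_edges T W2"
          using q(1) inner_split(1)[OF s] by auto
        then show "q \<in> z D"
        proof cases
          case 1 then show ?thesis using q pz AB(3) by auto
        next
          case 2 then show ?thesis using q(2-4) c(1) unfolding compatible_def by blast
        next
          case 3 then show ?thesis using q(2-4) c(2) unfolding compatible_def by blast
        qed
      qed
      moreover have "Z = part (W1 \<union> W2) z" using union[OF c] parts Z(4) by simp
      ultimately show "Z \<in> K (W1 \<union> W2)" using mem by auto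
    qed
  qed
qed

lemma split_space_sum:
  assumes s: "split W1 W2 p" and "cycle_space (G W1) (K W1)" "cycle_space (G W2) (K W2)"
    "connected_space F1 (G W1) (K W1)" "connected_space F2 (G W2) (K W2)"
  shows "space_sum p (G W1) (G W2) (K W1) (K W2)"
  using assms(2,3) part_ground_split(2)[OF s] connected_spaceD(1)[OF assms(4)]
    connected_spaceD(1)[OF assms(5)]
  by unfold_locales auto

lemma attaches_split:
  assumes "attaches T W B p N" "W \<subseteq> V"
  shows "split W {B} p"
  using assms unfolding attaches_def split_def by auto

text \<open>Each attachment is a 2-sum with a connected label, so connectedness persists;
  \<open>F\<close> has to stay clear of the basepoints used up on the way.\<close>

lemma grown_space:
  assumes "grown T A W" "F \<subseteq> ground A" "connected_space F (ground A) (cycles A)"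
    "F \<inter> inner_edges T W = {}"
  shows "cycle_space (G W) (K W) \<and> connected_space F (G W) (K W)"
  using assms
proof (induction rule: grown.induct)
  case single
  then show ?case using label_space[of A] by (simp add: part_single)
next
  case (attach W B p N)
  have W: "A \<in> W" "W \<subseteq> V" using grown_verts[OF attach(1)] by auto
  have s: "split W {B} p" using attaches_split[OF attach(2) W(2)] .
  have BV: "B \<in> V" using attach(2) by (simp add: attaches_def)
  have inn: "inner_edges T (insert B W) = insert p (inner_edges T W)"
    using inner_split(1)[OF s] inner_edges_single[OF tree] by simp
  then have F: "p \<notin> F" "F \<inter> inner_edges T W = {}" using attach(6) by auto
  have IH: "cycle_space (G W) (K W)" "connected_space F (G W) (K W)"
    using attach(3)[OF attach(4,5) F(2)] by auto
  have B: "cycle_space (G {B}) (K {B})" "connected_space {} (G {B}) (K {B})"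
    using label_space[OF BV] by (simp_all add: part_single)
  interpret S: space_sum p "G W" "G {B}" "K W" "K {B}"
    using split_space_sum[OF s IH(1) B(1) IH(2) B(2)] .
  have "F \<subseteq> G W" using attach(4) W(1) F(2) by (auto simp: part_ground_def)
  then show ?case
    using S.sum_space S.sum_connected[OF IH(2) B(2) _ F(1)]
      part_ground_split(1)[OF s] part_cycles_split[OF s] by simp
qed

lemma grown_space0:
  assumes "grown T A W"
  shows "cycle_space (G W) (K W)" "connected_space {} (G W) (K W)"
  using grown_space[OF assms, of "{}"] label_space[of A] grown_verts[OF assms] by auto

lemma spanning_cut:
  assumes s: "split W1 W2 p" and W: "grown T A W1" "grown T B W2"
    and span: "pair_spanning (G (W1 \<union> W2)) (K (W1 \<union> W2)) e f"
    and ef: "f \<in> G W2" "f \<noteq> p" "e \<noteq> p"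
  shows "pair_spanning (G W1) (K W1) e p"
proof -
  note W = grown_space0[OF W(1)] grown_space0[OF W(2)]
  interpret S: space_sum p "G W1" "G W2" "K W1" "K W2"
    using split_space_sum[OF s W(1,3,2,4)] .
  show ?thesis
    using S.pair_spanning_left[OF _ ef W(4)] span part_ground_split(1)[OF s] part_cycles_split[OF s]
    by simp
qed

lemma path_covers:
  assumes simple: "\<And>x y. x \<noteq> y \<Longrightarrow> {x, y} \<notin> K V"
    and deletion: "\<And>A B p. p \<in> edges T \<Longrightarrow> ends T p = {A, B} \<Longrightarrow> min_cycle (cycles B) (ground B) \<Longrightarrow>
      connected_space {p} (ground A) (cycles A)"
    and ps: "ps \<noteq> []" "set ps \<subseteq> V" "successively (adjacent T) ps"
    and e: "e \<in> ground (hd ps)" "e \<notin> edges T" and f: "f \<in> ground (last ps)" "f \<notin> edges T"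
    and span: "pair_spanning (G V) (K V) e f"
  shows "set ps = V"
proof (rule ccontr)
  assume ne: "set ps \<noteq> V"
  have hd: "hd ps \<in> V" using ps by auto
  have reach: "(step_in T V)\<^sup>*\<^sup>* (hd ps) v" if "v \<in> V" for v
    using is_treeD(7)[OF tree hd that] step_in_verts[OF tree] by simp
  \<comment> \<open>\<open>B\<close> is a leaf of the tree off the path, so both \<open>e\<close>
    and \<open>f\<close> lie on the side of \<open>V - {B}\<close>.\<close>
  obtain B p N where B: "B \<in> V - set ps" "grown T (hd ps) (V - {B})" "attaches T (V - {B}) B p N"
    using last_attached[OF tree subset_refl reach list_grown[OF tree ps] ps(2) ne] by auto
  let ?W = "V - {B}"
  have s: "split ?W {B} p" using attaches_split[OF B(3)] by auto
  have W: "cycle_space (G ?W) (K ?W)" "connected_space {} (G ?W) (K ?W)"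
    using grown_space0[OF B(2)] by auto
  have BV: "B \<in> V" using B(1) by simp
  have Bs: "cycle_space (G {B}) (K {B})" "connected_space {} (G {B}) (K {B})"
    using label_space[OF BV] by (simp_all add: part_single)
  interpret S: space_sum p "G ?W" "G {B}" "K ?W" "K {B}"
    using split_space_sum[OF s W(1) Bs(1) W(2) Bs(2)] .
  have V: "?W \<union> {B} = V" using BV by auto
  have span': "pair_spanning S.E S.K e f"
    using span part_ground_split(1)[OF s] part_cycles_split[OF s] V by simp
  have simple': "{x, y} \<notin> S.K" if "x \<noteq> y" for x y
    using simple[OF that] part_cycles_split[OF s] V by simp
  have pe: "p \<in> edges T" "ends T p = {N, B}" and NW: "N \<in> ?W"
    using B(3) by (auto simp: attaches_def)
  have big: "3 \<le> card (G {B})" using labels(3)[OF BV] by (simp add: part_single)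
  have inn: "inner_edges T ?W \<subseteq> edges T" by (auto simp: inner_edges_def)
  have "hd ps \<in> ?W" "last ps \<in> ?W" using ps(1,2) B(1) by (auto simp: subset_iff)
  then have ef: "e \<in> G ?W" "f \<in> G ?W" using e f inn by (auto simp: part_ground_def)
  have ep: "e \<noteq> p" "f \<noteq> p" using pe(1) e f by auto
  have "min_cycle (cycles B) (ground B)"
    using S.right_is_circuit[OF span' simple' big ef(1) ep(1) ef(2) ep(2) W(2) Bs(2)]
    by (simp add: part_single)
  then have "connected_space {p} (ground N) (cycles N)" using deletion[OF pe] by simp
  moreover have "p \<in> ground N" using edge_in_label[OF pe(1)] pe(2) by auto
  moreover have "p \<notin> inner_edges T ?W" using pe(2) by (auto simp: inner_edges_def)
  \<comment> \<open>Growing the remaining tree from the neighbour \<open>N\<close> spreads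
    connectivity without \<open>p\<close> from the label \<open>N\<close> to all of it; this gives a
    circuit through \<open>e\<close> and \<open>f\<close> of the kind \<open>no_avoiding\<close>
    excludes.\<close>
  ultimately have "connected_space {p} (G ?W) (K ?W)"
    using grown_space[OF regrow[OF tree B(2) NW], of "{p}"] by simp
  then obtain C1 where C1: "min_cycle (K ?W) C1" "e \<in> C1" "f \<in> C1" "C1 \<inter> {p} = {}"
    using connected_spaceD(2)[of "{p}" "G ?W" "K ?W" e f] ef ep by auto
  then have "p \<in> C1" using S.no_avoiding[OF span' simple' big C1(1-3) Bs(2)] by simp
  then show False using C1(4) by auto
qed

lemma two_ends:
  assumes "q \<in> edges T" "A \<in> ends T q" "B \<in> ends T q" "A \<noteq> B"
  shows "ends T q = {A, B}"
  using is_treeD(6)[OF tree assms(1)] assms(2-4) by (auto simp: card_2_iff)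

lemma path_edge_ends:
  assumes P: "distinct (us @ vs)" "set (us @ vs) \<subseteq> V" "successively (adjacent T) (us @ vs)"
    and q: "q \<in> edges T" "u \<in> ends T q" "u \<in> set us" "v \<in> ends T q" "v \<in> set vs"
  shows "u = last us \<and> v = hd vs"
proof -
  obtain i where i: "i < length us" "u = us ! i" using q(3) by (metis in_set_conv_nth)
  obtain j where j: "j < length vs" "v = vs ! j" using q(5) by (metis in_set_conv_nth)
  have "u \<noteq> v" using q(3,5) P(1) by auto
  then have e: "ends T q = {(us @ vs) ! i, (us @ vs) ! (length us + j)}"
    using two_ends[OF q(1,2,4)] i j by (simp add: nth_append)
  have "length us + j = Suc i"
    using tree_no_chord[OF tree P q(1) e] i j by auto
  then have "i = length us - 1" "j = 0" using i by auto
  moreover have "us \<noteq> []" "vs \<noteq> []" using i j by auto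
  ultimately show ?thesis using i j by (simp add: last_conv_nth hd_conv_nth)
qed

lemma path_split:
  assumes P: "distinct (us @ vs)" "set (us @ vs) \<subseteq> V" "successively (adjacent T) (us @ vs)"
    and ne: "us \<noteq> []" "vs \<noteq> []"
  shows "\<exists>p \<in> edges T. ends T p = {last us, hd vs} \<and> split (set us) (set vs) p"
proof -
  have "adjacent T (last us) (hd vs)" using P(3) ne by (simp add: successively_append_iff)
  then obtain p where p: "p \<in> edges T" "ends T p = {last us, hd vs}" unfolding adjacent_def by auto
  have "q = p" if q: "q \<in> edges T" "ends T q \<inter> set us \<noteq> {}" "ends T q \<inter> set vs \<noteq> {}" for q
  proof -
    obtain u v where uv: "u \<in> ends T q" "u \<in> set us" "v \<in> ends T q" "v \<in> set vs" using q by auto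
    have "u \<noteq> v" using uv P(1) by auto
    then have "ends T q = {u, v}" using two_ends[OF q(1) uv(1,3)] by simp
    then have "ends T q = ends T p" using path_edge_ends[OF P q(1) uv] p(2) by simp
    then show ?thesis using is_treeD(4)[OF tree] q(1) p(1) by (metis inj_onD)
  qed
  then have "split (set us) (set vs) p"
    using splitI[OF _ _ _ p(1) last_in_set[OF ne(1)] hd_in_set[OF ne(2)] p(2)] P(1,2) by simp
  then show ?thesis using p by auto
qed

text \<open>The tree is cut behind \<open>N\<close> and then before \<open>N\<close>; each cut
  replaces the distinguished element beyond it by the connecting edge. No other edge lies in
  \<open>N\<close>, as it would be a chord of the path.\<close>

lemma path_label:
  assumes P: "distinct (xs @ N # ys)" "set (xs @ N # ys) = V" "successively (adjacent T) (xs @ N # ys)"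
    and e: "e \<in> ground (hd (xs @ [N]))" "e \<notin> edges T" and f: "f \<in> ground (last (N # ys))" "f \<notin> edges T"
    and ef: "e \<noteq> f" and span: "pair_spanning (G V) (K V) e f"
  shows "\<exists>e' f'. e' \<noteq> f' \<and> e' \<in> ground N \<and> f' \<in> ground N \<and>
    pair_spanning (ground N) (cycles N) e' f' \<and> edges T \<inter> ground N \<subseteq> {e', f'} \<and>
    (xs = [] \<longrightarrow> e' \<notin> edges T) \<and> (ys = [] \<longrightarrow> f' \<notin> edges T)"
proof -
  have NV: "N \<in> V" and sub: "set xs \<subseteq> V" "set ys \<subseteq> V" using P(2) by auto
  have suc: "successively (adjacent T) (xs @ [N])" "successively (adjacent T) xs"
    "successively (adjacent T) ys"
    using P(3) by (auto simp: successively_append_iff successively_Cons)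
  have gr: "grown T (hd (xs @ [N])) (set (xs @ [N]))"
    using list_grown[OF tree _ _ suc(1)] P(2) by auto
  have nonedge: "x \<in> G W" if "x \<in> ground A" "A \<in> W" "x \<notin> edges T" for x A W
    using that by (auto simp: part_ground_def inner_edges_def)
  have "\<exists>f'. f' \<in> ground N \<and> f' \<noteq> e \<and> pair_spanning (G (set (xs @ [N]))) (K (set (xs @ [N]))) e f' \<and>
    (if ys = [] then f' \<notin> edges T else f' \<in> edges T \<and> ends T f' = {N, hd ys})"
  proof (cases "ys = []")
    case True
    then have "set (xs @ [N]) = V" using P(2) by simp
    then have "pair_spanning (G (set (xs @ [N]))) (K (set (xs @ [N]))) e f" using span by simp
    then show ?thesis using True f ef by (intro exI[of _ f]) auto
  next
    case False
    have P': "distinct ((xs @ [N]) @ ys)" "set ((xs @ [N]) @ ys) \<subseteq> V"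
      "successively (adjacent T) ((xs @ [N]) @ ys)" using P by auto
    obtain p where p: "p \<in> edges T" "ends T p = {N, hd ys}" "split (set (xs @ [N])) (set ys) p"
      using path_split[OF P' _ False] by auto
    have grY: "grown T (hd ys) (set ys)" using list_grown[OF tree False sub(2) suc(3)] .
    have "set (xs @ [N]) \<union> set ys = V" using P(2) by auto
    then have span': "pair_spanning (G (set (xs @ [N]) \<union> set ys)) (K (set (xs @ [N]) \<union> set ys)) e f"
      using span by simp
    have fY: "f \<in> G (set ys)" using nonedge[of f "last ys"] f False by auto
    have "pair_spanning (G (set (xs @ [N]))) (K (set (xs @ [N]))) e p"
      using spanning_cut[OF p(3) gr grY span' fY] p(1) e(2) f(2) by auto
    moreover have "p \<in> ground N" using edge_in_label[OF p(1)] p(2) by auto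
    ultimately show ?thesis using False p e(2) by (intro exI[of _ p]) auto
  qed
  then obtain f' where f': "f' \<in> ground N" "f' \<noteq> e"
    "pair_spanning (G (set (xs @ [N]))) (K (set (xs @ [N]))) e f'"
    "if ys = [] then f' \<notin> edges T else f' \<in> edges T \<and> ends T f' = {N, hd ys}" by blast
  have "\<exists>e'. e' \<in> ground N \<and> e' \<noteq> f' \<and> pair_spanning (ground N) (cycles N) e' f' \<and>
    (if xs = [] then e' \<notin> edges T else e' \<in> edges T \<and> ends T e' = {last xs, N})"
  proof (cases "xs = []")
    case True
    then have "pair_spanning (ground N) (cycles N) e f'" using f'(3) by (simp add: part_single)
    then show ?thesis using True e f'(2) by (intro exI[of _ e]) auto
  next
    case False
    have P': "distinct (xs @ [N])" "set (xs @ [N]) \<subseteq> V" using P by auto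
    obtain p where p: "p \<in> edges T" "ends T p = {last xs, N}" "split (set xs) (set [N]) p"
      using path_split[OF P' suc(1) False] by auto
    have grX: "grown T (hd xs) (set xs)" using list_grown[OF tree False sub(1) suc(2)] .
    have s: "split {N} (set xs) p" using split_commute[OF p(3)] by simp
    have "{N} \<union> set xs = set (xs @ [N])" by auto
    then have span': "pair_spanning (G ({N} \<union> set xs)) (K ({N} \<union> set xs)) f' e"
      using f'(3) pair_spanning_commute by metis
    have eX: "e \<in> G (set xs)" using nonedge[of e "hd xs"] e False by auto
    \<comment> \<open>If both cuts were made at the same edge, the path would repeat a
      vertex.\<close>
    have pf: "f' \<noteq> p"
    proof
      assume "f' = p"
      then have "ys \<noteq> []" "ends T p = {N, hd ys}" using f'(4) p(1) by (auto split: if_splits)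
      then have "last xs = hd ys \<or> last xs = N" using p(2) by auto
      moreover have "last xs \<in> set xs" "hd ys \<in> set ys" using False \<open>ys \<noteq> []\<close> by auto
      ultimately show False using P(1) by auto
    qed
    have "pair_spanning (G {N}) (K {N}) f' p"
      using spanning_cut[OF s grown.single[OF NV] grX span' eX _ pf] p(1) e(2) by auto
    then have "pair_spanning (ground N) (cycles N) p f'"
      using pair_spanning_commute[of _ _ p] by (simp add: part_single)
    moreover have "p \<in> ground N" using edge_in_label[OF p(1)] p(2) by auto
    ultimately show ?thesis using False p pf by (intro exI[of _ p]) auto
  qed
  then obtain e' where e': "e' \<in> ground N" "e' \<noteq> f'" "pair_spanning (ground N) (cycles N) e' f'"
    "if xs = [] then e' \<notin> edges T else e' \<in> edges T \<and> ends T e' = {last xs, N}" by blast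
  have "q \<in> {e', f'}" if q: "q \<in> edges T" "q \<in> ground N" for q
  proof -
    have Nq: "N \<in> ends T q" using incidenceD(5)[OF inc q(1) NV] q(2) by simp
    obtain B where B: "B \<in> ends T q" "B \<noteq> N" using ends_not_single[OF tree q(1), of N] by auto
    then have ends: "ends T q = {N, B}" using two_ends[OF q(1) Nq] by auto
    have "B \<in> V" using B(1) is_treeD(5)[OF tree q(1)] by auto
    then consider "B \<in> set xs" | "B \<in> set ys" using P(2) B(2) by auto
    then show ?thesis
    proof cases
      case 1
      then have "B = last xs" using path_edge_ends[of xs "N # ys" q B N] P q(1) B(1) Nq by auto
      moreover have "xs \<noteq> []" using 1 by auto
      ultimately have "e' \<in> edges T" "ends T q = ends T e'" using e'(4) ends by auto
      then show ?thesis using is_treeD(4)[OF tree] q(1) by (metis inj_onD insertI1)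
    next
      case 2
      then have "B = hd ys" using path_edge_ends[of "xs @ [N]" ys q N B] P q(1) B(1) Nq by auto
      moreover have "ys \<noteq> []" using 2 by auto
      ultimately have "f' \<in> edges T" "ends T q = ends T f'" using f'(4) ends by auto
      then show ?thesis using is_treeD(4)[OF tree] q(1) by (metis inj_onD insertCI)
    qed
  qed
  then have "edges T \<inter> ground N \<subseteq> {e', f'}" by auto
  then show ?thesis using e' f'(1,4) by (intro exI[of _ e'] exI[of _ f']) auto
qed

end

section \<open>Spikes\<close>

text \<open>Adding the fundamental cycle of an element outside \<open>C\<close> removes that element
  from \<open>Z\<close>; repetition reduces \<open>Z\<close> to a cycle inside
  \<open>C\<close>.\<close>

lemma cycle_space_subset:
  assumes K: "cycle_space E K" and K': "cycle_space E K'"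
    and base: "\<And>Z. Z \<subseteq> C \<Longrightarrow> Z \<in> K \<Longrightarrow> Z \<in> K'"
    and fund: "\<And>x. x \<in> E \<Longrightarrow> x \<notin> C \<Longrightarrow> \<exists>Y \<in> K \<inter> K'. x \<in> Y \<and> Y \<subseteq> insert x C"
  shows "Z \<in> K \<Longrightarrow> Z \<in> K'"
proof (induction "card (Z - C)" arbitrary: Z rule: less_induct)
  case less
  show ?case
  proof (cases "Z \<subseteq> C")
    case True
    then show ?thesis using base less(2) by simp
  next
    case False
    then obtain x where x: "x \<in> Z" "x \<notin> C" by auto
    then obtain Y where Y: "Y \<in> K" "Y \<in> K'" "x \<in> Y" "Y \<subseteq> insert x C"
      using fund[of x] cycle_spaceD(3)[OF K less(2)] by auto
    have "sym_diff Z Y - C = (Z - C) - {x}" using x Y(3,4) by auto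
    then have "card (sym_diff Z Y - C) < card (Z - C)"
      using x cycle_spaceD(4)[OF K less(2)] by (metis DiffI card_Diff1_less finite_Diff)
    then have "sym_diff Z Y \<in> K'" using less(1) cycle_spaceD(5)[OF K less(2) Y(1)] by simp
    then have "sym_diff (sym_diff Z Y) Y \<in> K'" using cycle_spaceD(5)[OF K' _ Y(2)] by simp
    moreover have "sym_diff (sym_diff Z Y) Y = Z" by auto
    ultimately show ?thesis by simp
  qed
qed

text \<open>Sets pairwise related by one exchange form a clique of a Johnson graph, and such a
  clique is a star or a co-star: a member \<open>A w\<close> reaching outside
  \<open>A x \<union> A y\<close> has all its other elements in \<open>A x \<inter> A y\<close>, and
  then no member can miss an element of that intersection.\<close>

lemma near_family:
  assumes near: "\<And>x y. x \<in> X \<Longrightarrow> y \<in> X \<Longrightarrow> x \<noteq> y \<Longrightarrow> card (A x - A y) = 1"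
    and xy: "x \<in> X" "y \<in> X" "x \<noteq> y"
  shows "(\<forall>z \<in> X. A x \<inter> A y \<subseteq> A z) \<or> (\<forall>z \<in> X. A z \<subseteq> A x \<union> A y)"
proof (rule disjCI, rule ballI)
  fix z assume z: "z \<in> X"
  assume "\<not> (\<forall>z \<in> X. A z \<subseteq> A x \<union> A y)"
  then obtain w g where w: "w \<in> X" "g \<in> A w" "g \<notin> A x" "g \<notin> A y" by auto
  have one: "u = v" if ab: "a \<in> X" "b \<in> X" "u \<in> A a - A b" "v \<in> A a - A b" for a b u v
  proof -
    have "a \<noteq> b" using ab(3) by auto
    then obtain s where "A a - A b = {s}" using near[OF ab(1,2)] by (metis card_1_singletonE)
    then show ?thesis using ab(3,4) by (metis singletonD)
  qed
  have wx: "A w - {g} \<subseteq> A x \<inter> A y"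
  proof
    fix v assume v: "v \<in> A w - {g}"
    show "v \<in> A x \<inter> A y"
      using one[OF w(1) xy(1), of v g] one[OF w(1) xy(2), of v g] w v by auto
  qed
  show "A x \<inter> A y \<subseteq> A z"
  proof (rule ccontr)
    assume "\<not> A x \<inter> A y \<subseteq> A z"
    then obtain i where i: "i \<in> A x" "i \<in> A y" "i \<notin> A z" by auto
    obtain a where a: "a \<in> A x" "a \<notin> A y"
      using near[OF xy] by (metis DiffD1 DiffD2 card_1_singletonE insertI1)
    obtain b where b: "b \<in> A y" "b \<notin> A x"
      using near[OF xy(2,1)] xy(3) by (metis DiffD1 DiffD2 card_1_singletonE insertI1)
    \<comment> \<open>\<open>A x\<close> and \<open>A y\<close> lose only \<open>i\<close> against
      \<open>A z\<close>, so \<open>A z\<close> keeps both \<open>a\<close> and \<open>b\<close>.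
      Neither is in \<open>A w\<close>, which would put two elements into
      \<open>A z - A w\<close>.\<close>
    have "a \<in> A z" using one[OF xy(1) z, of a i] a i by auto
    have "b \<in> A z" using one[OF xy(2) z, of b i] b i by auto
    have "a \<notin> A w" "b \<notin> A w" using wx a b w by auto
    then have "a = b"
      using one[OF z w(1), of a b] \<open>a \<in> A z\<close> \<open>b \<in> A z\<close> by auto
    then show False using a b by auto
  qed
qed

lemma unit_sum:
  assumes "finite Z" "inj_on \<iota> Z"
  shows "sum (\<lambda>c. unit_vector (\<iota> c)) Z j = (if j \<in> \<iota> ` Z then 1 else 0)"
  using assms
proof (induction Z rule: finite_induct)
  case (insert x Z)
  then show ?case by (auto simp: unit_vector_def plus_fun_def)
qed (simp add: zero_fun_def)

context gf2_matroid
begin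

text \<open>Zero-sum subsets determine independence over GF(2), just as cycles do in
  \<open>M\<close>, so it suffices to match these two along \<open>h\<close>.\<close>

lemma isomorphic_vectorsI:
  fixes h :: "'a \<Rightarrow> spike_element" and r :: nat
  defines "N \<equiv> delete (binary_spike r) {SY r}"
  assumes bij: "bij_betw h (ground M) (ground N)"
    and cyc: "\<And>Z. Z \<subseteq> ground M \<Longrightarrow> Z \<in> cycles M \<longleftrightarrow> sum (spike_vector r \<circ> h) Z = 0"
  shows "isomorphic M N"
  unfolding isomorphic_def
proof (intro exI conjI allI impI)
  fix I assume I: "I \<subseteq> ground M"
  have finI: "finite I" using I finite_ground finite_subset by blast
  have hI: "h ` I \<subseteq> ground N" using bij I by (auto simp: bij_betw_def)
  have inj: "inj_on h I" using bij I by (auto simp: bij_betw_def intro: inj_on_subset)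
  have sums: "sum (spike_vector r) (h ` Z) = sum (spike_vector r \<circ> h) Z" if "Z \<subseteq> I" for Z
    using sum.reindex[OF inj_on_subset[OF inj that]] .
  have gN: "ground N = ground (binary_spike r) - {SY r}" by (simp add: N_def delete_def)
  then have "h ` I \<in> indeps N \<longleftrightarrow> h ` I \<in> indeps (binary_spike r)"
    using hI by (auto simp: N_def delete_def)
  also have "\<dots> \<longleftrightarrow> (\<forall>Y. Y \<subseteq> h ` I \<longrightarrow> sum (spike_vector r) Y = 0 \<longrightarrow> Y = {})"
  proof -
    have eq: "binary_spike r = vector_matroid (ground (binary_spike r)) (spike_vector r)"
      by (simp add: binary_spike_def vector_matroid_def)
    have "h ` I \<subseteq> ground (binary_spike r)" using hI gN by auto
    then show ?thesis
      using vector_matroid_indep[OF finite_imageI[OF finI], of h "ground (binary_spike r)" "spike_vector r"]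
      unfolding eq[symmetric] by simp
  qed
  also have "\<dots> \<longleftrightarrow> (\<forall>Z. Z \<subseteq> I \<longrightarrow> sum (spike_vector r) (h ` Z) = 0 \<longrightarrow> Z = {})"
    by (auto simp: all_subset_image)
  also have "\<dots> \<longleftrightarrow> (\<forall>Z. Z \<subseteq> I \<longrightarrow> Z \<in> cycles M \<longrightarrow> Z = {})"
  proof -
    have "sum (spike_vector r) (h ` Z) = 0 \<longleftrightarrow> Z \<in> cycles M" if "Z \<subseteq> I" for Z
      using sums[OF that] cyc[of Z] that I by simp
    then show ?thesis by blast
  qed
  also have "\<dots> \<longleftrightarrow> I \<in> indeps M" using indep_iff[of I] I by blast
  finally show "I \<in> indeps M \<longleftrightarrow> h ` I \<in> indeps N" by simp
qed (rule bij)

text \<open>\<open>p\<close> becomes the tip, \<open>C - {p}\<close> the standard basis, and each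
  chord the \<open>y\<close> paired with its \<open>\<delta>\<close>. Both cycle spaces are
  generated by \<open>C\<close> and the triangles \<open>{x, p, \<delta> x}\<close>, hence
  agree.\<close>

lemma spike_isomorphic:
  assumes C: "min_cycle (cycles M) C" and pq: "p \<in> C" "q \<in> C" "p \<noteq> q"
    and \<delta>: "bij_betw \<delta> (ground M - C) (C - {p, q})"
    and triangle: "\<And>x. x \<in> ground M - C \<Longrightarrow> {x, p, \<delta> x} \<in> cycles M"
    and big: "4 \<le> card C"
  shows "\<exists>r \<ge> 3. isomorphic M (delete (binary_spike r) {SY r})"
proof -
  \<comment> \<open>\<open>C\<close> is to become the tip together with
    \<open>x_1, ..., x_r\<close>.\<close>
  define r where "r = card C - 1"
  have CE: "C \<subseteq> ground M" using min_cycle_subset[OF space C] .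
  have finC: "finite C" using CE finite_ground finite_subset by blast
  have "card (C - {p, q}) = r - 1" using pq finC by (simp add: r_def card_Diff_subset)
  then obtain g where g: "bij_betw g (C - {p, q}) {1..r - 1}"
    using finite_same_card_bij[of "C - {p, q}" "{1..r - 1}"] finC by auto
  \<comment> \<open>\<open>\<delta>\<close> never takes the value \<open>q\<close>, so
    \<open>q\<close> receives the index \<open>r\<close> whose \<open>y_r\<close> is
    deleted.\<close>
  define \<iota> where "\<iota> = g(q := r)"
  have r3: "3 \<le> r" using big by (simp add: r_def)
  have gi: "bij_betw \<iota> (C - {p, q}) {1..r - 1}"
    using g by (rule bij_betw_cong[THEN iffD1, rotated]) (auto simp: \<iota>_def)
  moreover have "\<iota> q = r" by (simp add: \<iota>_def)
  moreover have "C - {p} = insert q (C - {p, q})" using pq by auto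
  moreover have "{1..r} = insert r {1..r - 1}" using r3 by auto
  ultimately have \<iota>: "bij_betw \<iota> (C - {p}) {1..r}"
    using notIn_Un_bij_betw[of q "C - {p, q}" \<iota> "{1..r - 1}"] r3 by auto
  define h where "h c = (if c = p then Tip else if c \<in> C then SX (\<iota> c) else SY (\<iota> (\<delta> c)))" for c
  have \<iota>\<delta>: "bij_betw (\<iota> \<circ> \<delta>) (ground M - C) {1..r - 1}" using bij_betw_trans[OF \<delta> gi] .
  have hC: "h ` (C - {p}) = SX ` {1..r}"
    using \<iota> unfolding bij_betw_def h_def by (auto simp: image_iff)
  have hX: "h ` (ground M - C) = SY ` {1..r - 1}"
    using \<iota>\<delta> pq(1) unfolding bij_betw_def h_def by (auto simp: image_iff)
  let ?N = "delete (binary_spike r) {SY r}"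
  have gN: "ground ?N = SX ` {1..r} \<union> SY ` {1..r - 1} \<union> {Tip}"
  proof -
    have "SY ` {1..r} - {SY r} = SY ` ({1..r} - {r})" by auto
    also have "{1..r} - {r} = {1..r - 1}" by auto
    finally have "SY ` {1..r} - {SY r} = SY ` {1..r - 1}" .
    then show ?thesis by (auto simp: delete_def binary_spike_def vector_matroid_def)
  qed
  have gM: "ground M = (C - {p}) \<union> (ground M - C) \<union> {p}" using CE pq by auto
  have "h ` ground M = ground ?N"
    unfolding gN by (subst gM) (simp only: image_Un hC hX image_insert image_empty, simp add: h_def)
  moreover have "inj_on h (ground M)"
  proof (rule inj_onI)
    fix x y assume xy: "x \<in> ground M" "y \<in> ground M" "h x = h y"
    have 1: "inj_on \<iota> (C - {p})" "inj_on (\<iota> \<circ> \<delta>) (ground M - C)"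
      using \<iota> \<iota>\<delta> by (auto simp: bij_betw_def)
    show "x = y"
      using xy inj_onD[OF 1(1), of x y] inj_onD[OF 1(2), of x y] pq(1)
      by (auto simp: h_def split: if_splits)
  qed
  ultimately have bij: "bij_betw h (ground M) (ground ?N)" by (simp add: bij_betw_def)
  define \<psi> where "\<psi> = spike_vector r \<circ> h"
  define K' where "K' = {Z. Z \<subseteq> ground M \<and> sum \<psi> Z = 0}"
  have fin: "finite Z" if "Z \<subseteq> ground M" for Z using that finite_ground finite_subset by blast
  have cs': "cycle_space (ground M) K'"
    unfolding cycle_space_def
  proof (intro conjI ballI)
    fix A B assume "A \<in> K'" "B \<in> K'"
    then have AB: "A \<subseteq> ground M" "B \<subseteq> ground M" "sum \<psi> A = 0" "sum \<psi> B = 0" by (auto simp: K'_def)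
    then have "sum \<psi> (sym_diff A B) = 0" using sum_sym_diff[OF fin fin, of A B \<psi>] by simp
    then show "sym_diff A B \<in> K'" using AB(1,2) by (auto simp: K'_def)
  qed (use finite_ground in \<open>auto simp: K'_def\<close>)
  \<comment> \<open>The basis vectors add up to the all-ones tip, and this is the only dependency
    among these vectors.\<close>
  have on_C: "sum \<psi> Z = 0 \<longleftrightarrow> Z = {} \<or> Z = C" if Z: "Z \<subseteq> C" for Z
  proof -
    have finZ: "finite Z" using Z finC finite_subset by blast
    have inj: "inj_on \<iota> (Z - {p})" using \<iota> Z by (auto simp: bij_betw_def intro: inj_on_subset)
    have "sum \<psi> (Z - {p}) = sum (\<lambda>c. unit_vector (\<iota> c)) (Z - {p})"
      by (rule sum.cong) (use Z in \<open>auto simp: \<psi>_def h_def\<close>)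
    then have s1: "sum \<psi> (Z - {p}) j = (if j \<in> \<iota> ` (Z - {p}) then 1 else 0)" for j
      using unit_sum[OF _ inj] finZ by simp
    have "sum \<psi> Z = (if p \<in> Z then \<psi> p else 0) + sum \<psi> (Z - {p})"
      using sum.remove[OF finZ, of p \<psi>] by simp
    then have val: "sum \<psi> Z j = (if p \<in> Z \<and> j \<in> {1..r} then 1 else 0) +
        (if j \<in> \<iota> ` (Z - {p}) then 1 else 0)" for j
      using s1[of j] by (simp add: \<psi>_def h_def ones_vector_def)
    have img: "\<iota> ` (C - {p}) = {1..r}" using \<iota> by (simp add: bij_betw_def)
    have "sum \<psi> Z = 0 \<longleftrightarrow> (\<forall>j. (p \<in> Z \<and> j \<in> {1..r}) = (j \<in> \<iota> ` (Z - {p})))"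
      unfolding fun_eq_iff val by auto
    also have "\<dots> \<longleftrightarrow> \<iota> ` (Z - {p}) = (if p \<in> Z then \<iota> ` (C - {p}) else {})"
      unfolding img by auto
    also have "\<dots> \<longleftrightarrow> Z - {p} = (if p \<in> Z then C - {p} else {})"
      using \<iota> Z inj_on_image_eq_iff[of \<iota> "C - {p}" "Z - {p}" "C - {p}"] by (auto simp: bij_betw_def)
    also have "\<dots> \<longleftrightarrow> Z = {} \<or> Z = C" using pq(1) Z by auto
    finally show ?thesis .
  qed
  have same: "Z \<in> cycles M \<longleftrightarrow> Z \<in> K'" if "Z \<subseteq> C" for Z
    using on_C[OF that] that CE min_cycleD(1,3)[OF C] cycles.empty by (auto simp: K'_def)
  have fund: "{x, p, \<delta> x} \<in> K' \<and> x \<in> {x, p, \<delta> x} \<and> {x, p, \<delta> x} \<subseteq> insert x C"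
    if x: "x \<in> ground M" "x \<notin> C" for x
  proof -
    have d: "\<delta> x \<in> C" "\<delta> x \<noteq> p" using \<delta> x by (auto simp: bij_betw_def)
    have "\<psi> x + (\<psi> p + \<psi> (\<delta> x)) = 0"
      using d x pq(1) by (auto simp: \<psi>_def h_def fun_eq_iff)
    moreover have "x \<noteq> p" "x \<noteq> \<delta> x" using x pq(1) d by auto
    ultimately have "sum \<psi> {x, p, \<delta> x} = 0" using d(2) by simp
    then show ?thesis using x CE pq(1) d by (auto simp: K'_def)
  qed
  have triangle': "\<exists>Y \<in> cycles M \<inter> K'. x \<in> Y \<and> Y \<subseteq> insert x C"
    "\<exists>Y \<in> K' \<inter> cycles M. x \<in> Y \<and> Y \<subseteq> insert x C"
    if x: "x \<in> ground M" "x \<notin> C" for x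
  proof -
    have "{x, p, \<delta> x} \<in> cycles M" using triangle[of x] x by simp
    then show "\<exists>Y \<in> cycles M \<inter> K'. x \<in> Y \<and> Y \<subseteq> insert x C"
      "\<exists>Y \<in> K' \<inter> cycles M. x \<in> Y \<and> Y \<subseteq> insert x C"
      using fund[OF x] by (intro bexI[of _ "{x, p, \<delta> x}"]; simp)+
  qed
  have "Z \<in> cycles M \<longleftrightarrow> sum \<psi> Z = 0" if Z: "Z \<subseteq> ground M" for Z
  proof -
    have "Z \<in> cycles M \<Longrightarrow> Z \<in> K'"
      by (rule cycle_space_subset[OF space cs', of C]) (use same triangle' in auto)
    moreover have "Z \<in> K' \<Longrightarrow> Z \<in> cycles M"
      by (rule cycle_space_subset[OF cs' space, of C]) (use same triangle' in auto)
    ultimately show ?thesis using Z by (auto simp: K'_def)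
  qed
  then have "isomorphic M ?N" using isomorphic_vectorsI[OF bij] by (simp add: \<psi>_def)
  then show ?thesis using r3 by auto
qed

end

section \<open>3-connected labels\<close>

lemma card_eq_if_diff_eq:
  assumes "finite A" "finite B" "card (A - B) = card (B - A)"
  shows "card A = card B"
  using card_Int_Diff[OF assms(1), of B] card_Int_Diff[OF assms(2), of A] assms(3)
  by (simp add: Int_commute)

context matroid
begin

lemma rank_of_le_card: "finite X \<Longrightarrow> rank_of M X \<le> card X"
  using rank_of_attained(1)[of X] card_mono by metis

lemma rank_of_mono: "X \<subseteq> Y \<Longrightarrow> rank_of M X \<le> rank_of M Y"
  using rank_of_attained by (metis order_trans)

lemma finite_indep: "I \<in> indeps M \<Longrightarrow> finite I"
  using indeps_subset_ground finite_ground finite_subset by blast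

end

context gf2_matroid
begin

lemma rank_of_le_spanned:
  assumes I: "I \<in> indeps M" "I \<subseteq> X"
    and span: "\<And>x. x \<in> X \<Longrightarrow> x \<notin> I \<Longrightarrow> \<exists>Z \<in> cycles M. x \<in> Z \<and> Z \<subseteq> insert x I"
  shows "rank_of M X \<le> card I"
proof (rule ccontr)
  assume "\<not> rank_of M X \<le> card I"
  moreover obtain J where J: "J \<in> indeps M" "J \<subseteq> X" "card J = rank_of M X"
    using rank_of_attained(1)[of X] by auto
  ultimately obtain x where x: "x \<in> J - I" "insert x I \<in> indeps M"
    using augment[OF I(1) J(1)] by auto
  then obtain Z where Z: "Z \<in> cycles M" "x \<in> Z" "Z \<subseteq> insert x I" using span[of x] J(2) by auto
  then show False using x(2) indep_iff by auto
qed

lemma psubset_min_cycle_indep: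
  assumes "min_cycle (cycles M) C" "I \<subset> C"
  shows "I \<in> indeps M"
  using assms unfolding min_cycle_iff by (simp add: circuit_def)

end

locale three_connected = gf2_matroid +
  assumes conn: "connected_matroid M" and conn3: "n_connected 3 M" and big: "4 \<le> card (ground M)"
begin

lemma space_connected: "connected_space {} (ground M) (cycles M)"
  using connected_space_cycles[OF conn] big by simp

lemma no_loop: "{x} \<notin> cycles M"
  using connected_spaceD(1)[OF space_connected] .

lemma no_two_separation:
  assumes "X \<union> Y = ground M" "X \<inter> Y = {}" "2 \<le> card X" "2 \<le> card Y"
  shows "rank_of M (ground M) + 2 \<le> rank_of M X + rank_of M Y"
proof (rule ccontr)
  assume "\<not> rank_of M (ground M) + 2 \<le> rank_of M X + rank_of M Y"
  then have "k_separation M 2 X Y" using assms by (simp add: k_separation_def)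
  moreover have "\<not> k_separation M 2 X Y" using conn3 by (simp add: n_connected_def)
  ultimately show False by simp
qed

text \<open>A parallel pair has rank one, so splitting it off would be a 2-separation, at least two
  elements being left over.\<close>

lemma no_parallel:
  assumes "x \<noteq> y"
  shows "{x, y} \<notin> cycles M"
proof
  assume xy: "{x, y} \<in> cycles M"
  then have E: "{x, y} \<subseteq> ground M" using cycles_subset_ground by blast
  have x: "{x} \<in> indeps M"
    using indep_iff[of "{x}"] no_loop[of x] E by (auto simp: subset_singleton_iff)
  have 1: "rank_of M {x, y} \<le> card {x}"
  proof (rule rank_of_le_spanned[OF x])
    fix z assume "z \<in> {x, y}" "z \<notin> {x}"
    then have "z = y" by simp
    then show "\<exists>Z \<in> cycles M. z \<in> Z \<and> Z \<subseteq> insert z {x}"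
      using xy by (intro bexI[of _ "{x, y}"]) auto
  qed simp
  have 2: "rank_of M (ground M - {x, y}) \<le> rank_of M (ground M)"
    by (rule rank_of_mono) auto
  have "rank_of M (ground M) + 2 \<le> rank_of M {x, y} + rank_of M (ground M - {x, y})"
  proof (rule no_two_separation)
    show "{x, y} \<union> (ground M - {x, y}) = ground M" using E by auto
    show "2 \<le> card (ground M - {x, y})"
      using card_Diff_subset[of "{x, y}" "ground M"] E assms big by simp
  qed (use assms in auto)
  then show False using 1 2 by simp
qed

text \<open>Sharing a circuit that avoids \<open>p\<close> is an equivalence relation on the remaining elements. A
  nontrivial class together with the rest would give a separation of \<open>M\<close> with \<open>p\<close> deleted,
  hence a 2-separation of \<open>M\<close>.\<close>

lemma deletion_connected:
  assumes p: "p \<in> ground M"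
  shows "connected_space {p} (ground M) (cycles M)"
proof -
  define R where "R x y \<longleftrightarrow> (\<exists>C. min_cycle (cycles M) C \<and> x \<in> C \<and> y \<in> C \<and> p \<notin> C)" for x y
  have R_trans: "R x z" if xy: "R x y" "R y z" for x y z
  proof -
    obtain C1 where C1: "min_cycle (cycles M) C1" "x \<in> C1" "y \<in> C1" "p \<notin> C1"
      using xy(1) by (auto simp: R_def)
    obtain C2 where C2: "min_cycle (cycles M) C2" "y \<in> C2" "z \<in> C2" "p \<notin> C2"
      using xy(2) by (auto simp: R_def)
    have "C1 \<inter> C2 \<noteq> {}" using C1(3) C2(2) by auto
    then obtain C where "min_cycle (cycles M) C" "x \<in> C" "z \<in> C" "C \<subseteq> C1 \<union> C2"
      using min_cycle_trans[OF space C1(1,2) C2(1,3)] by auto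
    then show ?thesis using C1(4) C2(4) by (auto simp: R_def)
  qed
  have main: "R x y" if xy: "x \<in> ground M - {p}" "y \<in> ground M - {p}" "x \<noteq> y" for x y
  proof (rule ccontr)
    assume no: "\<not> R x y"
    define X where "X = insert x {z. R x z}"
    define Y where "Y = ground M - {p} - X"
    have XE: "X \<subseteq> ground M - {p}"
      using xy(1) min_cycle_subset[OF space] by (auto simp: X_def R_def)
    have yY: "y \<in> Y" using xy no by (auto simp: X_def Y_def)
    \<comment> \<open>By transitivity, a circuit avoiding \<open>p\<close> that meets the class of
      \<open>x\<close> stays inside it.\<close>
    have closed: "C \<subseteq> X \<or> C \<subseteq> Y" if C: "min_cycle (cycles M) C" "p \<notin> C" for C
    proof (cases "C \<inter> X = {}")
      case True
      then show ?thesis using C min_cycle_subset[OF space C(1)] by (auto simp: Y_def)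
    next
      case False
      then obtain u where u: "u \<in> C" "u \<in> X" by auto
      have "R x v" if "v \<in> C" for v
      proof -
        have "R u v" using C u(1) that by (auto simp: R_def)
        then show ?thesis using u(2) R_trans by (auto simp: X_def)
      qed
      then show ?thesis by (auto simp: X_def)
    qed
    obtain I where I: "I \<in> indeps M" "I \<subseteq> X" "card I = rank_of M X"
      using rank_of_attained(1)[of X] by auto
    obtain J where J: "J \<in> indeps M" "J \<subseteq> Y" "card J = rank_of M Y"
      using rank_of_attained(1)[of Y] by auto
    have pIJ: "p \<notin> I \<union> J" using I(2) J(2) XE by (auto simp: Y_def)
    have dis: "X \<inter> Y = {}" by (auto simp: Y_def)
    have "I \<union> J \<in> indeps M"
    proof (rule ccontr)
      assume "I \<union> J \<notin> indeps M"
      moreover have "I \<union> J \<subseteq> ground M" using I(1) J(1) indeps_subset_ground by auto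
      ultimately obtain C where C: "circuit M C" "C \<subseteq> I \<union> J"
        using dependent_contains_circuit by metis
      then have "C \<subseteq> X \<or> C \<subseteq> Y" using closed[of C] pIJ by (auto simp: min_cycle_iff)
      then have "C \<subseteq> I \<or> C \<subseteq> J" using C(2) I(2) J(2) dis by blast
      then have "C \<in> indeps M" using indep_subset I(1) J(1) by auto
      then show False using C(1) by (simp add: circuit_def)
    qed
    then have "card (I \<union> J) \<le> rank_of M (ground M)"
      using rank_of_attained(2) indeps_subset_ground by metis
    moreover have "I \<inter> J = {}" using I(2) J(2) dis by auto
    ultimately have rXY: "rank_of M X + rank_of M Y \<le> rank_of M (ground M)"
      using card_Un_disjoint[OF finite_indep[OF I(1)] finite_indep[OF J(1)]] I(3) J(3) by simp
    have rp: "rank_of M (insert p W) \<le> Suc (rank_of M W)" for W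
    proof -
      obtain L where L: "L \<in> indeps M" "L \<subseteq> insert p W" "card L = rank_of M (insert p W)"
        using rank_of_attained(1)[of "insert p W"] by auto
      have "card (L - {p}) \<le> rank_of M W"
        by (rule rank_of_attained(2)) (use indep_subset[OF L(1)] L(2) in auto)
      then show ?thesis using L(3) card_Diff1_le[of L p] finite_indep[OF L(1)]
        by (cases "p \<in> L") (auto simp: card_Diff_singleton_if split: if_splits)
    qed
    have finX: "finite X" "finite Y" using XE finite_ground finite_subset by (auto simp: Y_def)
    have E: "ground M = insert p (X \<union> Y)" using p XE by (auto simp: Y_def)
    have pX: "p \<notin> X" "p \<notin> Y" using XE by (auto simp: Y_def)
    have cX: "1 \<le> card X" "1 \<le> card Y"
      using finX yY by (auto simp: X_def card_gt_0_iff Suc_le_eq)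
    have "card (ground M) = Suc (card X + card Y)"
      unfolding E using finX pX dis by (simp add: card_Un_disjoint)
    \<comment> \<open>A side with two elements is kept and \<open>p\<close> is added to the other,
      at a cost of at most one in rank; the rank sum is then at most one above that of
      \<open>M\<close>.\<close>
    then consider "2 \<le> card X" | "2 \<le> card Y" using big by linarith
    then show False
    proof cases
      case 1
      have "2 \<le> card (insert p Y)" using cX(2) finX pX by simp
      then have "rank_of M (ground M) + 2 \<le> rank_of M X + rank_of M (insert p Y)"
        using no_two_separation[of X "insert p Y"] 1 E dis pX by auto
      then show False using rp[of Y] rXY by linarith
    next
      case 2
      have "2 \<le> card (insert p X)" using cX(1) finX pX by simp
      then have "rank_of M (ground M) + 2 \<le> rank_of M (insert p X) + rank_of M Y"
        using no_two_separation[of "insert p X" Y] 2 E dis pX by auto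
      then show False using rp[of X] rXY by linarith
    qed
  qed
  have both: "R x y" if xy: "x \<in> ground M - {p}" "y \<in> ground M - {p}" for x y
  proof (cases "x = y")
    case False
    then show ?thesis using main[OF xy] by simp
  next
    case True
    have "\<not> ground M \<subseteq> {p, x}"
      using card_mono[of "{p, x}" "ground M"] big by (auto simp: card_insert_if split: if_splits)
    then obtain z where "z \<in> ground M - {p}" "z \<noteq> x" by auto
    then have "R x z" using main[OF xy(1)] by auto
    then show ?thesis using True by (auto simp: R_def)
  qed
  show ?thesis
    unfolding connected_space_def
  proof (intro conjI allI ballI no_loop)
    fix x y assume "x \<in> ground M - {p}" "y \<in> ground M - {p}"
    then show "\<exists>C. min_cycle (cycles M) C \<and> x \<in> C \<and> y \<in> C \<and> C \<inter> {p} = {}"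
      using both[of x y] by (auto simp: R_def)
  qed
qed

end

text \<open>Every element \<open>x\<close> outside \<open>C\<close> is a chord that splits \<open>C\<close> into a part containing \<open>p\<close> and a
  part containing \<open>q\<close>; the former is \<open>side x\<close>.\<close>

locale chorded_circuit = three_connected +
  fixes p q :: 'a and C :: "'a set"
  assumes span: "pair_spanning (ground M) (cycles M) p q"
    and C: "min_cycle (cycles M) C" and pq: "p \<in> C" "q \<in> C" "p \<noteq> q"
begin

abbreviation "chords \<equiv> ground M - C"

definition side :: "'a \<Rightarrow> 'a set" where
  "side x = (SOME A. p \<in> A \<and> q \<notin> A \<and> A \<subseteq> C \<and> insert x A \<in> cycles M)"

lemma C_sub: "C \<subseteq> ground M" and fin_C: "finite C"
  using min_cycle_subset[OF space C] finite_ground finite_subset by auto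

lemma C_cycle: "C \<in> cycles M"
  using min_cycleD(1)[OF C] .

text \<open>If one of the two cycles of the chord contained both \<open>p\<close> and
  \<open>q\<close>, \<open>chord_separates\<close> would make \<open>x\<close> parallel to an
  element of \<open>C\<close>; hence \<open>p\<close> and \<open>q\<close> lie in different
  ones.\<close>

lemma ex_side:
  assumes x: "x \<in> chords"
  shows "\<exists>A. p \<in> A \<and> q \<notin> A \<and> A \<subseteq> C \<and> insert x A \<in> cycles M"
proof -
  have x': "x \<in> ground M" "x \<notin> C" using x by auto
  obtain Z where Z: "Z \<in> cycles M" "x \<in> Z" "Z \<subseteq> insert x C"
    using pair_spanningD[OF span C pq(1,2) x'] by auto
  have not_both: "\<not> (p \<in> Y \<and> q \<in> Y)" if Y: "Y \<in> cycles M" "x \<in> Y" "Y \<subseteq> insert x C" for Y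
  proof
    assume pqY: "p \<in> Y \<and> q \<in> Y"
    then obtain b where b: "C - Y = {b}"
      using chord_separates[OF space span C x'(2) no_loop Y] by auto
    have "insert x (C - Y) \<in> cycles M" using chord_split(2)[OF space C x'(2) no_loop Y] .
    then have "{x, b} \<in> cycles M" using b by simp
    moreover have "x \<noteq> b" using b x'(2) by auto
    ultimately show False using no_parallel by simp
  qed
  have Z': "insert x (C - Z) \<in> cycles M" using chord_split(2)[OF space C x'(2) no_loop Z] .
  have "p \<in> Z \<longleftrightarrow> q \<notin> Z"
    using not_both[OF Z] not_both[OF Z'] pq(1,2) by auto
  then show ?thesis
  proof (cases "p \<in> Z")
    case True
    then have "q \<notin> Z - {x}" "p \<in> Z - {x}" "Z - {x} \<subseteq> C" "insert x (Z - {x}) = Z"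
      using \<open>p \<in> Z \<longleftrightarrow> q \<notin> Z\<close> Z(2,3) x'(2) pq(1) by auto
    then show ?thesis using Z(1) by (intro exI[of _ "Z - {x}"]) simp
  next
    case False
    then show ?thesis using \<open>p \<in> Z \<longleftrightarrow> q \<notin> Z\<close> Z' pq(1) by (intro exI[of _ "C - Z"]) simp
  qed
qed

lemma side:
  assumes "x \<in> chords"
  shows "p \<in> side x" "q \<notin> side x" "side x \<subseteq> C" "insert x (side x) \<in> cycles M" "finite (side x)"
    "insert x (C - side x) \<in> cycles M"
proof -
  show s: "p \<in> side x" "q \<notin> side x" "side x \<subseteq> C" "insert x (side x) \<in> cycles M"
    using someI_ex[OF ex_side[OF assms]] unfolding side_def by auto
  show "finite (side x)" using s(3) fin_C finite_subset by blast
  have "sym_diff C (insert x (side x)) = insert x (C - side x)" using assms s(3) by auto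
  then show "insert x (C - side x) \<in> cycles M" using cycles_sym_diff[OF s(4) C_cycle] by simp
qed

lemma side_inj:
  assumes "x \<in> chords" "y \<in> chords" "x \<noteq> y"
  shows "side x \<noteq> side y"
proof
  assume eq: "side x = side y"
  have "sym_diff (insert x (side x)) (insert y (side y)) = {x, y}"
    using assms side(3)[OF assms(1)] unfolding eq by auto
  then have "{x, y} \<in> cycles M"
    using cycles_sym_diff[OF side(4)[OF assms(2)] side(4)[OF assms(1)]] by simp
  then show False using no_parallel[OF assms(3)] by simp
qed

text \<open>Removing \<open>p\<close> from a circuit through \<open>p\<close> and \<open>q\<close>
  leaves a basis, so all such circuits have equal size. This is how a circuit rerouted along chords
  is compared with \<open>C\<close>.\<close>

lemma spanning_card:
  assumes D: "min_cycle (cycles M) D" "p \<in> D" "q \<in> D"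
  shows "card D = Suc (rank_of M (ground M))"
proof -
  have I: "D - {p} \<in> indeps M" using psubset_min_cycle_indep[OF D(1)] D(2) by auto
  have DE: "D \<subseteq> ground M" using min_cycle_subset[OF space D(1)] .
  have "rank_of M (ground M) \<le> card (D - {p})"
  proof (rule rank_of_le_spanned[OF I])
    fix x assume x: "x \<in> ground M" "x \<notin> D - {p}"
    show "\<exists>Z \<in> cycles M. x \<in> Z \<and> Z \<subseteq> insert x (D - {p})"
    proof (cases "x = p")
      case True
      then show ?thesis using D min_cycleD(1)[OF D(1)] by (intro bexI[of _ D]) auto
    next
      case False
      then have xD: "x \<notin> D" using x(2) by simp
      then obtain Z where Z: "Z \<in> cycles M" "x \<in> Z" "Z \<subseteq> insert x D"
        using pair_spanningD[OF span D x(1)] by auto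
      show ?thesis
      proof (cases "p \<in> Z")
        case True
        have "sym_diff Z D \<in> cycles M" using cycles_sym_diff[OF min_cycleD(1)[OF D(1)] Z(1)] .
        moreover have "x \<in> sym_diff Z D" "sym_diff Z D \<subseteq> insert x (D - {p})"
          using Z(2,3) xD True D(2) by auto
        ultimately show ?thesis by (intro bexI[of _ "sym_diff Z D"] conjI)
      next
        case False
        then have "Z \<subseteq> insert x (D - {p})" using Z(3) by auto
        then show ?thesis using Z(1,2) by (intro bexI[of _ Z] conjI)
      qed
    qed
  qed (use DE in auto)
  moreover have "card (D - {p}) \<le> rank_of M (ground M)"
    using rank_of_attained(2)[OF I] DE by auto
  moreover have "finite D" using DE finite_ground finite_subset by blast
  then have "card D = Suc (card (D - {p}))" using card_Suc_Diff1[of D p] D(2) by simp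
  ultimately show ?thesis by simp
qed

lemma cycle_with_chord:
  assumes x: "x \<in> chords" and D: "D \<in> cycles M" "x \<in> D" "D \<subseteq> insert x C"
  shows "D = insert x (side x) \<or> D = insert x (C - side x)"
proof -
  have xC: "x \<notin> C" using x by simp
  let ?S = "sym_diff D (insert x (side x))"
  have "?S \<in> cycles M" using cycles_sym_diff[OF side(4)[OF x] D(1)] .
  moreover have sub: "?S \<subseteq> C" using D(2,3) side(3)[OF x] by auto
  ultimately have "?S = {} \<or> ?S = C" using min_cycleD(3)[OF C] by auto
  then show ?thesis
  proof
    assume "?S = {}"
    then show ?thesis by auto
  next
    assume S: "?S = C"
    have "D = sym_diff ?S (insert x (side x))" by auto
    then have "D = sym_diff C (insert x (side x))" using S by simp
    also have "\<dots> = insert x (C - side x)" using side(3)[OF x] xC by auto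
    finally show ?thesis by simp
  qed
qed

text \<open>Rerouting \<open>C\<close> along both chords replaces the symmetric difference of the
  sides by \<open>{x, y}\<close>. Incomparability makes the result a circuit, and it still contains
  \<open>p\<close> and \<open>q\<close>, so it has the size of \<open>C\<close> and the symmetric
  difference has two elements.\<close>

lemma incomparable_near:
  assumes x: "x \<in> chords" and y: "y \<in> chords"
    and inc: "\<not> side x \<subseteq> side y" "\<not> side y \<subseteq> side x"
  shows "card (side x - side y) = 1" "card (side y - side x) = 1"
proof -
  let ?S = "sym_diff (side x) (side y)"
  let ?Q = "{x, y} \<union> (C - ?S)"
  have xy: "x \<noteq> y" "x \<notin> C" "y \<notin> C" using x y inc by auto
  note sx = side(1-3)[OF x] and sy = side(1-3)[OF y]
  have "sym_diff (sym_diff C (insert x (side x))) (insert y (side y)) = ?Q"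
    using xy sx(3) sy(3) by auto
  then have Q: "?Q \<in> cycles M"
    using cycles_sym_diff[OF side(4)[OF y] cycles_sym_diff[OF side(4)[OF x] C_cycle]] by simp
  have proper: "C - ?S \<noteq> C" using inc sx(3) by auto
  have small: "D = {}" if D: "D \<in> cycles M" "D \<subseteq> C - ?S" for D
  proof -
    have "D \<subseteq> C" "D \<noteq> C" using D(2) proper by auto
    then show ?thesis using min_cycleD(3)[OF C D(1)] by simp
  qed
  \<comment> \<open>A cycle inside \<open>?Q\<close> using a single chord would contain a whole side
    of that chord or the complement of that side in \<open>C\<close>; either meets \<open>?S\<close>
    because the sides are incomparable.\<close>
  have one: False
    if D: "D \<in> cycles M" "D \<subseteq> ?Q" "u \<in> D" "v \<notin> D" and uv: "{u, v} = {x, y}" for D u v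
  proof -
    have u: "u \<in> chords" using uv x y by (metis insertI1 insertE singletonD)
    have "D \<subseteq> insert u (C - ?S)" using D(2,4) uv by (auto simp: doubleton_eq_iff)
    then have Du: "D \<subseteq> insert u C" "D - {u} \<subseteq> C - ?S" by auto
    have us: "insert u (side u) - {u} = side u" "insert u (C - side u) - {u} = C - side u"
      using u side(3)[OF u] by auto
    have "side u \<subseteq> C - ?S \<or> C - side u \<subseteq> C - ?S"
      using cycle_with_chord[OF u D(1,3) Du(1)] Du(2) us by metis
    moreover have "u = x \<and> v = y \<or> u = y \<and> v = x" using uv by (auto simp: doubleton_eq_iff)
    ultimately show False using inc sx(3) sy(3) by auto
  qed
  have "D = {} \<or> D = ?Q" if D: "D \<in> cycles M" "D \<subseteq> ?Q" for D
  proof -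
    consider "x \<in> D" "y \<in> D" | "x \<in> D" "y \<notin> D" | "x \<notin> D" "y \<in> D" | "x \<notin> D" "y \<notin> D" by auto
    then show ?thesis
    proof cases
      case 1
      have "?Q - D \<in> cycles M" using cycle_space_diff[OF space Q D] .
      moreover have "?Q - D \<subseteq> C - ?S" using 1 by auto
      ultimately have "?Q - D = {}" by (rule small)
      then show ?thesis using D(2) by auto
    next
      case 2 then show ?thesis using one[OF D 2] by simp
    next
      case 3 then show ?thesis using one[OF D 3(2,1)] by (simp add: insert_commute)
    next
      case 4
      then have "D \<subseteq> C - ?S" using D(2) by auto
      then show ?thesis using small[OF D(1)] by simp
    qed
  qed
  then have "min_cycle (cycles M) ?Q" using Q unfolding min_cycle_def by simp
  moreover have "p \<in> ?Q" "q \<in> ?Q" using pq sx sy by auto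
  ultimately have "card ?Q = card C" using spanning_card spanning_card[OF C pq(1,2)] by simp
  moreover have "card ?Q = 2 + card (C - ?S)"
  proof -
    have "{x, y} \<inter> (C - ?S) = {}" using xy by auto
    then show ?thesis using card_Un_disjoint[of "{x, y}" "C - ?S"] fin_C xy(1) by simp
  qed
  moreover have SC: "?S \<subseteq> C" using sx(3) sy(3) by auto
  moreover have "card (C - ?S) = card C - card ?S"
    by (rule card_Diff_subset[OF finite_subset[OF SC fin_C] SC])
  moreover have "card ?S \<le> card C" by (rule card_mono[OF fin_C SC])
  ultimately have "card ?S = 2" by linarith
  moreover have "card ?S = card (side x - side y) + card (side y - side x)"
    by (rule card_Un_disjoint) (use side(5)[OF x] side(5)[OF y] in auto)
  moreover have "0 < card (side x - side y)" "0 < card (side y - side x)"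
    using inc side(5)[OF x] side(5)[OF y] by (auto simp: card_gt_0_iff)
  ultimately show "card (side x - side y) = 1" "card (side y - side x) = 1" by linarith+
qed

text \<open>If \<open>side x\<close> were properly contained in \<open>side y\<close>, cutting the chords according to the size of
  their sides would produce a 2-separation.\<close>

lemma antichain:
  assumes x: "x \<in> chords" and y: "y \<in> chords"
  shows "\<not> side x \<subset> side y"
proof
  assume lt: "side x \<subset> side y"
  define L where "L = {z \<in> chords. card (side z) \<le> card (side x)}"
  define H where "H = chords - L"
  define U where "U = (\<Union>z \<in> L. side z)"
  have xL: "x \<in> L" using x by (simp add: L_def)
  have "card (side x) < card (side y)" using psubset_card_mono[OF side(5)[OF y] lt] .
  then have yH: "y \<in> H" using y by (simp add: H_def L_def)
  \<comment> \<open>The larger side cannot lie in the smaller, so a failure would make the sides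
    incomparable and therefore of equal size.\<close>
  have below: "side z \<subseteq> side w" if z: "z \<in> L" and w: "w \<in> H" for z w
  proof (rule ccontr)
    assume no: "\<not> side z \<subseteq> side w"
    have zw: "z \<in> chords" "w \<in> chords" "card (side z) < card (side w)"
      using z w by (auto simp: L_def H_def)
    have "\<not> side w \<subseteq> side z" using card_mono[OF side(5)[OF zw(1)]] zw(3) by (meson not_le)
    then have "card (side z - side w) = card (side w - side z)"
      using incomparable_near[OF zw(1,2) no] by simp
    then show False using card_eq_if_diff_eq[OF side(5)[OF zw(1)] side(5)[OF zw(2)]] zw(3) by simp
  qed
  have LC: "L \<subseteq> chords" "H \<subseteq> chords" by (auto simp: L_def H_def)
  have U: "U \<subseteq> C" "p \<in> U" "q \<notin> U"
    unfolding U_def using LC(1) xL side(1-3) by blast+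
  have UH: "U \<subseteq> side w" if "w \<in> H" for w using below that by (auto simp: U_def)
  have finU: "finite U" using U(1) fin_C finite_subset by blast
  have I: "U \<in> indeps M" "C - U \<in> indeps M"
    using psubset_min_cycle_indep[OF C] U pq by (metis Diff_subset DiffD2 psubsetI)+
  have "rank_of M (U \<union> L) \<le> card U"
  proof (rule rank_of_le_spanned[OF I(1)])
    fix z assume "z \<in> U \<union> L" "z \<notin> U"
    then have z: "z \<in> L" by simp
    then have "side z \<subseteq> U" by (auto simp: U_def)
    then show "\<exists>Z \<in> cycles M. z \<in> Z \<and> Z \<subseteq> insert z U"
      using side(4)[of z] z LC(1) by (intro bexI[of _ "insert z (side z)"]) auto
  qed simp
  moreover have "rank_of M ((C - U) \<union> H) \<le> card (C - U)"
  proof (rule rank_of_le_spanned[OF I(2)])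
    fix z assume "z \<in> (C - U) \<union> H" "z \<notin> C - U"
    then have z: "z \<in> H" by blast
    then have "C - side z \<subseteq> C - U" using UH by auto
    then show "\<exists>Z \<in> cycles M. z \<in> Z \<and> Z \<subseteq> insert z (C - U)"
      using side(6)[of z] z LC(2) by (intro bexI[of _ "insert z (C - side z)"]) auto
  qed simp
  moreover have "rank_of M (ground M) + 2 \<le> rank_of M (U \<union> L) + rank_of M ((C - U) \<union> H)"
  proof (rule no_two_separation)
    show "U \<union> L \<union> (C - U \<union> H) = ground M" using C_sub U(1) by (auto simp: H_def L_def)
    show "(U \<union> L) \<inter> (C - U \<union> H) = {}" using U(1) LC by (auto simp: H_def)
    have "finite (U \<union> L)" "finite (C - U \<union> H)"
      using finU fin_C finite_ground LC by (auto intro: finite_subset)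
    moreover have "{p, x} \<subseteq> U \<union> L" "{q, y} \<subseteq> C - U \<union> H" using U xL yH pq by auto
    ultimately have "card {p, x} \<le> card (U \<union> L)" "card {q, y} \<le> card (C - U \<union> H)"
      by (simp_all only: card_mono)
    moreover have "p \<noteq> x" "q \<noteq> y" using x y pq by auto
    ultimately show "2 \<le> card (U \<union> L)" "2 \<le> card (C - U \<union> H)" by auto
  qed
  \<comment> \<open>The two ranks add up to at most the size of \<open>C\<close>, which is one more
    than the rank of \<open>M\<close>.\<close>
  moreover have "card U + card (C - U) = card C"
    using card_Diff_subset[OF finU U(1)] card_mono[OF fin_C U(1)] by simp
  ultimately show False using spanning_card[OF C pq(1,2)] by linarith
qed

lemma near:
  assumes "x \<in> chords" "y \<in> chords" "x \<noteq> y"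
  shows "card (side x - side y) = 1"
  using incomparable_near(1)[OF assms(1,2)] antichain[OF assms(1,2)] antichain[OF assms(2,1)]
    side_inj[OF assms] by auto

text \<open>Otherwise \<open>c\<close> and \<open>d\<close> would be in series.\<close>

lemma separating_chord:
  assumes cd: "c \<in> C" "d \<in> C" "c \<noteq> d"
  shows "\<exists>x \<in> chords. (c \<in> side x) \<noteq> (d \<in> side x)"
proof (rule ccontr)
  assume no: "\<not> (\<exists>x \<in> chords. (c \<in> side x) \<noteq> (d \<in> side x))"
  have I: "C - {c, d} \<in> indeps M" by (rule psubset_min_cycle_indep[OF C]) (use cd(1) in auto)
  have "rank_of M (ground M - {c, d}) \<le> card (C - {c, d})"
  proof (rule rank_of_le_spanned[OF I])
    fix x assume "x \<in> ground M - {c, d}" "x \<notin> C - {c, d}"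
    then have x: "x \<in> chords" by auto
    show "\<exists>Z \<in> cycles M. x \<in> Z \<and> Z \<subseteq> insert x (C - {c, d})"
    proof (cases "c \<in> side x")
      case False
      then have "side x \<subseteq> C - {c, d}" using no x side(3)[OF x] by auto
      then show ?thesis using side(4)[OF x] by (intro bexI[of _ "insert x (side x)"]) auto
    next
      case True
      then have "C - side x \<subseteq> C - {c, d}" using no x by auto
      then show ?thesis using side(6)[OF x] by (intro bexI[of _ "insert x (C - side x)"]) auto
    qed
  qed (use C_sub in auto)
  moreover have "rank_of M {c, d} \<le> card {c, d}" by (rule rank_of_le_card) simp
  moreover have "rank_of M (ground M) + 2 \<le> rank_of M {c, d} + rank_of M (ground M - {c, d})"
  proof (rule no_two_separation)
    have "{c, d} \<subseteq> ground M" using cd C_sub by auto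
    then show "2 \<le> card (ground M - {c, d})" "{c, d} \<union> (ground M - {c, d}) = ground M"
      using big cd(3) by (auto simp: card_Diff_subset)
  qed (use cd(3) in auto)
  moreover have "card C = card (C - {c, d}) + card {c, d}"
    using card_Diff_subset[of "{c, d}" C] card_mono[OF fin_C, of "{c, d}"] cd by simp
  ultimately show False using spanning_card[OF C pq(1,2)] by linarith
qed

text \<open>\<open>near_family\<close> leaves two cases, and \<open>separating_chord\<close> makes
  both tight: a common element other than \<open>p\<close> would never be separated from
  \<open>p\<close>, and an element other than \<open>q\<close> outside the union never from
  \<open>q\<close>. Hence all sides have two elements, or all miss just one element besides
  \<open>q\<close>.\<close>

lemma side_star:
  "(\<forall>z \<in> chords. \<exists>d. side z = {p, d} \<and> d \<in> C - {p, q}) \<or>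
   (\<forall>z \<in> chords. \<exists>d. C - side z = {q, d} \<and> d \<in> C - {p, q})"
  and two_chords: "\<exists>x \<in> chords. \<exists>y \<in> chords. x \<noteq> y"
proof -
  obtain x where x: "x \<in> chords" using separating_chord[OF pq] by auto
  note sx = side(1-3)[OF x]
  have "side x \<noteq> {p}"
  proof
    assume "side x = {p}"
    then have "{x, p} \<in> cycles M" using side(4)[OF x] by simp
    then show False using no_parallel[of x p] x pq(1) by auto
  qed
  then obtain d where d: "d \<in> side x" "d \<noteq> p" using sx(1) by auto
  \<comment> \<open>Separating \<open>d\<close> from \<open>p\<close> takes a second chord, as
    \<open>side x\<close> contains both.\<close>
  then obtain y where y: "y \<in> chords" "d \<notin> side y"
    using separating_chord[of d p] sx(3) pq(1) side(1) by auto
  have xy: "x \<noteq> y" using d y by auto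
  show "\<exists>x \<in> chords. \<exists>y \<in> chords. x \<noteq> y" using x y xy by auto
  obtain a where a: "side x - side y = {a}" using near[OF x y(1) xy] by (metis card_1_singletonE)
  obtain b where b: "side y - side x = {b}" using near[OF y(1) x] xy by (metis card_1_singletonE)
  let ?I = "side x \<inter> side y"
  have card_eq: "card (side z) = card (side x)" if z: "z \<in> chords" for z
  proof (cases "z = x")
    case False
    then show ?thesis
      using card_eq_if_diff_eq[OF side(5)[OF z] side(5)[OF x]] near[OF z x] near[OF x z] by simp
  qed simp
  have cI: "card (side x) = card ?I + 1"
    using card_Int_Diff[OF side(5)[OF x], of "side y"] a by simp
  have "(\<forall>z \<in> chords. ?I \<subseteq> side z) \<or> (\<forall>z \<in> chords. side z \<subseteq> side x \<union> side y)"
    by (rule near_family[OF near x y(1) xy])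
  then show "(\<forall>z \<in> chords. \<exists>d. side z = {p, d} \<and> d \<in> C - {p, q}) \<or>
    (\<forall>z \<in> chords. \<exists>d. C - side z = {q, d} \<and> d \<in> C - {p, q})"
  proof
    assume star: "\<forall>z \<in> chords. ?I \<subseteq> side z"
    have "i = p" if i: "i \<in> ?I" for i
    proof (rule ccontr)
      assume "i \<noteq> p"
      then obtain z where "z \<in> chords" "(i \<in> side z) \<noteq> (p \<in> side z)"
        using separating_chord[of i p] i sx(3) pq(1) by auto
      then show False using star i side(1) by auto
    qed
    then have "?I = {p}" using sx(1) side(1)[OF y(1)] by auto
    then have two: "card (side x) = 2" using cI by simp
    have "\<exists>d. side z = {p, d} \<and> d \<in> C - {p, q}" if z: "z \<in> chords" for z
    proof -
      have "card (side z - {p}) = 1" using card_eq[OF z] two side(1,5)[OF z] by simp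
      then obtain d where "side z - {p} = {d}" by (metis card_1_singletonE)
      then have "side z = {p, d}" "d \<noteq> p" using side(1)[OF z] by auto
      then show ?thesis using side(2,3)[OF z] by auto
    qed
    then show ?thesis by blast
  next
    assume costar: "\<forall>z \<in> chords. side z \<subseteq> side x \<union> side y"
    have "d \<in> side x \<union> side y" if d: "d \<in> C" "d \<noteq> q" for d
    proof -
      obtain z where "z \<in> chords" "(d \<in> side z) \<noteq> (q \<in> side z)"
        using separating_chord[of d q] d pq(2) by auto
      then show ?thesis using costar side(2) by auto
    qed
    then have J: "side x \<union> side y = C - {q}" using sx side(2,3)[OF y(1)] by auto
    have "side x \<union> side y = insert b (side x)" "b \<notin> side x" using b by auto
    then have cJ: "card (C - {q}) = Suc (card (side x))" using J side(5)[OF x] by simp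
    have "\<exists>d. C - side z = {q, d} \<and> d \<in> C - {p, q}" if z: "z \<in> chords" for z
    proof -
      have sub: "side z \<subseteq> C - {q}" using side(2,3)[OF z] by auto
      then have "card (C - {q} - side z) = 1"
        using card_Diff_subset[OF side(5)[OF z] sub] card_eq[OF z] cJ by simp
      then obtain d where d: "C - {q} - side z = {d}" by (metis card_1_singletonE)
      then have "C - side z = {q, d}" using pq(2) side(2)[OF z] by auto
      moreover have "d \<in> C - {p, q}" using d side(1)[OF z] by auto
      ultimately show ?thesis by auto
    qed
    then show ?thesis by blast
  qed
qed

text \<open>Serves both alternatives at once: \<open>u\<close> is the future tip and
  \<open>v\<close> the other of \<open>p\<close> and \<open>q\<close>. Surjectivity of
  \<open>d\<close> comes from separating an element from \<open>v\<close>, which by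
  \<open>split\<close> only a chord assigned to that element can do. Two chords then give
  \<open>C\<close> at least four elements.\<close>

lemma triangles_spike:
  assumes uv: "{u, v} = {p, q}"
    and tri: "\<And>x. x \<in> chords \<Longrightarrow> d x \<in> C - {p, q} \<and> {x, u, d x} \<in> cycles M"
    and split: "\<And>x c. x \<in> chords \<Longrightarrow> c \<in> C - {p, q} \<Longrightarrow> (c \<in> side x) = (v \<in> side x) \<or> c = d x"
    and split': "\<And>x. x \<in> chords \<Longrightarrow> (d x \<in> side x) \<noteq> (v \<in> side x)"
  shows "\<exists>r \<ge> 3. isomorphic M (delete (binary_spike r) {SY r})"
proof (rule spike_isomorphic[OF C])
  show uvC: "u \<in> C" "v \<in> C" "u \<noteq> v" using uv pq by (auto simp: doubleton_eq_iff)
  have inj: "inj_on d chords"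
  proof (rule inj_onI, rule ccontr)
    fix x y assume xy: "x \<in> chords" "y \<in> chords" "d x = d y" "x \<noteq> y"
    have "sym_diff {x, u, d x} {y, u, d y} = {x, y}"
      using xy uvC(1) tri[OF xy(1)] by auto
    then have "{x, y} \<in> cycles M"
      using cycles_sym_diff[of "{y, u, d y}" M "{x, u, d x}"] tri[OF xy(1)] tri[OF xy(2)] by simp
    then show False using no_parallel[OF xy(4)] by simp
  qed
  have "C - {p, q} \<subseteq> d ` chords"
  proof
    fix c assume c: "c \<in> C - {p, q}"
    moreover have "c \<noteq> v" using c uv by auto
    ultimately obtain x where "x \<in> chords" "(c \<in> side x) \<noteq> (v \<in> side x)"
      using separating_chord[of c v] uvC(2) by auto
    then show "c \<in> d ` chords" using split[of x c] c by auto
  qed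
  then have img: "d ` chords = C - {p, q}" using tri by auto
  then show "bij_betw d chords (C - {u, v})" using inj uv by (simp add: bij_betw_def)
  obtain x y where xy: "x \<in> chords" "y \<in> chords" "x \<noteq> y" using two_chords by auto
  have "d x \<noteq> d y" using inj_onD[OF inj _ xy(1,2)] xy(3) by auto
  then have "card {d x, d y, p, q} = 4" using tri[OF xy(1)] tri[OF xy(2)] pq(3) by auto
  moreover have "{d x, d y, p, q} \<subseteq> C" using tri[OF xy(1)] tri[OF xy(2)] pq by auto
  ultimately show "4 \<le> card C" using card_mono[OF fin_C] by metis
qed (use tri in auto)

lemma spike: "\<exists>r \<ge> 3. isomorphic M (delete (binary_spike r) {SY r})"
proof -
  consider (1) "\<forall>z \<in> chords. \<exists>d. side z = {p, d} \<and> d \<in> C - {p, q}"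
    | (2) "\<forall>z \<in> chords. \<exists>d. C - side z = {q, d} \<and> d \<in> C - {p, q}"
    using side_star by auto
  then show ?thesis
  proof cases
    case 1
    then obtain d where d: "\<And>z. z \<in> chords \<Longrightarrow> side z = {p, d z} \<and> d z \<in> C - {p, q}" by metis
    show ?thesis
    proof (rule triangles_spike[of p q d])
      show "d x \<in> C - {p, q} \<and> {x, p, d x} \<in> cycles M" if "x \<in> chords" for x
        using d[OF that] side(4)[OF that] by simp
    qed (use d pq in auto)
  next
    case 2
    then obtain d where d: "\<And>z. z \<in> chords \<Longrightarrow> C - side z = {q, d z} \<and> d z \<in> C - {p, q}" by metis
    show ?thesis
    proof (rule triangles_spike[of q p d])
      show "d x \<in> C - {p, q} \<and> {x, q, d x} \<in> cycles M" if "x \<in> chords" for x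
        using d[OF that] side(6)[OF that] by simp
      fix x assume x: "x \<in> chords"
      show "(c \<in> side x) = (p \<in> side x) \<or> c = d x" if "c \<in> C - {p, q}" for c
        using d[OF x] that side(1)[OF x] by blast
      show "(d x \<in> side x) \<noteq> (p \<in> side x)"
        using d[OF x] side(1)[OF x] by blast
    qed auto
  qed
qed

end

lemma (in three_connected) pair_spanning_spike:
  assumes "pair_spanning (ground M) (cycles M) p q" "p \<in> ground M" "q \<in> ground M" "p \<noteq> q"
  shows "\<exists>r \<ge> 3. isomorphic M (delete (binary_spike r) {SY r})"
proof -
  obtain C where C: "min_cycle (cycles M) C" "p \<in> C" "q \<in> C"
    using connected_spaceD(2)[OF space_connected assms(2) _ assms(3)] by auto
  interpret chorded_circuit M p q C using assms(1,4) C by unfold_locales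
  show ?thesis by (rule spike)
qed

section \<open>The canonical decomposition\<close>

lemma two_outside:
  assumes "finite S" "card S + 2 \<le> card X"
  shows "\<exists>x \<in> X - S. \<exists>y \<in> X - S. x \<noteq> y"
proof -
  have "2 \<le> card (X - S)" using diff_card_le_card_Diff[OF assms(1), of X] assms(2) by linarith
  then obtain U where "U \<subseteq> X - S" "card U = 2" by (meson obtain_subset_with_card_n)
  then show ?thesis by (auto simp: card_2_iff)
qed

lemma isomorphic_uniform_indep:
  assumes "isomorphic N (uniform_matroid k n)"
  shows "finite (ground N)" "card (ground N) = n"
    "I \<subseteq> ground N \<Longrightarrow> I \<in> indeps N \<longleftrightarrow> card I \<le> k"
proof -
  obtain h where h: "bij_betw h (ground N) {..<n}"
    and ind: "\<And>I. I \<subseteq> ground N \<Longrightarrow> I \<in> indeps N \<longleftrightarrow> h ` I \<in> indeps (uniform_matroid k n)"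
    using assms by (auto simp: isomorphic_def uniform_matroid_def)
  show "finite (ground N)" "card (ground N) = n"
    using bij_betw_finite[OF h] bij_betw_same_card[OF h] by simp_all
  assume I: "I \<subseteq> ground N"
  have "card (h ` I) = card I" using h I by (auto simp: bij_betw_def intro: card_image inj_on_subset)
  moreover have "h ` I \<subseteq> {..<n}" using h I by (auto simp: bij_betw_def)
  ultimately show "I \<in> indeps N \<longleftrightarrow> card I \<le> k" using ind[OF I] by (simp add: uniform_matroid_def)
qed

lemma ground_circuit_label:
  assumes fin: "finite (ground N)" and C: "circuit N (ground N)" "ground N \<noteq> {}"
  shows "circuit_label (card (ground N)) N"
proof -
  let ?k = "card (ground N)"
  have k: "1 \<le> ?k" using fin C(2) by (simp add: Suc_le_eq card_gt_0_iff)
  obtain h where h: "bij_betw h (ground N) {..<?k}"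
    using ex_bij_betw_finite_nat[OF fin] by (auto simp: lessThan_atLeast0)
  have "I \<in> indeps N \<longleftrightarrow> h ` I \<in> indeps (uniform_matroid (?k - 1) ?k)" if I: "I \<subseteq> ground N" for I
  proof -
    have "card (h ` I) = card I" using h I by (auto simp: bij_betw_def intro: card_image inj_on_subset)
    moreover have "h ` I \<subseteq> {..<?k}" using h I by (auto simp: bij_betw_def)
    moreover have "I \<in> indeps N \<longleftrightarrow> I \<noteq> ground N" using C(1) I by (auto simp: circuit_def)
    moreover have "I \<noteq> ground N \<longleftrightarrow> card I < ?k"
      using psubset_card_mono[OF fin] I by blast
    ultimately show ?thesis using k by (auto simp: uniform_matroid_def)
  qed
  then have "isomorphic N (uniform_matroid (?k - 1) ?k)"
    unfolding isomorphic_def using h by (intro exI[of _ h]) (auto simp: uniform_matroid_def)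
  then show ?thesis using k by (simp add: circuit_label_def)
qed

lemma cocircuit_label_pair:
  assumes N: "cocircuit_label k N" and xy: "x \<in> ground N" "y \<in> ground N" "x \<noteq> y"
  shows "circuit N {x, y}"
proof -
  have iso: "isomorphic N (uniform_matroid 1 k)" using N by (simp add: cocircuit_label_def)
  have sub: "{x, y} \<subseteq> ground N" using xy by simp
  have "D \<in> indeps N" if D: "D \<subset> {x, y}" for D
  proof -
    have "card D < card {x, y}" using psubset_card_mono[OF _ D] by simp
    moreover have "D \<subseteq> ground N" using D sub by auto
    ultimately show ?thesis using isomorphic_uniform_indep(3)[OF iso] xy(3) by simp
  qed
  moreover have "{x, y} \<notin> indeps N" using isomorphic_uniform_indep(3)[OF iso sub] xy(3) by simp
  ultimately show ?thesis using sub by (simp add: circuit_def)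
qed

text \<open>Any two elements are parallel and at least two remain, so two-element circuits connect
  what is left.\<close>

lemma cocircuit_label_deletion_connected:
  assumes N: "cocircuit_label k N" and bin: "gf2_matroid N" and big: "3 \<le> card (ground N)"
    and con: "connected_space {} (ground N) (cycles N)"
  shows "connected_space {p} (ground N) (cycles N)"
  unfolding connected_space_def
proof (intro conjI allI ballI)
  show "{x} \<notin> cycles N" for x using connected_spaceD(1)[OF con] .
  fix x y assume x: "x \<in> ground N - {p}" and y: "y \<in> ground N - {p}"
  have pair: "\<exists>C. min_cycle (cycles N) C \<and> x \<in> C \<and> z \<in> C \<and> C \<inter> {p} = {}"
    if z: "z \<in> ground N - {p}" "z \<noteq> x" for z
    using cocircuit_label_pair[OF N, of x z] x z
    by (intro exI[of _ "{x, z}"]) (auto simp: gf2_matroid.min_cycle_iff[OF bin])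
  show "\<exists>C. min_cycle (cycles N) C \<and> x \<in> C \<and> y \<in> C \<and> C \<inter> {p} = {}"
  proof (cases "x = y")
    case False
    then show ?thesis using pair[OF y] by simp
  next
    case True
    have "\<not> ground N \<subseteq> {p, x}"
      using card_mono[of "{p, x}" "ground N"] big by (auto simp: card_insert_if split: if_splits)
    then obtain z where "z \<in> ground N - {p}" "z \<noteq> x" by auto
    then obtain C where "min_cycle (cycles N) C" "x \<in> C" "C \<inter> {p} = {}" using pair by metis
    then show ?thesis using True by (intro exI[of _ C]) simp
  qed
qed

lemma tree_decompositionD:
  assumes "tree_decomposition M T"
  shows "is_tree T" "N \<in> verts T \<Longrightarrow> matroid N" "N \<in> verts T \<Longrightarrow> connected_matroid N"
    "ground M = (\<Union>N \<in> verts T. ground N) - edges T"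
    "3 \<le> card (ground M) \<Longrightarrow> N \<in> verts T \<Longrightarrow> 3 \<le> card (ground N)"
    "\<exists>T'. contract_step\<^sup>*\<^sup>* T T' \<and> verts T' = {M} \<and> edges T' = {}"
proof -
  note td = assms[unfolded tree_decomposition_def]
  show "is_tree T" using td by (elim conjE)
  show "matroid N" if "N \<in> verts T" using td that by (elim conjE) blast
  show "connected_matroid N" if "N \<in> verts T" using td that by (elim conjE) blast
  show "ground M = (\<Union>N \<in> verts T. ground N) - edges T" using td by (elim conjE)
  have "if card (ground M) < 3 then verts T = {M} else \<forall>N \<in> verts T. 3 \<le> card (ground N)"
    using td by (elim conjE)
  then show "3 \<le> card (ground N)" if "3 \<le> card (ground M)" "N \<in> verts T" using that by simp
  show "\<exists>T'. contract_step\<^sup>*\<^sup>* T T' \<and> verts T' = {M} \<and> edges T' = {}"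
    using td by (elim conjE)
qed

lemma tree_decomposition_incidence:
  assumes td: "tree_decomposition M T"
  shows "incidence T"
proof -
  have T: "is_tree T" using td by (simp add: tree_decomposition_def)
  have meet: "ground A \<inter> ground B = {p}"
    if "A \<in> verts T" "B \<in> verts T" "A \<noteq> B" "p \<in> edges T" "ends T p = {A, B}" for A B p
    using td that unfolding tree_decomposition_def by metis
  have apart: "ground A \<inter> ground B = {}"
    if "A \<in> verts T" "B \<in> verts T" "A \<noteq> B" "\<not> adjacent T A B" for A B
    using td that unfolding tree_decomposition_def by metis
  have shared: "x \<in> edges T \<and> ends T x = {A, B}"
    if "A \<in> verts T" "B \<in> verts T" "A \<noteq> B" "x \<in> ground A" "x \<in> ground B" for A B x
  proof -
    have "adjacent T A B" using apart[OF that(1-3)] that(4,5) by auto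
    then obtain p where p: "p \<in> edges T" "ends T p = {A, B}" by (auto simp: adjacent_def)
    then have "x = p" using meet[OF that(1-3) p] that(4,5) by auto
    then show ?thesis using p by simp
  qed
  show ?thesis
    unfolding incidence_def
  proof (intro conjI ballI allI impI)
    fix p assume p: "p \<in> edges T"
    show "ends T p \<subseteq> verts T" "card (ends T p) = 2" using is_treeD(5,6)[OF T p] by auto
    fix N assume N: "N \<in> verts T"
    obtain A B where AB: "A \<noteq> B" "ends T p = {A, B}"
      using is_treeD(6)[OF T p] by (auto simp: card_2_iff)
    have V: "A \<in> verts T" "B \<in> verts T" using is_treeD(5)[OF T p] AB by auto
    have pAB: "p \<in> ground A" "p \<in> ground B" using meet[OF V AB(1) p AB(2)] by auto
    show "p \<in> ground N \<longleftrightarrow> N \<in> ends T p"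
    proof
      assume "N \<in> ends T p"
      then show "p \<in> ground N" using AB(2) pAB by auto
    next
      assume pN: "p \<in> ground N"
      show "N \<in> ends T p"
      proof (cases "N = A")
        case True
        then show ?thesis using AB by simp
      next
        case False
        then show ?thesis using shared[OF N V(1) False pN pAB(1)] by auto
      qed
    qed
  next
    fix A B x assume "A \<in> verts T" "B \<in> verts T" "x \<in> ground A" "x \<in> ground B" "x \<notin> edges T"
    then show "A = B" using shared[of A B x] by auto
  qed (use is_treeD[OF T] in auto)
qed

text \<open>Empty cycles at all other labels complete \<open>Z\<close> to a compatible family, as
  there is no edge to be matched.\<close>

lemma (in label_tree) nonedge_cycle:
  assumes N: "N \<in> V" and Z: "Z \<in> cycles N" "Z \<inter> edges T = {}"
  shows "Z \<in> K V"
proof -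
  define z where "z A = (if A = N then Z else {})" for A
  have "compatible T V z"
    using Z cycles.empty unfolding compatible_def inner_edges_verts[OF inc] by (auto simp: z_def)
  moreover have "(\<Union>A \<in> V. z A) - inner_edges T V = Z"
    unfolding inner_edges_verts[OF inc] using N Z(2) by (auto simp: z_def split: if_splits)
  ultimately show ?thesis unfolding part_cycles_def by blast
qed

text \<open>Rules out the degenerate clause of \<open>tree_decomposition\<close> for fewer than
  three elements, so that every label has at least three.\<close>

lemma simple_matroid_large:
  assumes M: "matroid M" "simple_matroid M" "connected_matroid M"
    and ef: "e \<in> ground M" "f \<in> ground M" "e \<noteq> f"
  shows "3 \<le> card (ground M)"
proof -
  obtain C where C: "circuit M C" "e \<in> C" "f \<in> C"
    using M(3) ef unfolding connected_matroid_def by metis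
  have "\<not> circuit M {e, f}" using M(2) ef(3) by (auto simp: simple_matroid_def)
  then have "C \<noteq> {e, f}" using C(1) by auto
  then obtain g where g: "g \<in> C" "g \<noteq> e" "g \<noteq> f" using C by auto
  have "{e, f, g} \<subseteq> ground M" using C circuit_subset_ground[OF C(1)] g(1) by auto
  then have "card {e, f, g} \<le> card (ground M)" using card_mono matroid.finite_ground[OF M(1)] by metis
  then show ?thesis using g ef(3) by auto
qed

lemma simple_matroid_cycles:
  assumes M: "gf2_matroid M" "simple_matroid M" and xy: "x \<noteq> y"
  shows "{x, y} \<notin> cycles M"
proof
  assume "{x, y} \<in> cycles M"
  then obtain C where C: "circuit M C" "C \<subseteq> {x, y}"
    using gf2_matroid.contains_circuit[OF M(1)] by auto
  then have "C = {x} \<or> C = {y} \<or> C = {x, y}"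
    using gf2_matroid.circuit_nonempty[OF M(1) C(1)] by auto
  then show False using C(1) M(2) xy by (auto simp: simple_matroid_def)
qed

theorem theorem1p2:
  fixes M :: "'a pre_matroid" and e f :: 'a and T :: "'a matroid_graph"
  assumes "matroid M" and "simple_matroid M" and "connected_matroid M" and "binary_matroid M"
    and "e \<in> ground M" and "f \<in> ground M" and "e \<noteq> f"
    and "\<And>C. circuit M C \<Longrightarrow> {e, f} \<subseteq> C \<Longrightarrow> spanning M C"
    and "canonical_tree_decomposition M T"
  shows "\<exists>P. is_path T P \<and>
           (\<forall>N \<in> set P. (\<exists>k \<ge> 3. circuit_label k N) \<or>
                        isomorphic N (uniform_matroid 1 3) \<or>
                        (\<exists>r \<ge> 3. isomorphic N (delete (binary_spike r) {SY r}))) \<and>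
           \<not> isomorphic (hd P) (uniform_matroid 1 3) \<and>
           \<not> isomorphic (last P) (uniform_matroid 1 3)"
proof -
  have dep: "cycles_dependent M" using binary_cycles_dependent assms(1,4) by blast
  then have bM: "gf2_matroid M"
    using assms(1) by (simp add: gf2_matroid_def gf2_matroid_axioms_def)
  have td: "tree_decomposition M T" using assms(9) by (simp add: canonical_tree_decomposition_def)
  have tree: "is_tree T" using tree_decompositionD(1)[OF td] .
  have inc: "incidence T" using tree_decomposition_incidence[OF td] .
  obtain T' where T': "contract_step\<^sup>*\<^sup>* T T'" "verts T' = {M}" "edges T' = {}"
    using tree_decompositionD(6)[OF td] by auto
  have glob: "\<forall>N \<in> verts T. cycles_dependent N" "part_cycles T (verts T) = cycles M"
    using contract_steps_cycles[OF T' dep inc tree_sparse[OF tree]] by auto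
  have big: "3 \<le> card (ground M)" using simple_matroid_large[OF assms(1-3,5-7)] .
  have lab: "matroid N" "connected_matroid N" "3 \<le> card (ground N)" if "N \<in> verts T" for N
    by (fact tree_decompositionD(2)[OF td that] tree_decompositionD(3)[OF td that]
        tree_decompositionD(5)[OF td big that])+
  interpret label_tree T
    using tree inc lab glob(1) by (simp add: label_tree_def)
  have gM: "ground M = (\<Union>N \<in> V. ground N) - edges T"
    by (rule tree_decompositionD(4)[OF td])
  then have GV: "G V = ground M" by (simp add: part_ground_def inner_edges_verts[OF inc])
  have simple: "{x, y} \<notin> K V" if "x \<noteq> y" for x y
    using simple_matroid_cycles[OF bM assms(2) that] glob(2) by simp
  have span: "pair_spanning (G V) (K V) e f"
    using gf2_matroid.pair_spanning_cycles[OF bM assms(8)] GV glob(2) by simp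
  have trichotomy: "(\<exists>k. circuit_label k N) \<or> (\<exists>k. cocircuit_label k N) \<or> three_connected N"
    if N: "N \<in> V" for N
    using assms(9) N label_binary[OF N] lab(2)[OF N]
    unfolding canonical_tree_decomposition_def three_connected_def three_connected_axioms_def by blast
  \<comment> \<open>In the canonical decomposition the neighbour of a circuit label is no circuit,
    and the two remaining kinds of labels stay connected after deleting an element.\<close>
  have deletion: "connected_space {p} (ground A) (cycles A)"
    if p: "p \<in> edges T" "ends T p = {A, B}" and B: "min_cycle (cycles B) (ground B)" for A B p
  proof -
    have V: "A \<in> V" "B \<in> V" "p \<in> ground A" using edge_in_label[OF p(1)] p(2) by auto
    have "circuit B (ground B)" using B gf2_matroid.min_cycle_iff[OF label_binary[OF V(2)]] by simp
    moreover have "finite (ground B)" "ground B \<noteq> {}"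
      using matroid.finite_ground[OF lab(1)[OF V(2)]] min_cycleD(2)[OF B] by auto
    ultimately have "circuit_label (card (ground B)) B" using ground_circuit_label by blast
    moreover have "adjacent T A B" using p by (auto simp: adjacent_def)
    ultimately have "\<nexists>k. circuit_label k A"
      using assms(9) unfolding canonical_tree_decomposition_def by metis
    then consider k where "cocircuit_label k A" | "three_connected A" using trichotomy[OF V(1)] by auto
    then show ?thesis
    proof cases
      case 1
      then show ?thesis
        by (rule cocircuit_label_deletion_connected[OF _ label_binary[OF V(1)] lab(3)[OF V(1)]
            label_space(2)[OF V(1)]])
    next
      case 2
      then show ?thesis by (rule three_connected.deletion_connected[OF _ V(3)])
    qed
  qed
  obtain Ne Nf where Ne: "Ne \<in> V" "e \<in> ground Ne" "e \<notin> edges T"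
    and Nf: "Nf \<in> V" "f \<in> ground Nf" "f \<notin> edges T"
    using assms(5,6) gM by auto
  obtain P where P: "P \<noteq> []" "hd P = Ne" "last P = Nf" "distinct P" "set P \<subseteq> V"
    "successively (adjacent T) P"
    using grown_path[OF tree_grown[OF tree Ne(1)] Ne(1) Nf(1)] by metis
  have PV: "set P = V"
    using path_covers[OF simple deletion P(1,5,6) _ _ _ _ span] Ne Nf P(2,3) by simp
  have ends: "\<exists>e' f'. e' \<noteq> f' \<and> e' \<in> ground N \<and> f' \<in> ground N \<and>
      pair_spanning (ground N) (cycles N) e' f' \<and> edges T \<inter> ground N \<subseteq> {e', f'} \<and>
      (N = hd P \<longrightarrow> e' \<notin> edges T) \<and> (N = last P \<longrightarrow> f' \<notin> edges T)"
    if N: "N \<in> set P" for N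
  proof -
    obtain xs ys where eq: "P = xs @ N # ys" using split_list[OF N] by auto
    have "hd (xs @ [N]) = Ne" "last (N # ys) = Nf"
      using P(2,3) unfolding eq by (cases xs; simp)+
    then have 1: "e \<in> ground (hd (xs @ [N]))" "f \<in> ground (last (N # ys))"
      using Ne(2) Nf(2) by simp_all
    have 2: "N = hd P \<longrightarrow> xs = []" using P(4) unfolding eq by (cases xs) auto
    have 3: "N = last P \<longrightarrow> ys = []" using P(4) unfolding eq by (auto simp: last_in_set)
    show ?thesis
      using path_label[OF P(4)[unfolded eq] PV[unfolded eq] P(6)[unfolded eq] 1(1) Ne(3) 1(2) Nf(3)
          assms(7) span] 2 3 by metis
  qed
  \<comment> \<open>Elements of a cocircuit label are parallel; a pair without edges would stay
    parallel in the simple matroid \<open>M\<close>.\<close>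
  have few_nonedges: "x = y"
    if N: "N \<in> V" "cocircuit_label k N" and xy: "x \<in> ground N - edges T" "y \<in> ground N - edges T"
    for N k x y
  proof (rule ccontr)
    assume ne: "x \<noteq> y"
    have "circuit N {x, y}" using cocircuit_label_pair[OF N(2)] xy ne by auto
    then have "{x, y} \<in> K V" using nonedge_cycle[OF N(1) circuit_in_cycles] xy by auto
    then show False using simple ne by auto
  qed
  have three: "k = 3 \<and> N \<noteq> hd P \<and> N \<noteq> last P" if N: "N \<in> set P" "cocircuit_label k N" for N k
  proof -
    have NV: "N \<in> V" using N(1) PV by simp
    obtain e' f' where ef: "edges T \<inter> ground N \<subseteq> {e', f'}" "N = hd P \<longrightarrow> e' \<notin> edges T"
      "N = last P \<longrightarrow> f' \<notin> edges T" using ends[OF N(1)] by metis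
    have k: "card (ground N) = k" "3 \<le> k"
      using N(2) isomorphic_uniform_indep(2) lab(3)[OF NV] by (auto simp: cocircuit_label_def)
    \<comment> \<open>With at most one non-edge the size exceeds the number of edges by at most one:
      two edges give at most 3, and at an end one edge gives at most 2, which is too small.\<close>
    have bound: "k \<le> card S + 1" if S: "finite S" "edges T \<inter> ground N \<subseteq> S" for S
    proof (rule ccontr)
      assume "\<not> k \<le> card S + 1"
      then obtain x y where "x \<in> ground N - S" "y \<in> ground N - S" "x \<noteq> y"
        using two_outside[OF S(1), of "ground N"] k(1) by auto
      then show False using few_nonedges[OF NV N(2), of x y] S(2) by auto
    qed
    have "k \<le> 3" using bound[of "{e', f'}"] ef(1) card_insert_le_m1[of 2 "{f'}" e'] by simp
    moreover have "N \<noteq> hd P" using bound[of "{f'}"] ef(1,2) k(2) by auto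
    moreover have "N \<noteq> last P" using bound[of "{e'}"] ef(1,3) k(2) by auto
    ultimately show ?thesis using k(2) by simp
  qed
  have "(\<exists>k \<ge> 3. circuit_label k N) \<or> isomorphic N (uniform_matroid 1 3) \<or>
      (\<exists>r \<ge> 3. isomorphic N (delete (binary_spike r) {SY r}))" if N: "N \<in> set P" for N
  proof -
    have NV: "N \<in> V" using N PV by simp
    consider k where "circuit_label k N" | k where "cocircuit_label k N" | "three_connected N"
      using trichotomy[OF NV] by auto
    then show ?thesis
    proof cases
      case (1 k)
      then have "3 \<le> k"
        using isomorphic_uniform_indep(2)[of N] lab(3)[OF NV] by (auto simp: circuit_label_def)
      then show ?thesis using 1 by auto
    next
      case (2 k)
      then show ?thesis using three[OF N 2] by (auto simp: cocircuit_label_def)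
    next
      case 3
      then show ?thesis using three_connected.pair_spanning_spike[OF 3] ends[OF N] by metis
    qed
  qed
  moreover have "\<not> isomorphic N (uniform_matroid 1 3)" if "N = hd P \<or> N = last P" for N
  proof
    assume "isomorphic N (uniform_matroid 1 3)"
    then have "cocircuit_label 3 N" by (simp add: cocircuit_label_def)
    moreover have "N \<in> set P" using that P(1) by auto
    ultimately show False using three that by blast
  qed
  ultimately show ?thesis
    using spanning_list_is_path[OF tree P(1,4) PV P(6)] by blast
qed

end
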